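(* Let $T$ be an integral domain, $M$ a maximal ideal of $T$, $K=T/M$ its residue field, $\phi:T\to K$ the canonical surjection, and $D$ a proper subring of $K$. Let $R=\phi^{-1}(D)$ be the pullback of $D\hookrightarrow K$ along $\phi$. Then $R$ is a Krull-type domain if and only if $D$ is a semilocal Bézout domain with quotient field $K$ and $T$ is a Krull-type domain such that $T_M$ is a valuation domain.
   Context: All rings are integral domains. For a domain $A$ with quotient field $F$ and a nonzero fractional ideal $I$ of $A$, put $I^{-1}=\{x\in F : xI\subseteq A\}$, $I_v=(I^{-1})^{-1}$, and $I_t=\bigcup J_v$, where $J$ ranges over the nonzero finitely generated fractional ideals contained in $I$. $I$ is a $t$-ideal if it is nonzero and $I_t=I$. A $t$-maximal ideal is a maximal element of the set of proper integral $t$-ideals of $A$. $A$ is a PVMD if $A_N$ is a valuation domain for each $t$-maximal ideal $N$ of $A$. A Krull-type domain is a PVMD of finite $t$-character, i.e., a PVMD in which each nonzero nonunit is contained in only finitely many $t$-maximal ideals. Semilocal means having only finitely many maximal ideals.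
   Formalization: The maximal ideal M is assumed nonzero (T is not a field); without this the claim fails, e.g. for T = K = Q, M = 0, D = Z, where R = Z is a Krull-type domain but D is not semilocal. *)

theory Defs
  imports "HOL-Algebra.Algebra"
begin

section \<open>The quotient field of a domain\<close>

definition frac_rel :: "('a, 'm) ring_scheme \<Rightarrow> (('a \<times> 'a) \<times> ('a \<times> 'a)) set" where
  "frac_rel A = {((a, b), (c, d)).
     a \<in> carrier A \<and> b \<in> carrier A - {\<zero>\<^bsub>A\<^esub>} \<and> c \<in> carrier A \<and> d \<in> carrier A - {\<zero>\<^bsub>A\<^esub>} \<and>
     a \<otimes>\<^bsub>A\<^esub> d = c \<otimes>\<^bsub>A\<^esub> b}"

definition fraction :: "('a, 'm) ring_scheme \<Rightarrow> 'a \<Rightarrow> 'a \<Rightarrow> ('a \<times> 'a) set" where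
  "fraction A a b = frac_rel A `` {(a, b)}"

definition frac_field :: "('a, 'm) ring_scheme \<Rightarrow> ('a \<times> 'a) set ring" where
  "frac_field A =
    \<lparr>carrier = (carrier A \<times> (carrier A - {\<zero>\<^bsub>A\<^esub>})) // frac_rel A,
     monoid.mult = (\<lambda>U W. \<Union>(a, b)\<in>U. \<Union>(c, d)\<in>W. fraction A (a \<otimes>\<^bsub>A\<^esub> c) (b \<otimes>\<^bsub>A\<^esub> d)),
     one = fraction A \<one>\<^bsub>A\<^esub> \<one>\<^bsub>A\<^esub>,
     ring.zero = fraction A \<zero>\<^bsub>A\<^esub> \<one>\<^bsub>A\<^esub>,
     ring.add = (\<lambda>U W. \<Union>(a, b)\<in>U. \<Union>(c, d)\<in>W.
              fraction A ((a \<otimes>\<^bsub>A\<^esub> d) \<oplus>\<^bsub>A\<^esub> (c \<otimes>\<^bsub>A\<^esub> b)) (b \<otimes>\<^bsub>A\<^esub> d))\<rparr>"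

definition frac_embed :: "('a, 'm) ring_scheme \<Rightarrow> 'a \<Rightarrow> ('a \<times> 'a) set" where
  "frac_embed A a = fraction A a \<one>\<^bsub>A\<^esub>"

definition is_quotient_field :: "('f, 'm) ring_scheme \<Rightarrow> 'f set \<Rightarrow> bool" where
  "is_quotient_field F A \<longleftrightarrow> field F \<and> subring A F \<and>
     carrier F = {a \<otimes>\<^bsub>F\<^esub> inv\<^bsub>F\<^esub> b |a b. a \<in> A \<and> b \<in> A - {\<zero>\<^bsub>F\<^esub>}}"


section \<open>Fractional ideals, the \<open>v\<close>- and the \<open>t\<close>-operation\<close>

text \<open>Throughout this section \<open>F\<close> is a field and \<open>A\<close> is a subring with quotient field \<open>F\<close>.
  The integral ideals of \<open>A\<close> are the fractional ideals contained in \<open>A\<close>, and an abstract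
  domain is later identified with its image in its quotient field.\<close>

definition submodule_in :: "('f, 'm) ring_scheme \<Rightarrow> 'f set \<Rightarrow> 'f set \<Rightarrow> bool" where
  "submodule_in F A I \<longleftrightarrow> additive_subgroup I F \<and> (\<forall>a\<in>A. \<forall>x\<in>I. a \<otimes>\<^bsub>F\<^esub> x \<in> I)"

definition nonzero_fractional_ideal :: "('f, 'm) ring_scheme \<Rightarrow> 'f set \<Rightarrow> 'f set \<Rightarrow> bool" where
  "nonzero_fractional_ideal F A I \<longleftrightarrow> submodule_in F A I \<and> I \<noteq> {\<zero>\<^bsub>F\<^esub>} \<and>
     (\<exists>d\<in>A - {\<zero>\<^bsub>F\<^esub>}. \<forall>x\<in>I. d \<otimes>\<^bsub>F\<^esub> x \<in> A)"

definition finitely_generated_in :: "('f, 'm) ring_scheme \<Rightarrow> 'f set \<Rightarrow> 'f set \<Rightarrow> bool" where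
  "finitely_generated_in F A I \<longleftrightarrow>
     (\<exists>S. finite S \<and> S \<subseteq> carrier F \<and> I = \<Inter>{L. submodule_in F A L \<and> S \<subseteq> L})"

definition ideal_inverse :: "('f, 'm) ring_scheme \<Rightarrow> 'f set \<Rightarrow> 'f set \<Rightarrow> 'f set" where
  "ideal_inverse F A I = {x \<in> carrier F. \<forall>y\<in>I. x \<otimes>\<^bsub>F\<^esub> y \<in> A}"

definition v_closure :: "('f, 'm) ring_scheme \<Rightarrow> 'f set \<Rightarrow> 'f set \<Rightarrow> 'f set" where
  "v_closure F A I = ideal_inverse F A (ideal_inverse F A I)"

definition t_closure :: "('f, 'm) ring_scheme \<Rightarrow> 'f set \<Rightarrow> 'f set \<Rightarrow> 'f set" where
  "t_closure F A I = \<Union>{v_closure F A J |J.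
     nonzero_fractional_ideal F A J \<and> finitely_generated_in F A J \<and> J \<subseteq> I}"

definition t_ideal :: "('f, 'm) ring_scheme \<Rightarrow> 'f set \<Rightarrow> 'f set \<Rightarrow> bool" where
  "t_ideal F A I \<longleftrightarrow> nonzero_fractional_ideal F A I \<and> t_closure F A I = I"

definition t_maximal :: "('f, 'm) ring_scheme \<Rightarrow> 'f set \<Rightarrow> 'f set \<Rightarrow> bool" where
  "t_maximal F A N \<longleftrightarrow> t_ideal F A N \<and> N \<subset> A \<and>
     (\<forall>I. t_ideal F A I \<and> I \<subset> A \<and> N \<subseteq> I \<longrightarrow> I = N)"

definition localization_in ::
    "('f, 'm) ring_scheme \<Rightarrow> 'f set \<Rightarrow> 'f set \<Rightarrow> ('f, 'm) ring_scheme" where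
  "localization_in F A P =
     F\<lparr>carrier := {a \<otimes>\<^bsub>F\<^esub> inv\<^bsub>F\<^esub> s |a s. a \<in> A \<and> s \<in> A - P}\<rparr>"


section \<open>Classes of domains\<close>

definition localization :: "('a, 'm) ring_scheme \<Rightarrow> 'a set \<Rightarrow> ('a \<times> 'a) set ring" where
  "localization A P =
     localization_in (frac_field A) (frac_embed A ` carrier A) (frac_embed A ` P)"

definition valuation_domain :: "('a, 'm) ring_scheme \<Rightarrow> bool" where
  "valuation_domain V \<longleftrightarrow> domain V \<and>
     (\<forall>a\<in>carrier V. \<forall>b\<in>carrier V. a divides\<^bsub>V\<^esub> b \<or> b divides\<^bsub>V\<^esub> a)"

definition PVMD :: "('a, 'm) ring_scheme \<Rightarrow> bool" where
  "PVMD A \<longleftrightarrow> domain A \<and>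
     (\<forall>N. t_maximal (frac_field A) (frac_embed A ` carrier A) N \<longrightarrow>
        valuation_domain (localization_in (frac_field A) (frac_embed A ` carrier A) N))"

definition finite_t_character :: "('a, 'm) ring_scheme \<Rightarrow> bool" where
  "finite_t_character A \<longleftrightarrow>
     (\<forall>x\<in>carrier A - {\<zero>\<^bsub>A\<^esub>} - Units A.
        finite {N. t_maximal (frac_field A) (frac_embed A ` carrier A) N \<and> frac_embed A x \<in> N})"

definition Krull_type_domain :: "('a, 'm) ring_scheme \<Rightarrow> bool" where
  "Krull_type_domain A \<longleftrightarrow> PVMD A \<and> finite_t_character A"

definition Bezout_domain :: "('a, 'm) ring_scheme \<Rightarrow> bool" where
  "Bezout_domain A \<longleftrightarrow> domain A \<and>
     (\<forall>S. finite S \<and> S \<subseteq> carrier A \<longrightarrow> principalideal (Idl\<^bsub>A\<^esub> S) A)"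

definition semilocal :: "('a, 'm) ring_scheme \<Rightarrow> bool" where
  "semilocal A \<longleftrightarrow> finite {P. maximalideal P A}"


section \<open>The pullback\<close>

definition pullback_ring :: "('a, 'm) ring_scheme \<Rightarrow> 'a set \<Rightarrow> 'a set set \<Rightarrow> ('a, 'm) ring_scheme" where
  "pullback_ring T M D = T\<lparr>carrier := {x \<in> carrier T. M +>\<^bsub>T\<^esub> x \<in> D}\<rparr>"

end

theory Submission
  imports Defs
begin

text \<open>Write \<open>R\<close> for the pullback, so that \<open>M\<close> is a common ideal of \<open>R \<subseteq> T\<close> and \<open>R / M = D\<close>. All notions
involved can be read off from divisibility in the domain itself: an element \<open>x\<close> belongs to the
\<open>v\<close>-closure of a finite set \<open>S\<close> not contained in \<open>{0}\<close> exactly when, for all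
\<open>a\<close> and \<open>b\<close> such that \<open>b\<close> divides every \<open>a s\<close> with \<open>s \<in> S\<close>, \<open>b\<close> also divides \<open>a x\<close>;
and the localization at a prime \<open>P\<close> is a valuation domain exactly when any two elements \<open>a\<close>, \<open>b\<close> admit some \<open>s \<notin> P\<close> with \<open>b\<close> dividing \<open>s a\<close> or \<open>a\<close> dividing \<open>s b\<close>; such \<open>P\<close>
are called essential. This gives \<open>Krull_type_domain_iff\<close> and lets the rest of the argument take place
inside \<open>T\<close>.

Multiplying by an element of \<open>M\<close> moves divisibility statements between \<open>T\<close> and \<open>R\<close>. Away from \<open>M\<close>
this makes contraction to \<open>R\<close> preserve \<open>t\<close>-closed primes and essential primes, and every
\<open>t\<close>-maximal ideal of \<open>R\<close> not containing \<open>M\<close> is contracted from a \<open>t\<close>-maximal ideal of \<open>T\<close>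
(\<open>max_t_closed_R_is_contraction\<close>). The ideals of \<open>R\<close> above \<open>M\<close> are governed by \<open>D\<close>, so the theorem
reduces to understanding the ideals above \<open>M\<close>.

If \<open>R\<close> is of Krull type, then \<open>M\<close>, being the conductor of \<open>T\<close> in \<open>R\<close>, is \<open>t\<close>-closed in \<open>R\<close>, hence lies
in a \<open>t\<close>-maximal ideal and is essential. This makes \<open>T\<close> localized at \<open>M\<close> a valuation domain and \<open>K\<close>
the quotient field of \<open>D\<close>. Two primes inside one essential prime are comparable; therefore a
\<open>t\<close>-maximal ideal of \<open>T\<close> other than \<open>M\<close> cannot contract into a \<open>t\<close>-maximal ideal of \<open>R\<close> above \<open>M\<close>,
and it contracts to a \<open>t\<close>-maximal ideal (\<open>max_t_closed_T_contracts\<close>). So \<open>T\<close> is of Krull type. An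
element of \<open>R\<close> outside all \<open>t\<close>-maximal ideals above \<open>M\<close> is a unit modulo \<open>M\<close> (\<open>unit_modulo_M\<close>).
There are only finitely many of these ideals, because all of them contain one nonzero element of
\<open>M\<close>, and prime avoidance shows that the maximal ideals of \<open>R\<close> above \<open>M\<close> are among them. Hence \<open>D\<close>
is semilocal and its localizations at maximal ideals are valuation domains, which for semilocal
domains is the same as being Bezout (\<open>semilocal_Bezout_iff\<close>).

Conversely, if \<open>D\<close> is semilocal and Bezout with quotient field \<open>K\<close> and \<open>M\<close> is essential in \<open>T\<close>, then
every maximal ideal of \<open>R\<close> above \<open>M\<close> is essential (\<open>essential_over_M\<close>): this is the composition of
the valuation of \<open>T\<close> at \<open>M\<close> with a valuation of \<open>K\<close>. Essential primes are \<open>t\<close>-closed, so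
the \<open>t\<close>-maximal ideals of \<open>R\<close> above \<open>M\<close> are exactly these finitely many maximal ideals, and all
others are contracted from the \<open>t\<close>-maximal ideals of \<open>T\<close>, which is of Krull type.\<close>

section \<open>Maximal members of finitary closure systems\<close>

text \<open>Zorn's lemma for the sets closed under an operation \<open>h\<close> on finite sets: the union of a chain of
closed sets is closed since a finite subset of the union already lies in one member. Both ideals
and \<open>t\<close>-closed ideals are closed sets of this kind.\<close>

lemma maximal_finitary_closed_set:
  assumes "\<And>S. finite S \<Longrightarrow> S \<subseteq> I \<Longrightarrow> h S \<subseteq> I" and "u \<notin> I"
  obtains N where "I \<subseteq> N" "u \<notin> N" "\<And>S. finite S \<Longrightarrow> S \<subseteq> N \<Longrightarrow> h S \<subseteq> N"
    "\<And>J. \<lbrakk> N \<subseteq> J; u \<notin> J; \<And>S. finite S \<Longrightarrow> S \<subseteq> J \<Longrightarrow> h S \<subseteq> J \<rbrakk> \<Longrightarrow> J = N"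
proof -
  define \<A> where "\<A> = {J. I \<subseteq> J \<and> u \<notin> J \<and> (\<forall>S. finite S \<longrightarrow> S \<subseteq> J \<longrightarrow> h S \<subseteq> J)}"
  have ne: "\<A> \<noteq> {}" using assms by (auto simp: \<A>_def)
  have "\<exists>N\<in>\<A>. \<forall>J\<in>\<A>. N \<subseteq> J \<longrightarrow> J = N"
  proof (rule subset_Zorn_nonempty[OF ne])
    fix \<C> assume C: "\<C> \<noteq> {}" "subset.chain \<A> \<C>"
    have CA: "\<C> \<subseteq> \<A>" using C(2) by (simp add: subset_chain_def)
    have "h S \<subseteq> \<Union>\<C>" if S: "finite S" "S \<subseteq> \<Union>\<C>" for S
    proof -
      obtain J where "J \<in> \<C>" "S \<subseteq> J"
        by (rule finite_subset_Union_chain[OF S C])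
      then show ?thesis using CA S(1) unfolding \<A>_def by blast
    qed
    moreover have "I \<subseteq> \<Union>\<C>" "u \<notin> \<Union>\<C>" using C(1) CA unfolding \<A>_def by blast+
    ultimately show "\<Union>\<C> \<in> \<A>" unfolding \<A>_def by blast
  qed
  then obtain N where N: "N \<in> \<A>" "\<And>J. J \<in> \<A> \<Longrightarrow> N \<subseteq> J \<Longrightarrow> J = N" by blast
  have props: "I \<subseteq> N" "u \<notin> N" "\<forall>S. finite S \<longrightarrow> S \<subseteq> N \<longrightarrow> h S \<subseteq> N"
    using N(1) unfolding \<A>_def by blast+
  show ?thesis
  proof (rule that[OF props(1,2)])
    show "h S \<subseteq> N" if "finite S" "S \<subseteq> N" for S using props(3) that by simp
    fix J assume J: "N \<subseteq> J" "u \<notin> J" "\<And>S. finite S \<Longrightarrow> S \<subseteq> J \<Longrightarrow> h S \<subseteq> J"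
    then have "J \<in> \<A>" using props(1) unfolding \<A>_def by simp
    then show "J = N" using N(2) J(1) by simp
  qed
qed

lemma (in ring) maximalideal_exists:
  assumes "ideal I R" and "\<one> \<notin> I"
  obtains N where "maximalideal N R" "I \<subseteq> N"
proof -
  have gen: "Idl S \<subseteq> J" if "ideal J R" "S \<subseteq> J" for S J
    by (rule genideal_minimal[OF that])
  have fin: "ideal J R" if cl: "\<And>S. finite S \<Longrightarrow> S \<subseteq> J \<Longrightarrow> S \<subseteq> carrier R \<and> Idl S \<subseteq> J" for J
  proof (rule idealI)
    have J: "J \<subseteq> carrier R" using cl[of "{_}"] by auto
    have mem: "x \<in> J" if "ideal K R \<Longrightarrow> S \<subseteq> K \<Longrightarrow> x \<in> K" "K = Idl S" "finite S" "S \<subseteq> J" for S K x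
      using that cl[of S] J genideal_ideal[of S] genideal_self[of S] by blast
    show "ring R" by (rule ring_axioms)
    show "subgroup J (add_monoid R)"
    proof (rule add.subgroupI)
      show "J \<noteq> {}" using mem[of "Idl {}" "{}" "\<zero>"]
        by (auto simp: additive_subgroup.zero_closed ideal.axioms(1))
      fix a assume a: "a \<in> J"
      show "\<ominus> a \<in> J" by (rule mem[of "Idl {a}" "{a}"])
          (use a in \<open>auto simp: additive_subgroup.a_inv_closed ideal.axioms(1)\<close>)
      fix b assume b: "b \<in> J"
      show "a \<oplus> b \<in> J" by (rule mem[of "Idl {a,b}" "{a,b}"])
          (use a b in \<open>auto simp: additive_subgroup.a_closed ideal.axioms(1)\<close>)
    qed (rule J)
    fix a x assume a: "a \<in> J" and x: "x \<in> carrier R"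
    show "x \<otimes> a \<in> J" by (rule mem[of "Idl {a}" "{a}"])
        (use a x in \<open>auto simp: ideal.I_l_closed\<close>)
    show "a \<otimes> x \<in> J" by (rule mem[of "Idl {a}" "{a}"])
        (use a x in \<open>auto simp: ideal.I_r_closed\<close>)
  qed
  \<comment> \<open>sets reaching outside the ring get the whole type as hull, so closed proper sets stay inside it\<close>
  define h where "h S = (if S \<subseteq> carrier R then Idl S else UNIV)" for S
  have closed_iff: "(\<forall>S. finite S \<longrightarrow> S \<subseteq> J \<longrightarrow> h S \<subseteq> J) \<longleftrightarrow> ideal J R" if "\<one> \<notin> J" for J
  proof
    assume *: "\<forall>S. finite S \<longrightarrow> S \<subseteq> J \<longrightarrow> h S \<subseteq> J"
    show "ideal J R"
    proof (rule fin)
      fix S assume "finite S" "S \<subseteq> J"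
      then have "h S \<subseteq> J" using * by blast
      then show "S \<subseteq> carrier R \<and> Idl S \<subseteq> J" using that by (auto simp: h_def split: if_splits)
    qed
  next
    assume J: "ideal J R"
    then have "J \<subseteq> carrier R" by (simp add: additive_subgroup.a_subset ideal.axioms(1))
    then show "\<forall>S. finite S \<longrightarrow> S \<subseteq> J \<longrightarrow> h S \<subseteq> J" using gen[OF J] by (auto simp: h_def)
  qed
  obtain N where N: "I \<subseteq> N" "\<one> \<notin> N" "\<And>S. finite S \<Longrightarrow> S \<subseteq> N \<Longrightarrow> h S \<subseteq> N"
    "\<And>J. \<lbrakk> N \<subseteq> J; \<one> \<notin> J; \<And>S. finite S \<Longrightarrow> S \<subseteq> J \<Longrightarrow> h S \<subseteq> J \<rbrakk> \<Longrightarrow> J = N"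
    by (rule maximal_finitary_closed_set[of I h "\<one>"]) (use closed_iff[of I] assms in auto)
  have NI: "ideal N R" using closed_iff[of N] N by blast
  have "maximalideal N R"
  proof (rule maximalidealI[OF NI])
    show "carrier R \<noteq> N" using N(2) by auto
    fix J assume J: "ideal J R" "N \<subseteq> J" "J \<subseteq> carrier R"
    show "J = N \<or> J = carrier R"
      using N(4)[of J] closed_iff[of J] J ideal.one_imp_carrier[OF J(1)] by blast
  qed
  then show ?thesis using that N(1) by blast
qed

section \<open>Divisorial hulls and essential primes\<close>

text \<open>The \<open>v\<close>-closure, computed without fractions. For a finite \<open>S\<close> containing a nonzero element this is the
\<open>v\<close>-closure of the ideal generated by \<open>S\<close>, because the fractions \<open>a / b\<close> with \<open>b\<close> dividing all
\<open>a s\<close> form the inverse of that ideal. Allowing \<open>b = 0\<close> makes the hull of the empty set and of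
\<open>{0}\<close> equal to \<open>{0}\<close> without a case distinction.\<close>

definition v_hull :: "('a, 'm) ring_scheme \<Rightarrow> 'a set \<Rightarrow> 'a set" where
  "v_hull A S = {x \<in> carrier A. \<forall>a\<in>carrier A. \<forall>b\<in>carrier A.
     (\<forall>s\<in>S. b divides\<^bsub>A\<^esub> (a \<otimes>\<^bsub>A\<^esub> s)) \<longrightarrow> b divides\<^bsub>A\<^esub> (a \<otimes>\<^bsub>A\<^esub> x)}"

definition t_closed :: "('a, 'm) ring_scheme \<Rightarrow> 'a set \<Rightarrow> bool" where
  "t_closed A I \<longleftrightarrow> I \<subseteq> carrier A \<and> (\<forall>S. finite S \<longrightarrow> S \<subseteq> I \<longrightarrow> v_hull A S \<subseteq> I)"

text \<open>The \<open>t\<close>-maximal ideals; properness is expressed by \<open>1 \<notin> N\<close>.\<close>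

definition max_t_closed :: "('a, 'm) ring_scheme \<Rightarrow> 'a set \<Rightarrow> bool" where
  "max_t_closed A N \<longleftrightarrow> t_closed A N \<and> N \<noteq> {\<zero>\<^bsub>A\<^esub>} \<and> \<one>\<^bsub>A\<^esub> \<notin> N \<and>
     (\<forall>I. t_closed A I \<and> \<one>\<^bsub>A\<^esub> \<notin> I \<and> N \<subseteq> I \<longrightarrow> I = N)"

text \<open>The fraction-free form of the localization at \<open>P\<close> being a valuation domain.\<close>

definition essential :: "('a, 'm) ring_scheme \<Rightarrow> 'a set \<Rightarrow> bool" where
  "essential A P \<longleftrightarrow> (\<forall>a\<in>carrier A. \<forall>b\<in>carrier A. \<exists>s\<in>carrier A - P.
     b divides\<^bsub>A\<^esub> (s \<otimes>\<^bsub>A\<^esub> a) \<or> a divides\<^bsub>A\<^esub> (s \<otimes>\<^bsub>A\<^esub> b))"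

lemma v_hullI:
  assumes "x \<in> carrier A"
    and "\<And>a b. \<lbrakk> a \<in> carrier A; b \<in> carrier A; \<And>s. s \<in> S \<Longrightarrow> b divides\<^bsub>A\<^esub> (a \<otimes>\<^bsub>A\<^esub> s) \<rbrakk>
           \<Longrightarrow> b divides\<^bsub>A\<^esub> (a \<otimes>\<^bsub>A\<^esub> x)"
  shows "x \<in> v_hull A S"
  using assms by (simp add: v_hull_def)

lemma v_hullD:
  assumes "x \<in> v_hull A S" "a \<in> carrier A" "b \<in> carrier A"
    and "\<And>s. s \<in> S \<Longrightarrow> b divides\<^bsub>A\<^esub> (a \<otimes>\<^bsub>A\<^esub> s)"
  shows "b divides\<^bsub>A\<^esub> (a \<otimes>\<^bsub>A\<^esub> x)"
  using assms by (simp add: v_hull_def)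

lemma v_hull_carrier: "x \<in> v_hull A S \<Longrightarrow> x \<in> carrier A"
  by (simp add: v_hull_def)

lemma t_closedD: "\<lbrakk> t_closed A I; finite S; S \<subseteq> I; x \<in> v_hull A S \<rbrakk> \<Longrightarrow> x \<in> I"
  by (auto simp: t_closed_def)

lemma t_closed_subset: "t_closed A I \<Longrightarrow> I \<subseteq> carrier A"
  by (simp add: t_closed_def)

lemma max_t_closedD:
  assumes "max_t_closed A N"
  shows "t_closed A N" "N \<noteq> {\<zero>\<^bsub>A\<^esub>}" "\<one>\<^bsub>A\<^esub> \<notin> N"
    "\<And>I. \<lbrakk> t_closed A I; \<one>\<^bsub>A\<^esub> \<notin> I; N \<subseteq> I \<rbrakk> \<Longrightarrow> I = N"
  using assms by (auto simp: max_t_closed_def)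

lemma essentialE:
  assumes "essential A P" "a \<in> carrier A" "b \<in> carrier A"
  obtains s c where "s \<in> carrier A" "s \<notin> P" "c \<in> carrier A" "s \<otimes>\<^bsub>A\<^esub> a = b \<otimes>\<^bsub>A\<^esub> c"
  | s c where "s \<in> carrier A" "s \<notin> P" "c \<in> carrier A" "s \<otimes>\<^bsub>A\<^esub> b = a \<otimes>\<^bsub>A\<^esub> c"
  using assms unfolding essential_def factor_def by blast

lemma essentialI:
  assumes "\<And>a b. \<lbrakk> a \<in> carrier A; b \<in> carrier A \<rbrakk> \<Longrightarrow> \<exists>s\<in>carrier A - P. \<exists>c\<in>carrier A.
      s \<otimes>\<^bsub>A\<^esub> a = b \<otimes>\<^bsub>A\<^esub> c \<or> s \<otimes>\<^bsub>A\<^esub> b = a \<otimes>\<^bsub>A\<^esub> c"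
  shows "essential A P"
  unfolding essential_def factor_def using assms by blast

lemma essential_subset: "essential A Q \<Longrightarrow> P \<subseteq> Q \<Longrightarrow> essential A P"
  unfolding essential_def by blast

context domain
begin

lemma v_hull_self: "S \<subseteq> carrier R \<Longrightarrow> s \<in> S \<Longrightarrow> s \<in> v_hull R S"
  by (auto simp: v_hull_def)

text \<open>Sums and multiples of elements of \<open>S\<close> lie in the hull of \<open>S\<close>, so closedness under hulls of
finite sets already forces a \<open>t\<close>-closed set to be an ideal.\<close>

lemma t_closed_ideal:
  assumes "t_closed R I" shows "ideal I R"
proof (rule idealI)
  have I: "I \<subseteq> carrier R" by (rule t_closed_subset[OF assms])
  show "ring R" by (rule ring_axioms)
  have l: "x \<otimes> a \<in> I" if "a \<in> I" "x \<in> carrier R" for a x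
  proof (rule t_closedD[OF assms, of "{a}"])
    have "b divides (c \<otimes> (x \<otimes> a))" if "b divides (c \<otimes> a)" "b \<in> carrier R" "c \<in> carrier R" for b c
    proof -
      have "c \<otimes> (x \<otimes> a) = (c \<otimes> a) \<otimes> x" using I \<open>a \<in> I\<close> \<open>x \<in> carrier R\<close> that by (auto simp: m_ac)
      then show ?thesis using that I \<open>a \<in> I\<close> \<open>x \<in> carrier R\<close> by (auto intro: divides_prod_r)
    qed
    then show "x \<otimes> a \<in> v_hull R {a}" using that I by (intro v_hullI) auto
  qed (use that in auto)
  then show "\<And>a x. a \<in> I \<Longrightarrow> x \<in> carrier R \<Longrightarrow> x \<otimes> a \<in> I" .
  then show "\<And>a x. a \<in> I \<Longrightarrow> x \<in> carrier R \<Longrightarrow> a \<otimes> x \<in> I"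
    using I m_comm by (metis subsetD)
  show "subgroup I (add_monoid R)"
  proof (rule add.subgroupI)
    have "\<zero> \<in> v_hull R {}" by (rule v_hullI) (simp_all add: divides_zero)
    then have "\<zero> \<in> I" by (rule t_closedD[OF assms, rotated -1]) simp_all
    then show "I \<noteq> {}" by blast
    fix a assume a: "a \<in> I"
    have "(\<ominus> \<one>) \<otimes> a \<in> I" using l[OF a, of "\<ominus> \<one>"] by simp
    then show "\<ominus> a \<in> I" using I a by (simp add: l_minus subset_iff)
    fix b assume b: "b \<in> I"
    show "a \<oplus> b \<in> I"
    proof (rule t_closedD[OF assms, of "{a,b}"])
      show "a \<oplus> b \<in> v_hull R {a, b}"
      proof (rule v_hullI)
        show "a \<oplus> b \<in> carrier R" using a b I by auto
        fix c d assume c: "c \<in> carrier R" "d \<in> carrier R" "\<And>s. s \<in> {a,b} \<Longrightarrow> d divides (c \<otimes> s)"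
        then obtain e f where "e \<in> carrier R" "f \<in> carrier R" "c \<otimes> a = d \<otimes> e" "c \<otimes> b = d \<otimes> f"
          unfolding factor_def by (metis insertI1 insertI2)
        then have "c \<otimes> (a \<oplus> b) = d \<otimes> (e \<oplus> f)" using a b c I by (simp add: r_distr subset_iff)
        then show "d divides (c \<otimes> (a \<oplus> b))"
          using \<open>e \<in> carrier R\<close> \<open>f \<in> carrier R\<close> by (auto simp: factor_def)
      qed
    qed (use a b in auto)
  qed (rule I)
qed

lemma t_closed_in_max_t_closed:
  assumes "t_closed R I" "I \<noteq> {\<zero>}" "\<one> \<notin> I"
  obtains N where "max_t_closed R N" "I \<subseteq> N"
proof -
  \<comment> \<open>the value outside the ring forces closed proper sets to consist of ring elements\<close>
  define h where "h S = (if S \<subseteq> carrier R then v_hull R S else UNIV)" for S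
  have cl: "(\<forall>S. finite S \<longrightarrow> S \<subseteq> J \<longrightarrow> h S \<subseteq> J) \<longleftrightarrow> t_closed R J" if "\<one> \<notin> J" for J
  proof
    assume *: "\<forall>S. finite S \<longrightarrow> S \<subseteq> J \<longrightarrow> h S \<subseteq> J"
    have J: "J \<subseteq> carrier R"
    proof
      fix x assume "x \<in> J"
      then have "h {x} \<subseteq> J" using * by blast
      then show "x \<in> carrier R" using that by (auto simp: h_def split: if_splits)
    qed
    then show "t_closed R J" using * by (auto simp: t_closed_def h_def split: if_splits)
  qed (auto simp: t_closed_def h_def)
  obtain N where N: "I \<subseteq> N" "\<one> \<notin> N" "\<And>S. finite S \<Longrightarrow> S \<subseteq> N \<Longrightarrow> h S \<subseteq> N"
    "\<And>J. \<lbrakk> N \<subseteq> J; \<one> \<notin> J; \<And>S. finite S \<Longrightarrow> S \<subseteq> J \<Longrightarrow> h S \<subseteq> J \<rbrakk> \<Longrightarrow> J = N"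
    by (rule maximal_finitary_closed_set[of I h "\<one>"]) (use cl[of I] assms in auto)
  have "\<zero> \<in> I" using t_closed_ideal[OF assms(1)] by (simp add: additive_subgroup.zero_closed ideal.axioms(1))
  then have "N \<noteq> {\<zero>}" using N(1) assms(2) by blast
  then have "max_t_closed R N"
    unfolding max_t_closed_def using N(1-3) cl[of N]
    by (intro conjI allI impI) (simp, simp, simp, metis N(4) cl)
  then show ?thesis using that N(1) by blast
qed

text \<open>For \<open>b \<notin> N\<close> the colon set of all \<open>x\<close> with \<open>b x \<in> N\<close> is again proper and \<open>t\<close>-closed and contains
\<open>N\<close>, hence equals \<open>N\<close> by maximality.\<close>

lemma max_t_closed_prime:
  assumes "max_t_closed R N" shows "primeideal N R"
proof (rule primeidealI)
  note N = max_t_closedD[OF assms]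
  show idl: "ideal N R" by (rule t_closed_ideal[OF N(1)])
  show "cring R" by (rule is_cring)
  show "carrier R \<noteq> N" using N(3) by auto
  have Nc: "N \<subseteq> carrier R" by (rule t_closed_subset[OF N(1)])
  fix a b assume a: "a \<in> carrier R" and b: "b \<in> carrier R" and ab: "a \<otimes> b \<in> N"
  show "a \<in> N \<or> b \<in> N"
  proof (rule disjCI)
    assume "b \<notin> N"
    define Q where "Q = {x \<in> carrier R. b \<otimes> x \<in> N}"
    have "t_closed R Q"
      unfolding t_closed_def
    proof (intro conjI allI impI subsetI)
      fix S x assume S: "finite S" "S \<subseteq> Q" and x: "x \<in> v_hull R S"
      have xc: "x \<in> carrier R" using x by (rule v_hull_carrier)
      have "b \<otimes> x \<in> v_hull R ((\<otimes>) b ` S)"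
      proof (rule v_hullI)
        fix c d assume cd: "c \<in> carrier R" "d \<in> carrier R"
          and "\<And>s. s \<in> (\<otimes>) b ` S \<Longrightarrow> d divides (c \<otimes> s)"
        then have "d divides (c \<otimes> (b \<otimes> s))" if "s \<in> S" for s using that by blast
        then have "d divides ((c \<otimes> b) \<otimes> s)" if "s \<in> S" for s
          using that S(2) m_assoc[OF cd(1) b, of s] by (auto simp: Q_def)
        then have "d divides ((c \<otimes> b) \<otimes> x)" using v_hullD[OF x] cd b by simp
        then show "d divides (c \<otimes> (b \<otimes> x))" by (simp only: m_assoc[OF cd(1) b xc])
      qed (use b xc in simp)
      moreover have "(\<otimes>) b ` S \<subseteq> N" using S(2) by (auto simp: Q_def)
      ultimately have "b \<otimes> x \<in> N" using t_closedD[OF N(1)] S(1) by blast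
      then show "x \<in> Q" using xc by (simp add: Q_def)
    qed (auto simp: Q_def)
    moreover have "\<one> \<notin> Q" using \<open>b \<notin> N\<close> b by (simp add: Q_def)
    moreover have "N \<subseteq> Q" using ideal.I_l_closed[OF idl] b Nc by (auto simp: Q_def)
    ultimately have "Q = N" by (rule N(4))
    then show "a \<in> N" using ab a m_comm[OF a b] by (auto simp: Q_def)
  qed
qed

text \<open>In a valuation domain a finitely generated ideal is generated by one of its generators. The
factor \<open>u\<close> clears the denominators.\<close>

lemma essential_divisor_of_finite_set:
  assumes "primeideal P R" "essential R P" and "finite S" "S \<noteq> {}" "S \<subseteq> carrier R"
  shows "\<exists>s\<in>S. \<exists>u\<in>carrier R - P. \<forall>s'\<in>S. s divides (u \<otimes> s')"
proof -
  interpret P: primeideal P R by fact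
  show ?thesis using assms(3-5)
  proof (induction S rule: finite_ne_induct)
    case (singleton x)
    then show ?case using P.I_notcarr P.one_imp_carrier by (intro bexI[of _ x] bexI[of _ "\<one>"]) auto
  next
    case (insert x S)
    then obtain s u where su: "s \<in> S" "u \<in> carrier R" "u \<notin> P" "\<And>s'. s' \<in> S \<Longrightarrow> s divides (u \<otimes> s')" by auto
    have c: "x \<in> carrier R" "s \<in> carrier R" using insert su by auto
    from assms(2) c show ?case
    proof (cases rule: essentialE)
      case (1 w d)
      have nP: "u \<otimes> w \<in> carrier R - P" using su 1 P.I_prime by auto
      have "s divides ((u \<otimes> w) \<otimes> s')" if "s' \<in> insert x S" for s'
      proof (cases "s' = x")
        case True
        have "(u \<otimes> w) \<otimes> x = u \<otimes> (s \<otimes> d)" using 1 su c by (simp add: m_assoc)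
        also have "\<dots> = s \<otimes> (u \<otimes> d)" using 1 su c by (simp add: m_ac)
        finally show ?thesis using 1 su True by (auto simp: factor_def)
      next
        case False
        then have s': "s' \<in> S" using that by auto
        have s'c: "s' \<in> carrier R" using s' insert by auto
        have "(u \<otimes> w) \<otimes> s' = (u \<otimes> s') \<otimes> w" using 1 su s'c by (simp add: m_ac)
        then show ?thesis using su(4)[OF s'] 1 su c s'c by (auto intro: divides_prod_r)
      qed
      then show ?thesis using nP su(1) by (intro bexI[of _ s] bexI[of _ "u \<otimes> w"]) auto
    next
      case (2 w d)
      have nP: "w \<otimes> u \<in> carrier R - P" using su 2 P.I_prime by auto
      have "x divides ((w \<otimes> u) \<otimes> s')" if "s' \<in> insert x S" for s'
      proof (cases "s' = x")
        case True
        have "(w \<otimes> u) \<otimes> x = x \<otimes> (w \<otimes> u)" using 2 su c by (simp add: m_comm)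
        then show ?thesis using 2 su True by (auto simp: factor_def)
      next
        case False
        then have s': "s' \<in> S" using that by auto
        have s'c: "s' \<in> carrier R" using s' insert by auto
        obtain e where e: "e \<in> carrier R" "u \<otimes> s' = s \<otimes> e" using su(4)[OF s'] by (auto simp: factor_def)
        have "(w \<otimes> u) \<otimes> s' = w \<otimes> (s \<otimes> e)" using 2 su c s'c e by (simp add: m_assoc)
        also have "\<dots> = (w \<otimes> s) \<otimes> e" using 2(1) c(2) e(1) by (simp add: m_assoc)
        also have "\<dots> = x \<otimes> (d \<otimes> e)" unfolding 2(4) using 2(1,3) c e(1) by (simp add: m_assoc)
        finally show ?thesis using 2 e by (auto simp: factor_def)
      qed
      then show ?thesis using nP by (intro bexI[of _ x] bexI[of _ "w \<otimes> u"]) auto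
    qed
  qed
qed

text \<open>If the finite set \<open>S \<subseteq> P\<close> is generated locally by its member \<open>s\<close>, say \<open>s\<close> divides \<open>u s'\<close> for all
\<open>s' \<in> S\<close>, then the definition of the hull with \<open>a = u\<close> and \<open>b = s\<close> gives \<open>u x \<in> P\<close> for each \<open>x\<close> in
the hull, and \<open>u \<notin> P\<close>.\<close>

lemma essential_prime_t_closed:
  assumes "primeideal P R" "essential R P" shows "t_closed R P"
proof -
  interpret P: primeideal P R by fact
  show ?thesis
    unfolding t_closed_def
  proof (intro conjI allI impI subsetI)
    show "x \<in> carrier R" if "x \<in> P" for x using that by (rule P.Icarr)
    fix S x assume S: "finite S" "S \<subseteq> P" and x: "x \<in> v_hull R S"
    have xc: "x \<in> carrier R" using x by (rule v_hull_carrier)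
    show "x \<in> P"
    proof (cases "S = {}")
      case True
      then have "\<zero> divides (\<one> \<otimes> x)" using v_hullD[OF x, of \<one> \<zero>] by simp
      then show ?thesis using xc by (auto simp: factor_def)
    next
      case False
      obtain s u where su: "s \<in> S" "u \<in> carrier R" "u \<notin> P" "\<And>s'. s' \<in> S \<Longrightarrow> s divides (u \<otimes> s')"
        using essential_divisor_of_finite_set[OF assms S(1) False] S(2) P.Icarr by blast
      have sP: "s \<in> P" using su S by blast
      have "s divides (u \<otimes> x)" using v_hullD[OF x su(2)] su(4) sP P.Icarr by blast
      then have "u \<otimes> x \<in> P" using sP P.I_r_closed by (auto simp: factor_def)
      then show ?thesis using P.I_prime su xc by blast
    qed
  qed
qed

text \<open>The prime ideals of a valuation domain form a chain.\<close>

lemma primes_in_essential_comparable: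
  assumes "primeideal P R" "primeideal P' R" "essential R Q" "P \<subseteq> Q" "P' \<subseteq> Q"
  shows "P \<subseteq> P' \<or> P' \<subseteq> P"
proof (rule ccontr)
  interpret P: primeideal P R by fact
  interpret P': primeideal P' R by fact
  assume "\<not> ?thesis"
  then obtain a b where ab: "a \<in> P" "a \<notin> P'" "b \<in> P'" "b \<notin> P" by blast
  from assms(3) P.Icarr[OF ab(1)] P'.Icarr[OF ab(3)] show False
  proof (cases rule: essentialE)
    case (1 s c)
    then have "s \<otimes> a \<in> P'" using ab P'.I_r_closed by simp
    then show False using P'.I_prime 1 ab assms(5) P.Icarr by blast
  next
    case (2 s c)
    then have "s \<otimes> b \<in> P" using ab P.I_r_closed by simp
    then show False using P.I_prime 2 ab assms(4) P'.Icarr by blast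
  qed
qed

end

section \<open>The field of fractions\<close>

context domain
begin

lemma frac_rel_iff:
  "((a, b), (c, d)) \<in> frac_rel R \<longleftrightarrow> a \<in> carrier R \<and> b \<in> carrier R - {\<zero>} \<and>
     c \<in> carrier R \<and> d \<in> carrier R - {\<zero>} \<and> a \<otimes> d = c \<otimes> b"
  by (simp add: frac_rel_def)

lemma frac_rel_trans:
  assumes "((a, b), (c, d)) \<in> frac_rel R" "((c, d), (e, f)) \<in> frac_rel R"
  shows "((a, b), (e, f)) \<in> frac_rel R"
proof -
  have c: "a \<in> carrier R" "b \<in> carrier R - {\<zero>}" "c \<in> carrier R" "d \<in> carrier R - {\<zero>}"
    "e \<in> carrier R" "f \<in> carrier R - {\<zero>}" and eq: "a \<otimes> d = c \<otimes> b" "c \<otimes> f = e \<otimes> d"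
    using assms by (auto simp: frac_rel_iff)
  have "d \<otimes> (a \<otimes> f) = (a \<otimes> d) \<otimes> f" using c by (simp add: m_ac)
  also have "\<dots> = (c \<otimes> f) \<otimes> b" unfolding eq(1) using c by (simp add: m_ac)
  also have "\<dots> = d \<otimes> (e \<otimes> b)" unfolding eq(2) using c by (simp add: m_ac)
  finally have "a \<otimes> f = e \<otimes> b" using c m_lcancel[of d "a \<otimes> f" "e \<otimes> b"] by auto
  then show ?thesis using c by (simp add: frac_rel_iff)
qed

lemma frac_rel_equiv: "equiv (carrier R \<times> (carrier R - {\<zero>})) (frac_rel R)"
proof (rule equivI)
  show "frac_rel R \<subseteq> (carrier R \<times> (carrier R - {\<zero>})) \<times> (carrier R \<times> (carrier R - {\<zero>}))"
    by (auto simp: frac_rel_def)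
  show "refl_on (carrier R \<times> (carrier R - {\<zero>})) (frac_rel R)"
    by (auto simp: refl_on_def frac_rel_iff)
  show "sym (frac_rel R)" by (auto simp: sym_def frac_rel_iff)
  show "trans (frac_rel R)" by (rule transI) (metis frac_rel_trans surj_pair)
qed

lemma fraction_eq_iff:
  assumes "a \<in> carrier R" "b \<in> carrier R - {\<zero>}" "c \<in> carrier R" "d \<in> carrier R - {\<zero>}"
  shows "fraction R a b = fraction R c d \<longleftrightarrow> a \<otimes> d = c \<otimes> b"
  unfolding fraction_def using eq_equiv_class_iff[OF frac_rel_equiv, of "(a,b)" "(c,d)"] assms
  by (simp add: frac_rel_iff)

lemma fraction_closed:
  assumes "a \<in> carrier R" "b \<in> carrier R - {\<zero>}"
  shows "fraction R a b \<in> carrier (frac_field R)"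
  unfolding frac_field_def fraction_def using assms by (simp add: quotientI)

lemma frac_fieldE:
  assumes "U \<in> carrier (frac_field R)"
  obtains a b where "a \<in> carrier R" "b \<in> carrier R - {\<zero>}" "U = fraction R a b"
  using assms unfolding frac_field_def fraction_def by (auto elim!: quotientE)

text \<open>The operations of the field of fractions are unions over representatives; this evaluates such a
union when the value does not depend on the representatives.\<close>

lemma Union_over_fractions:
  assumes ab: "a \<in> carrier R" "b \<in> carrier R - {\<zero>}" and cd: "c \<in> carrier R" "d \<in> carrier R - {\<zero>}"
    and eq: "\<And>a' b' c' d'. \<lbrakk> a' \<in> carrier R; b' \<in> carrier R - {\<zero>}; c' \<in> carrier R; d' \<in> carrier R - {\<zero>};
      a \<otimes> b' = a' \<otimes> b; c \<otimes> d' = c' \<otimes> d \<rbrakk> \<Longrightarrow> f a' b' c' d' = Y"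
  shows "(\<Union>(a', b')\<in>fraction R a b. \<Union>(c', d')\<in>fraction R c d. f a' b' c' d') = Y"
proof -
  have ne: "(a, b) \<in> fraction R a b" "(c, d) \<in> fraction R c d"
    using ab cd by (auto simp: fraction_def frac_rel_iff)
  have "f a' b' c' d' = Y" if "(a', b') \<in> fraction R a b" "(c', d') \<in> fraction R c d" for a' b' c' d'
    using that by (intro eq) (auto simp: fraction_def frac_rel_iff)
  then show ?thesis using ne by (auto split: prod.splits) blast
qed

lemma frac_mult:
  assumes "a \<in> carrier R" "b \<in> carrier R - {\<zero>}" "c \<in> carrier R" "d \<in> carrier R - {\<zero>}"
  shows "fraction R a b \<otimes>\<^bsub>frac_field R\<^esub> fraction R c d = fraction R (a \<otimes> c) (b \<otimes> d)"
proof -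
  have rep: "fraction R (a' \<otimes> c') (b' \<otimes> d') = fraction R (a \<otimes> c) (b \<otimes> d)"
    if "a' \<in> carrier R" "b' \<in> carrier R - {\<zero>}" "c' \<in> carrier R" "d' \<in> carrier R - {\<zero>}"
      "a \<otimes> b' = a' \<otimes> b" "c \<otimes> d' = c' \<otimes> d" for a' b' c' d'
  proof -
    have "(a' \<otimes> c') \<otimes> (b \<otimes> d) = (a' \<otimes> b) \<otimes> (c' \<otimes> d)" using that(1-4) assms by (simp add: m_ac)
    also have "\<dots> = (a \<otimes> b') \<otimes> (c \<otimes> d')" using that(5,6) by simp
    also have "\<dots> = (a \<otimes> c) \<otimes> (b' \<otimes> d')" using that(1-4) assms by (simp add: m_ac)
    finally show ?thesis using that(1-4) assms by (subst fraction_eq_iff) (auto simp: integral_iff)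
  qed
  from Union_over_fractions[OF assms rep] show ?thesis by (simp add: frac_field_def)
qed

lemma frac_add:
  assumes "a \<in> carrier R" "b \<in> carrier R - {\<zero>}" "c \<in> carrier R" "d \<in> carrier R - {\<zero>}"
  shows "fraction R a b \<oplus>\<^bsub>frac_field R\<^esub> fraction R c d = fraction R (a \<otimes> d \<oplus> c \<otimes> b) (b \<otimes> d)"
proof -
  have rep: "fraction R (a' \<otimes> d' \<oplus> c' \<otimes> b') (b' \<otimes> d') = fraction R (a \<otimes> d \<oplus> c \<otimes> b) (b \<otimes> d)"
    if "a' \<in> carrier R" "b' \<in> carrier R - {\<zero>}" "c' \<in> carrier R" "d' \<in> carrier R - {\<zero>}"
      "a \<otimes> b' = a' \<otimes> b" "c \<otimes> d' = c' \<otimes> d" for a' b' c' d'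
  proof -
    have "(a' \<otimes> d' \<oplus> c' \<otimes> b') \<otimes> (b \<otimes> d) = (a' \<otimes> b) \<otimes> (d \<otimes> d') \<oplus> (c' \<otimes> d) \<otimes> (b \<otimes> b')"
      using that(1-4) assms by (simp add: l_distr r_distr m_ac)
    also have "\<dots> = (a \<otimes> b') \<otimes> (d \<otimes> d') \<oplus> (c \<otimes> d') \<otimes> (b \<otimes> b')" using that(5,6) by simp
    also have "\<dots> = (a \<otimes> d \<oplus> c \<otimes> b) \<otimes> (b' \<otimes> d')" using that(1-4) assms by (simp add: l_distr r_distr m_ac)
    finally show ?thesis using that(1-4) assms by (subst fraction_eq_iff) (auto simp: integral_iff)
  qed
  from Union_over_fractions[OF assms rep] show ?thesis by (simp add: frac_field_def)
qed

lemma frac_one: "\<one>\<^bsub>frac_field R\<^esub> = fraction R \<one> \<one>"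
  and frac_zero: "\<zero>\<^bsub>frac_field R\<^esub> = fraction R \<zero> \<one>"
  by (simp_all add: frac_field_def)

lemma frac_field_is_field: "field (frac_field R)"
proof -
  let ?F = "frac_field R"
  have nz: "b \<otimes> d \<in> carrier R - {\<zero>}" if "b \<in> carrier R - {\<zero>}" "d \<in> carrier R - {\<zero>}" for b d
    using that by (auto simp: integral_iff)
  have abel: "abelian_group ?F"
  proof (rule abelian_groupI)
    fix x y assume xy: "x \<in> carrier ?F" "y \<in> carrier ?F"
    obtain a b c d where ab: "a \<in> carrier R" "b \<in> carrier R - {\<zero>}" "x = fraction R a b"
      and cd: "c \<in> carrier R" "d \<in> carrier R - {\<zero>}" "y = fraction R c d"
      using xy by (elim frac_fieldE)
    show "x \<oplus>\<^bsub>?F\<^esub> y \<in> carrier ?F"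
      unfolding ab cd using ab cd nz[of b d] by (simp add: frac_add fraction_closed)
    show "x \<oplus>\<^bsub>?F\<^esub> y = y \<oplus>\<^bsub>?F\<^esub> x"
      unfolding ab cd using ab(1,2) cd(1,2) nz[of b d] nz[of d b]
      by (simp add: frac_add fraction_eq_iff a_comm m_comm)
    fix z assume "z \<in> carrier ?F"
    then obtain e f where ef: "e \<in> carrier R" "f \<in> carrier R - {\<zero>}" "z = fraction R e f"
      by (elim frac_fieldE)
    have "((a \<otimes> d \<oplus> c \<otimes> b) \<otimes> f \<oplus> e \<otimes> (b \<otimes> d)) \<otimes> (b \<otimes> (d \<otimes> f)) =
          (a \<otimes> (d \<otimes> f) \<oplus> (c \<otimes> f \<oplus> e \<otimes> d) \<otimes> b) \<otimes> (b \<otimes> d \<otimes> f)"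
      using ab(1,2) cd(1,2) ef(1,2) by (simp add: l_distr r_distr m_ac a_ac)
    then show "x \<oplus>\<^bsub>?F\<^esub> y \<oplus>\<^bsub>?F\<^esub> z = x \<oplus>\<^bsub>?F\<^esub> (y \<oplus>\<^bsub>?F\<^esub> z)"
      unfolding ab cd ef using ab(1,2) cd(1,2) ef(1,2) nz[of b d] nz[of d f]
        nz[OF nz[of b d], of f] nz[OF _ nz[of d f], of b]
      by (simp add: frac_add fraction_eq_iff)
  next
    show "\<zero>\<^bsub>?F\<^esub> \<in> carrier ?F" by (simp add: frac_zero fraction_closed)
    fix x assume x: "x \<in> carrier ?F"
    then obtain a b where ab: "a \<in> carrier R" "b \<in> carrier R - {\<zero>}" "x = fraction R a b"
      by (elim frac_fieldE)
    show "\<zero>\<^bsub>?F\<^esub> \<oplus>\<^bsub>?F\<^esub> x = x"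
      unfolding ab frac_zero using ab(1,2) by (simp add: frac_add)
    have "fraction R (\<ominus> a) b \<oplus>\<^bsub>?F\<^esub> x = \<zero>\<^bsub>?F\<^esub>"
      unfolding ab frac_zero using ab(1,2) nz[of b b]
      by (simp add: frac_add fraction_eq_iff l_minus l_neg)
    then show "\<exists>y\<in>carrier ?F. y \<oplus>\<^bsub>?F\<^esub> x = \<zero>\<^bsub>?F\<^esub>"
      using ab by (intro bexI[of _ "fraction R (\<ominus> a) b"]) (auto intro: fraction_closed)
  qed
  have mon: "Group.comm_monoid ?F"
  proof (rule comm_monoidI)
    show "\<one>\<^bsub>?F\<^esub> \<in> carrier ?F" by (simp add: frac_one fraction_closed)
    fix x y assume xy: "x \<in> carrier ?F" "y \<in> carrier ?F"
    obtain a b c d where ab: "a \<in> carrier R" "b \<in> carrier R - {\<zero>}" "x = fraction R a b"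
      and cd: "c \<in> carrier R" "d \<in> carrier R - {\<zero>}" "y = fraction R c d"
      using xy by (elim frac_fieldE)
    show "x \<otimes>\<^bsub>?F\<^esub> y \<in> carrier ?F"
      unfolding ab cd using ab cd nz[of b d] by (simp add: frac_mult fraction_closed)
    show "\<one>\<^bsub>?F\<^esub> \<otimes>\<^bsub>?F\<^esub> x = x"
      unfolding ab frac_one using ab(1,2) by (simp add: frac_mult)
    show "x \<otimes>\<^bsub>?F\<^esub> y = y \<otimes>\<^bsub>?F\<^esub> x"
      unfolding ab cd using ab(1,2) cd(1,2) nz[of b d] nz[of d b]
      by (simp add: frac_mult fraction_eq_iff m_comm)
    fix z assume "z \<in> carrier ?F"
    then obtain e f where ef: "e \<in> carrier R" "f \<in> carrier R - {\<zero>}" "z = fraction R e f"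
      by (elim frac_fieldE)
    show "x \<otimes>\<^bsub>?F\<^esub> y \<otimes>\<^bsub>?F\<^esub> z = x \<otimes>\<^bsub>?F\<^esub> (y \<otimes>\<^bsub>?F\<^esub> z)"
      unfolding ab cd ef using ab(1,2) cd(1,2) ef(1,2) nz[of b d] nz[of d f]
      by (simp add: frac_mult m_assoc)
  qed
  have "cring ?F"
  proof (rule cringI[OF abel mon])
    fix x y z assume xyz: "x \<in> carrier ?F" "y \<in> carrier ?F" "z \<in> carrier ?F"
    obtain a b c d e f where ab: "a \<in> carrier R" "b \<in> carrier R - {\<zero>}" "x = fraction R a b"
      and cd: "c \<in> carrier R" "d \<in> carrier R - {\<zero>}" "y = fraction R c d"
      and ef: "e \<in> carrier R" "f \<in> carrier R - {\<zero>}" "z = fraction R e f"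
      using xyz by (elim frac_fieldE)
    have "(a \<otimes> d \<oplus> c \<otimes> b) \<otimes> e \<otimes> (b \<otimes> f \<otimes> (d \<otimes> f)) =
          (a \<otimes> e \<otimes> (d \<otimes> f) \<oplus> c \<otimes> e \<otimes> (b \<otimes> f)) \<otimes> (b \<otimes> d \<otimes> f)"
      using ab(1,2) cd(1,2) ef(1,2) by (simp add: l_distr r_distr m_ac a_ac)
    then show "(x \<oplus>\<^bsub>?F\<^esub> y) \<otimes>\<^bsub>?F\<^esub> z = x \<otimes>\<^bsub>?F\<^esub> z \<oplus>\<^bsub>?F\<^esub> y \<otimes>\<^bsub>?F\<^esub> z"
      unfolding ab cd ef using ab(1,2) cd(1,2) ef(1,2) nz[of b d] nz[of b f] nz[of d f]
        nz[OF nz[of b d], of f] nz[OF nz[of b f] nz[of d f]]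
      by (simp add: frac_add frac_mult fraction_eq_iff)
  qed
  then interpret F: cring ?F .
  show ?thesis
  proof (rule F.cring_fieldI2)
    show "\<zero>\<^bsub>?F\<^esub> \<noteq> \<one>\<^bsub>?F\<^esub>" by (simp add: frac_zero frac_one fraction_eq_iff)
    fix x assume x: "x \<in> carrier ?F" "x \<noteq> \<zero>\<^bsub>?F\<^esub>"
    then obtain a b where ab: "a \<in> carrier R" "b \<in> carrier R - {\<zero>}" "x = fraction R a b"
      by (elim frac_fieldE)
    then have a: "a \<in> carrier R - {\<zero>}" using x(2) by (auto simp: frac_zero fraction_eq_iff)
    have "x \<otimes>\<^bsub>?F\<^esub> fraction R b a = \<one>\<^bsub>?F\<^esub>"
      unfolding ab frac_one using ab(2) a nz[of b a] by (simp add: frac_mult fraction_eq_iff m_comm)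
    then show "\<exists>y\<in>carrier ?F. x \<otimes>\<^bsub>?F\<^esub> y = \<one>\<^bsub>?F\<^esub>"
      using ab(2) a by (intro bexI[of _ "fraction R b a"]) (auto intro: fraction_closed)
  qed
qed

end

text \<open>A field in which a domain is embedded such that every element is a fraction. Keeping the
embedding abstract hides the representation of fractions as classes of pairs.\<close>

locale field_of_fractions = R?: domain R + F: field F for R (structure) and F (structure) +
  fixes \<iota>
  assumes hom: "\<iota> \<in> ring_hom R F"
    and inj: "inj_on \<iota> (carrier R)"
    and fractions: "x \<in> carrier F \<Longrightarrow> \<exists>a\<in>carrier R. \<exists>b\<in>carrier R - {\<zero>\<^bsub>R\<^esub>}. x \<otimes>\<^bsub>F\<^esub> \<iota> b = \<iota> a"

lemma (in domain) frac_field_of_fractions: "field_of_fractions R (frac_field R) (frac_embed R)"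
proof (intro field_of_fractions.intro field_of_fractions_axioms.intro)
  show "domain R" by (rule domain_axioms)
  show "field (frac_field R)" by (rule frac_field_is_field)
  show "frac_embed R \<in> ring_hom R (frac_field R)"
    by (rule ring_hom_memI)
       (simp_all add: frac_embed_def fraction_closed frac_mult frac_add frac_one)
  show "inj_on (frac_embed R) (carrier R)"
    by (rule inj_onI) (simp add: frac_embed_def fraction_eq_iff)
  fix x assume "x \<in> carrier (frac_field R)"
  then obtain a b where ab: "a \<in> carrier R" "b \<in> carrier R - {\<zero>}" "x = fraction R a b"
    by (elim frac_fieldE)
  then have "x \<otimes>\<^bsub>frac_field R\<^esub> frac_embed R b = frac_embed R a"
    by (simp add: frac_embed_def frac_mult fraction_eq_iff integral_iff)
  then show "\<exists>a\<in>carrier R. \<exists>b\<in>carrier R - {\<zero>}. x \<otimes>\<^bsub>frac_field R\<^esub> frac_embed R b = frac_embed R a"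
    using ab by blast
qed

section \<open>Krull-type domains without fractions\<close>

context field_of_fractions
begin

interpretation h: ring_hom_cring R F \<iota>
  by (rule ring_hom_cringI) (unfold_locales, rule hom)

abbreviation B where "B \<equiv> \<iota> ` carrier R"

lemma embed_eq_iff: "a \<in> carrier R \<Longrightarrow> b \<in> carrier R \<Longrightarrow> \<iota> a = \<iota> b \<longleftrightarrow> a = b"
  using inj by (auto simp: inj_on_def)

lemma embed_zero_iff: "a \<in> carrier R \<Longrightarrow> \<iota> a = \<zero>\<^bsub>F\<^esub> \<longleftrightarrow> a = \<zero>\<^bsub>R\<^esub>"
  using embed_eq_iff[of a "\<zero>\<^bsub>R\<^esub>"] by simp

lemma embed_in_image_iff: "a \<in> carrier R \<Longrightarrow> I \<subseteq> carrier R \<Longrightarrow> \<iota> a \<in> \<iota> ` I \<longleftrightarrow> a \<in> I"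
  by (rule inj_on_image_mem_iff[OF inj])

lemma embed_in_imageD: "\<iota> a \<in> \<iota> ` I \<Longrightarrow> a \<in> carrier R \<Longrightarrow> I \<subseteq> carrier R \<Longrightarrow> a \<in> I"
  by (simp add: embed_in_image_iff)

lemma embed_subset_iff:
  assumes "I \<subseteq> carrier R" "J \<subseteq> carrier R" shows "\<iota> ` I \<subseteq> \<iota> ` J \<longleftrightarrow> I \<subseteq> J"
  using assms embed_in_image_iff[OF _ assms(2)] by blast

lemma embed_quotient_iff:
  assumes "a \<in> carrier R" "b \<in> carrier R" "b \<noteq> \<zero>\<^bsub>R\<^esub>"
  shows "\<iota> a \<otimes>\<^bsub>F\<^esub> inv\<^bsub>F\<^esub> \<iota> b \<in> B \<longleftrightarrow> b divides\<^bsub>R\<^esub> a"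
proof -
  have u: "\<iota> b \<in> Units F" using assms by (simp add: F.field_Units embed_zero_iff)
  have "\<iota> a \<otimes>\<^bsub>F\<^esub> inv\<^bsub>F\<^esub> \<iota> b = \<iota> c \<longleftrightarrow> a = b \<otimes>\<^bsub>R\<^esub> c" if c: "c \<in> carrier R" for c
  proof -
    have "\<iota> a \<otimes>\<^bsub>F\<^esub> inv\<^bsub>F\<^esub> \<iota> b = \<iota> c \<longleftrightarrow> \<iota> a = \<iota> b \<otimes>\<^bsub>F\<^esub> \<iota> c"
    proof
      assume "\<iota> a \<otimes>\<^bsub>F\<^esub> inv\<^bsub>F\<^esub> \<iota> b = \<iota> c"
      then have "\<iota> b \<otimes>\<^bsub>F\<^esub> \<iota> c = \<iota> b \<otimes>\<^bsub>F\<^esub> (\<iota> a \<otimes>\<^bsub>F\<^esub> inv\<^bsub>F\<^esub> \<iota> b)" by simp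
      also have "\<dots> = \<iota> a \<otimes>\<^bsub>F\<^esub> (\<iota> b \<otimes>\<^bsub>F\<^esub> inv\<^bsub>F\<^esub> \<iota> b)"
        using assms u by (simp add: F.m_lcomm)
      finally show "\<iota> a = \<iota> b \<otimes>\<^bsub>F\<^esub> \<iota> c" using assms u by simp
    next
      assume "\<iota> a = \<iota> b \<otimes>\<^bsub>F\<^esub> \<iota> c"
      then have "\<iota> a \<otimes>\<^bsub>F\<^esub> inv\<^bsub>F\<^esub> \<iota> b = \<iota> c \<otimes>\<^bsub>F\<^esub> (\<iota> b \<otimes>\<^bsub>F\<^esub> inv\<^bsub>F\<^esub> \<iota> b)"
        using assms F.Units_inv_closed[OF u] c by (simp add: F.m_ac)
      then show "\<iota> a \<otimes>\<^bsub>F\<^esub> inv\<^bsub>F\<^esub> \<iota> b = \<iota> c" using u c by simp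
    qed
    also have "\<dots> \<longleftrightarrow> a = b \<otimes>\<^bsub>R\<^esub> c"
      using embed_eq_iff[of a "b \<otimes>\<^bsub>R\<^esub> c"] assms c by simp
    finally show ?thesis .
  qed
  then show ?thesis unfolding factor_def by auto
qed

lemma fraction_cases:
  assumes "x \<in> carrier F"
  obtains a b where "a \<in> carrier R" "b \<in> carrier R" "b \<noteq> \<zero>\<^bsub>R\<^esub>" "x = \<iota> a \<otimes>\<^bsub>F\<^esub> inv\<^bsub>F\<^esub> \<iota> b"
proof -
  obtain a b where ab: "a \<in> carrier R" "b \<in> carrier R - {\<zero>\<^bsub>R\<^esub>}" "x \<otimes>\<^bsub>F\<^esub> \<iota> b = \<iota> a"
    using fractions[OF assms] by blast
  have u: "\<iota> b \<in> Units F" using ab by (simp add: F.field_Units embed_zero_iff)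
  have "\<iota> a \<otimes>\<^bsub>F\<^esub> inv\<^bsub>F\<^esub> \<iota> b = x \<otimes>\<^bsub>F\<^esub> (\<iota> b \<otimes>\<^bsub>F\<^esub> inv\<^bsub>F\<^esub> \<iota> b)"
    unfolding ab(3)[symmetric] using ab(1,2) assms u by (simp add: F.m_assoc)
  then show ?thesis using that ab u assms by auto
qed

lemma times_quotient:
  assumes "a \<in> carrier R" "b \<in> carrier R" "b \<noteq> \<zero>\<^bsub>R\<^esub>" "x \<in> carrier R"
  shows "(\<iota> a \<otimes>\<^bsub>F\<^esub> inv\<^bsub>F\<^esub> \<iota> b) \<otimes>\<^bsub>F\<^esub> \<iota> x = \<iota> (a \<otimes>\<^bsub>R\<^esub> x) \<otimes>\<^bsub>F\<^esub> inv\<^bsub>F\<^esub> \<iota> b"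
proof -
  have u: "inv\<^bsub>F\<^esub> \<iota> b \<in> carrier F" using assms by (simp add: F.field_Units embed_zero_iff)
  show ?thesis using assms u by (simp add: F.m_ac)
qed

definition span :: "'c set \<Rightarrow> 'c set" where
  "span S = \<Inter>{L. submodule_in F B L \<and> S \<subseteq> L}"

lemma submodule_in_carrier: "submodule_in F B (carrier F)"
  unfolding submodule_in_def using F.add.subgroup_self by (auto intro!: additive_subgroupI)

lemma span_submodule:
  assumes "S \<subseteq> carrier F" shows "submodule_in F B (span S)"
proof -
  let ?LL = "{L. submodule_in F B L \<and> S \<subseteq> L}"
  have "carrier F \<in> ?LL" using submodule_in_carrier assms by simp
  then have "subgroup (\<Inter>?LL) (add_monoid F)"
    by (intro F.add.subgroups_Inter) (auto simp: submodule_in_def additive_subgroup_def)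
  then show ?thesis unfolding span_def submodule_in_def additive_subgroup_def by blast
qed

lemma span_superset: "S \<subseteq> span S"
  by (auto simp: span_def)

lemma span_least: "submodule_in F B L \<Longrightarrow> S \<subseteq> L \<Longrightarrow> span S \<subseteq> L"
  by (auto simp: span_def)

text \<open>The elements multiplied by \<open>z\<close> into the ring form a submodule, so membership of \<open>z\<close> in the inverse
of a generated fractional ideal can be tested on generators.\<close>

lemma submodule_colon:
  assumes "z \<in> carrier F" shows "submodule_in F B {y \<in> carrier F. z \<otimes>\<^bsub>F\<^esub> y \<in> B}"
  unfolding submodule_in_def
proof (intro conjI ballI)
  show "additive_subgroup {y \<in> carrier F. z \<otimes>\<^bsub>F\<^esub> y \<in> B} F"
  proof (intro additive_subgroupI F.add.subgroupI)
    have "\<zero>\<^bsub>F\<^esub> \<in> B" using h.hom_zero R.zero_closed by (metis imageI)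
    then have "\<zero>\<^bsub>F\<^esub> \<in> {y \<in> carrier F. z \<otimes>\<^bsub>F\<^esub> y \<in> B}" using assms by simp
    then show "{y \<in> carrier F. z \<otimes>\<^bsub>F\<^esub> y \<in> B} \<noteq> {}" by blast
  next
    fix x y assume x: "x \<in> {y \<in> carrier F. z \<otimes>\<^bsub>F\<^esub> y \<in> B}"
    then obtain a where a: "a \<in> carrier R" "x \<in> carrier F" "z \<otimes>\<^bsub>F\<^esub> x = \<iota> a" by auto
    have "z \<otimes>\<^bsub>F\<^esub> (\<ominus>\<^bsub>F\<^esub> x) = \<iota> (\<ominus>\<^bsub>R\<^esub> a)" using a assms by (simp add: F.r_minus)
    then have "z \<otimes>\<^bsub>F\<^esub> (\<ominus>\<^bsub>F\<^esub> x) \<in> B" using R.a_inv_closed[OF a(1)] by (metis imageI)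
    then show "\<ominus>\<^bsub>F\<^esub> x \<in> {y \<in> carrier F. z \<otimes>\<^bsub>F\<^esub> y \<in> B}" using a by simp
    assume y: "y \<in> {y \<in> carrier F. z \<otimes>\<^bsub>F\<^esub> y \<in> B}"
    then obtain b where b: "b \<in> carrier R" "y \<in> carrier F" "z \<otimes>\<^bsub>F\<^esub> y = \<iota> b" by auto
    have "z \<otimes>\<^bsub>F\<^esub> (x \<oplus>\<^bsub>F\<^esub> y) = \<iota> (a \<oplus>\<^bsub>R\<^esub> b)" using a b assms by (simp add: F.r_distr)
    then have "z \<otimes>\<^bsub>F\<^esub> (x \<oplus>\<^bsub>F\<^esub> y) \<in> B" using R.a_closed[OF a(1) b(1)] by (metis imageI)
    then show "x \<oplus>\<^bsub>F\<^esub> y \<in> {y \<in> carrier F. z \<otimes>\<^bsub>F\<^esub> y \<in> B}" using a b by simp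
  qed auto
  fix r x assume "r \<in> B" and x: "x \<in> {y \<in> carrier F. z \<otimes>\<^bsub>F\<^esub> y \<in> B}"
  then obtain a c where a: "a \<in> carrier R" "x \<in> carrier F" "z \<otimes>\<^bsub>F\<^esub> x = \<iota> a"
    and c: "c \<in> carrier R" "r = \<iota> c" by auto
  have "z \<otimes>\<^bsub>F\<^esub> (r \<otimes>\<^bsub>F\<^esub> x) = r \<otimes>\<^bsub>F\<^esub> (z \<otimes>\<^bsub>F\<^esub> x)" using a(2) c assms by (simp add: F.m_lcomm)
  also have "\<dots> = \<iota> (c \<otimes>\<^bsub>R\<^esub> a)" using a c by simp
  finally have "z \<otimes>\<^bsub>F\<^esub> (r \<otimes>\<^bsub>F\<^esub> x) \<in> B" using R.m_closed[OF c(1) a(1)] by (metis imageI)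
  then show "r \<otimes>\<^bsub>F\<^esub> x \<in> {y \<in> carrier F. z \<otimes>\<^bsub>F\<^esub> y \<in> B}" using a c by simp
qed

lemma ideal_inverse_span_iff:
  assumes "z \<in> carrier F" "S \<subseteq> carrier F"
  shows "z \<in> ideal_inverse F B (span S) \<longleftrightarrow> (\<forall>y\<in>S. z \<otimes>\<^bsub>F\<^esub> y \<in> B)"
proof
  assume "z \<in> ideal_inverse F B (span S)"
  then show "\<forall>y\<in>S. z \<otimes>\<^bsub>F\<^esub> y \<in> B" using span_superset[of S] by (auto simp: ideal_inverse_def)
next
  assume "\<forall>y\<in>S. z \<otimes>\<^bsub>F\<^esub> y \<in> B"
  then have "span S \<subseteq> {y \<in> carrier F. z \<otimes>\<^bsub>F\<^esub> y \<in> B}"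
    by (intro span_least submodule_colon assms) (use assms in auto)
  then show "z \<in> ideal_inverse F B (span S)" using assms by (auto simp: ideal_inverse_def)
qed

text \<open>The elements \<open>a / b\<close> of the inverse of \<open>S\<close> are those where \<open>b\<close> divides all \<open>a s\<close>. As the inverse
contains \<open>1\<close>, the \<open>v\<close>-closure consists of ring elements, and \<open>x\<close> belongs to it exactly when \<open>b\<close> divides
\<open>a x\<close> for all these \<open>a / b\<close>. The nonzero element of \<open>S\<close> takes care of the pairs with \<open>b = 0\<close>, which
represent no fraction.\<close>

lemma v_closure_span:
  assumes S: "S \<subseteq> carrier R" and s0: "s0 \<in> S" "s0 \<noteq> \<zero>\<^bsub>R\<^esub>"
  shows "v_closure F B (span (\<iota> ` S)) = \<iota> ` v_hull R S"
proof
  have SF: "\<iota> ` S \<subseteq> carrier F" using S by auto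
  have inverse_iff: "\<iota> a \<otimes>\<^bsub>F\<^esub> inv\<^bsub>F\<^esub> \<iota> b \<in> ideal_inverse F B (span (\<iota> ` S)) \<longleftrightarrow>
      (\<forall>s\<in>S. b divides\<^bsub>R\<^esub> (a \<otimes>\<^bsub>R\<^esub> s))"
    if ab: "a \<in> carrier R" "b \<in> carrier R" "b \<noteq> \<zero>\<^bsub>R\<^esub>" for a b
  proof -
    have "\<iota> a \<otimes>\<^bsub>F\<^esub> inv\<^bsub>F\<^esub> \<iota> b \<in> carrier F" using ab by (simp add: F.field_Units embed_zero_iff)
    then have "\<iota> a \<otimes>\<^bsub>F\<^esub> inv\<^bsub>F\<^esub> \<iota> b \<in> ideal_inverse F B (span (\<iota> ` S)) \<longleftrightarrow>
      (\<forall>s\<in>S. (\<iota> a \<otimes>\<^bsub>F\<^esub> inv\<^bsub>F\<^esub> \<iota> b) \<otimes>\<^bsub>F\<^esub> \<iota> s \<in> B)"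
      by (subst ideal_inverse_span_iff[OF _ SF]) auto
    also have "\<dots> \<longleftrightarrow> (\<forall>s\<in>S. b divides\<^bsub>R\<^esub> (a \<otimes>\<^bsub>R\<^esub> s))"
    proof (rule ball_cong[OF refl])
      fix s assume "s \<in> S"
      then have s: "s \<in> carrier R" using S by blast
      show "(\<iota> a \<otimes>\<^bsub>F\<^esub> inv\<^bsub>F\<^esub> \<iota> b) \<otimes>\<^bsub>F\<^esub> \<iota> s \<in> B \<longleftrightarrow> b divides\<^bsub>R\<^esub> (a \<otimes>\<^bsub>R\<^esub> s)"
        unfolding times_quotient[OF ab s] using ab s by (intro embed_quotient_iff) auto
    qed
    finally show ?thesis .
  qed
  show "v_closure F B (span (\<iota> ` S)) \<subseteq> \<iota> ` v_hull R S"
  proof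
    fix z assume z: "z \<in> v_closure F B (span (\<iota> ` S))"
    then have zF: "z \<in> carrier F"
      and zi: "\<And>y. y \<in> ideal_inverse F B (span (\<iota> ` S)) \<Longrightarrow> z \<otimes>\<^bsub>F\<^esub> y \<in> B"
      by (auto simp: v_closure_def ideal_inverse_def)
    have "\<one>\<^bsub>F\<^esub> \<in> ideal_inverse F B (span (\<iota> ` S))"
      by (subst ideal_inverse_span_iff) (use SF S in auto)
    then have "z \<in> B" using zi zF by fastforce
    then obtain x where x: "x \<in> carrier R" "z = \<iota> x" by auto
    have "x \<in> v_hull R S"
    proof (rule v_hullI[OF x(1)])
      fix a b assume ab: "a \<in> carrier R" "b \<in> carrier R"
        and d: "\<And>s. s \<in> S \<Longrightarrow> b divides\<^bsub>R\<^esub> (a \<otimes>\<^bsub>R\<^esub> s)"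
      show "b divides\<^bsub>R\<^esub> (a \<otimes>\<^bsub>R\<^esub> x)"
      proof (cases "b = \<zero>\<^bsub>R\<^esub>")
        case True
        have "a \<otimes>\<^bsub>R\<^esub> s0 = \<zero>\<^bsub>R\<^esub>" using d[OF s0(1)] True by (auto simp: factor_def)
        then have "a = \<zero>\<^bsub>R\<^esub>" using s0 S ab R.integral_iff by blast
        then show ?thesis using True x by (auto simp: factor_def)
      next
        case False
        have "\<iota> a \<otimes>\<^bsub>F\<^esub> inv\<^bsub>F\<^esub> \<iota> b \<in> ideal_inverse F B (span (\<iota> ` S))"
          using inverse_iff[OF ab False] d by blast
        then have "\<iota> x \<otimes>\<^bsub>F\<^esub> (\<iota> a \<otimes>\<^bsub>F\<^esub> inv\<^bsub>F\<^esub> \<iota> b) \<in> B" using zi x by blast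
        moreover have "inv\<^bsub>F\<^esub> \<iota> b \<in> carrier F" using ab False by (simp add: F.field_Units embed_zero_iff)
        ultimately have "(\<iota> a \<otimes>\<^bsub>F\<^esub> inv\<^bsub>F\<^esub> \<iota> b) \<otimes>\<^bsub>F\<^esub> \<iota> x \<in> B" using ab x by (simp add: F.m_comm)
        then show ?thesis
          unfolding times_quotient[OF ab False x(1)] using embed_quotient_iff[of "a \<otimes>\<^bsub>R\<^esub> x" b] ab False x
          by blast
      qed
    qed
    then show "z \<in> \<iota> ` v_hull R S" using x by blast
  qed
  show "\<iota> ` v_hull R S \<subseteq> v_closure F B (span (\<iota> ` S))"
  proof
    fix z assume "z \<in> \<iota> ` v_hull R S"
    then obtain x where x: "x \<in> v_hull R S" "z = \<iota> x" by auto
    have xc: "x \<in> carrier R" using x(1) by (rule v_hull_carrier)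
    have "\<iota> x \<otimes>\<^bsub>F\<^esub> y \<in> B" if y: "y \<in> ideal_inverse F B (span (\<iota> ` S))" for y
    proof -
      have yF: "y \<in> carrier F" using y by (simp add: ideal_inverse_def)
      obtain a b where ab: "a \<in> carrier R" "b \<in> carrier R" "b \<noteq> \<zero>\<^bsub>R\<^esub>" "y = \<iota> a \<otimes>\<^bsub>F\<^esub> inv\<^bsub>F\<^esub> \<iota> b"
        using fraction_cases[OF yF] by metis
      have "b divides\<^bsub>R\<^esub> (a \<otimes>\<^bsub>R\<^esub> x)"
        using v_hullD[OF x(1) ab(1,2)] inverse_iff[OF ab(1-3)] y ab(4) by blast
      then have "y \<otimes>\<^bsub>F\<^esub> \<iota> x \<in> B"
        unfolding ab(4) times_quotient[OF ab(1-3) xc] using embed_quotient_iff[of "a \<otimes>\<^bsub>R\<^esub> x" b] ab(1-3) xc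
        by blast
      then show ?thesis using yF xc by (simp add: F.m_comm)
    qed
    then show "z \<in> v_closure F B (span (\<iota> ` S))"
      using x xc by (auto simp: v_closure_def ideal_inverse_def[of F B "ideal_inverse _ _ _"])
  qed
qed

lemma integral_fractional_ideal_iff:
  assumes "J \<subseteq> B"
  shows "nonzero_fractional_ideal F B J \<longleftrightarrow> submodule_in F B J \<and> J \<noteq> {\<zero>\<^bsub>F\<^esub>}"
proof -
  have "\<one>\<^bsub>F\<^esub> \<in> B - {\<zero>\<^bsub>F\<^esub>}" using h.hom_one R.one_closed by (metis DiffI F.one_not_zero imageI singletonD)
  moreover have "\<forall>x\<in>J. \<one>\<^bsub>F\<^esub> \<otimes>\<^bsub>F\<^esub> x \<in> B" using assms by auto
  ultimately show ?thesis unfolding nonzero_fractional_ideal_def by blast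
qed

lemma submodule_image_iff:
  assumes "I \<subseteq> carrier R"
  shows "submodule_in F B (\<iota> ` I) \<longleftrightarrow> ideal I R"
proof
  assume sub: "submodule_in F B (\<iota> ` I)"
  then interpret I: additive_subgroup "\<iota> ` I" F by (simp add: submodule_in_def)
  show "ideal I R"
  proof (rule idealI)
    show "ring R" by (rule R.ring_axioms)
    show "subgroup I (add_monoid R)"
    proof (rule R.add.subgroupI[OF assms])
      show "I \<noteq> {}" using I.zero_closed by blast
      fix a b assume a: "a \<in> I"
      then have ac: "a \<in> carrier R" using assms by blast
      have "\<iota> (\<ominus>\<^bsub>R\<^esub> a) \<in> \<iota> ` I" unfolding h.hom_a_inv[OF ac] using a by (intro I.a_inv_closed imageI)
      then show "\<ominus>\<^bsub>R\<^esub> a \<in> I" by (rule embed_in_imageD) (use ac assms in auto)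
      assume b: "b \<in> I"
      then have bc: "b \<in> carrier R" using assms by blast
      have "\<iota> (a \<oplus>\<^bsub>R\<^esub> b) \<in> \<iota> ` I" unfolding h.hom_add[OF ac bc] using a b by (intro I.a_closed imageI)
      then show "a \<oplus>\<^bsub>R\<^esub> b \<in> I" by (rule embed_in_imageD) (use ac bc assms in auto)
    qed
    fix a x assume a: "a \<in> I" and x: "x \<in> carrier R"
    then have ac: "a \<in> carrier R" using assms by blast
    have "\<iota> (x \<otimes>\<^bsub>R\<^esub> a) \<in> \<iota> ` I"
      unfolding h.hom_mult[OF x ac] using sub a x by (simp add: submodule_in_def)
    then show xa: "x \<otimes>\<^bsub>R\<^esub> a \<in> I" by (rule embed_in_imageD) (use ac x assms in auto)
    from ac show "a \<otimes>\<^bsub>R\<^esub> x \<in> I" using xa x R.m_comm by simp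
  qed
next
  assume "ideal I R"
  then interpret I: ideal I R .
  show "submodule_in F B (\<iota> ` I)"
    unfolding submodule_in_def
  proof (intro conjI ballI additive_subgroupI)
    show "subgroup (\<iota> ` I) (add_monoid F)"
      by (rule h.ring.img_is_add_subgroup[OF I.a_subgroup])
    fix a x assume "a \<in> B" "x \<in> \<iota> ` I"
    then obtain c d where cd: "c \<in> carrier R" "d \<in> I" "a = \<iota> c" "x = \<iota> d" by auto
    then have "a \<otimes>\<^bsub>F\<^esub> x = \<iota> (c \<otimes>\<^bsub>R\<^esub> d)" using assms by auto
    then show "a \<otimes>\<^bsub>F\<^esub> x \<in> \<iota> ` I" using I.I_l_closed[OF cd(2,1)] by (simp only: imageI)
  qed
qed

text \<open>A finitely generated nonzero fractional ideal inside an integral ideal is generated by a finite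
set of ring elements with a nonzero member, so \<open>v_closure_span\<close> computes its \<open>v\<close>-closure. In the
other direction a given finite set is first enlarged by a nonzero element of \<open>I\<close>.\<close>

lemma t_ideal_image_iff:
  assumes I: "I \<subseteq> carrier R"
  shows "t_ideal F B (\<iota> ` I) \<longleftrightarrow> t_closed R I \<and> I \<noteq> {\<zero>\<^bsub>R\<^esub>}"
proof
  have IB: "\<iota> ` I \<subseteq> B" using I by auto
  have zero_iff: "\<iota> ` I = {\<zero>\<^bsub>F\<^esub>} \<longleftrightarrow> I = {\<zero>\<^bsub>R\<^esub>}"
    using inj_on_image_eq_iff[OF inj I, of "{\<zero>\<^bsub>R\<^esub>}"] by simp
  {
    assume t: "t_ideal F B (\<iota> ` I)"
    then have sub: "submodule_in F B (\<iota> ` I)" and ne: "I \<noteq> {\<zero>\<^bsub>R\<^esub>}"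
      using integral_fractional_ideal_iff[OF IB] zero_iff by (auto simp: t_ideal_def)
    interpret I: ideal I R using submodule_image_iff[OF I] sub by blast
    have "v_hull R S \<subseteq> I" if S: "finite S" "S \<subseteq> I" for S
    proof -
      have "\<exists>y\<in>I. y \<noteq> \<zero>\<^bsub>R\<^esub>" using ne I.zero_closed by auto
      then obtain y where y: "y \<in> I" "y \<noteq> \<zero>\<^bsub>R\<^esub>" by blast
      \<comment> \<open>a nonzero member makes the generated submodule a nonzero fractional ideal\<close>
      let ?S = "insert y S"
      have S': "?S \<subseteq> I" "finite ?S" "?S \<subseteq> carrier R" using S y I by auto
      have SF: "\<iota> ` ?S \<subseteq> carrier F" using S'(3) by auto
      let ?J = "span (\<iota> ` ?S)"
      have J: "?J \<subseteq> \<iota> ` I" using S'(1) by (intro span_least[OF sub]) auto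
      have "\<iota> y \<in> ?J" by (rule subsetD[OF span_superset]) simp
      then have "?J \<noteq> {\<zero>\<^bsub>F\<^esub>}" using y I by (auto simp: embed_zero_iff)
      then have "nonzero_fractional_ideal F B ?J"
        using integral_fractional_ideal_iff[of ?J] J IB span_submodule[OF SF] by auto
      moreover have "finitely_generated_in F B ?J"
        unfolding finitely_generated_in_def span_def using S'(2) SF by blast
      ultimately have "v_closure F B ?J \<subseteq> t_closure F B (\<iota> ` I)"
        unfolding t_closure_def using J by blast
      then have "\<iota> ` v_hull R ?S \<subseteq> \<iota> ` I"
        using t v_closure_span[OF S'(3), of y] y by (simp add: t_ideal_def)
      moreover have "v_hull R ?S \<subseteq> carrier R" by (auto dest: v_hull_carrier)
      ultimately have "v_hull R ?S \<subseteq> I" using embed_subset_iff[OF _ I] by blast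
      moreover have "v_hull R S \<subseteq> v_hull R ?S" by (auto simp: v_hull_def)
      ultimately show ?thesis by blast
    qed
    then show "t_closed R I \<and> I \<noteq> {\<zero>\<^bsub>R\<^esub>}" using ne I by (auto simp: t_closed_def)
  }
  assume t: "t_closed R I \<and> I \<noteq> {\<zero>\<^bsub>R\<^esub>}"
  then interpret I: ideal I R using R.t_closed_ideal by blast
  have sub: "submodule_in F B (\<iota> ` I)" using submodule_image_iff[OF I] I.is_ideal by blast
  have frac: "nonzero_fractional_ideal F B (\<iota> ` I)"
    using integral_fractional_ideal_iff[OF IB] sub zero_iff t by blast
  have "\<exists>y\<in>I. y \<noteq> \<zero>\<^bsub>R\<^esub>" using t I.zero_closed by auto
  then obtain y where y: "y \<in> I" "y \<noteq> \<zero>\<^bsub>R\<^esub>" by blast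
  have "t_closure F B (\<iota> ` I) = \<iota> ` I"
  proof
    show "t_closure F B (\<iota> ` I) \<subseteq> \<iota> ` I"
    proof
      fix z assume "z \<in> t_closure F B (\<iota> ` I)"
      then obtain J where J: "nonzero_fractional_ideal F B J" "finitely_generated_in F B J" "J \<subseteq> \<iota> ` I"
        and z: "z \<in> v_closure F B J" by (auto simp: t_closure_def)
      obtain S' where S': "finite S'" "S' \<subseteq> carrier F" "J = span S'"
        using J(2) by (auto simp: finitely_generated_in_def span_def)
      have "S' \<subseteq> \<iota> ` I" using S'(3) J(3) span_superset by blast
      then obtain S where S: "S \<subseteq> I" "finite S" "S' = \<iota> ` S"
        using finite_subset_image[OF S'(1)] by metis
      have Sc: "S \<subseteq> carrier R" using S I by blast
      have "\<exists>s\<in>S. s \<noteq> \<zero>\<^bsub>R\<^esub>"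
      proof (rule ccontr)
        assume "\<not> ?thesis"
        then have "S' \<subseteq> {\<zero>\<^bsub>F\<^esub>}" using S(3) by auto
        moreover have "submodule_in F B {\<zero>\<^bsub>F\<^esub>}"
          unfolding submodule_in_def using F.zeroideal
          by (auto simp: ideal_def)
        ultimately have "J \<subseteq> {\<zero>\<^bsub>F\<^esub>}" using S'(3) span_least by blast
        moreover have "\<zero>\<^bsub>F\<^esub> \<in> J"
          using J(1) additive_subgroup.zero_closed[of J F]
          by (auto simp: nonzero_fractional_ideal_def submodule_in_def)
        ultimately have "J = {\<zero>\<^bsub>F\<^esub>}" by blast
        then show False using J(1) by (simp add: nonzero_fractional_ideal_def)
      qed
      then obtain s where "s \<in> S" "s \<noteq> \<zero>\<^bsub>R\<^esub>" by blast
      then have "z \<in> \<iota> ` v_hull R S" using v_closure_span[OF Sc] z unfolding S'(3) S(3) by simp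
      moreover have "v_hull R S \<subseteq> I" using t S(1,2) by (simp add: t_closed_def)
      ultimately show "z \<in> \<iota> ` I" by blast
    qed
    show "\<iota> ` I \<subseteq> t_closure F B (\<iota> ` I)"
    proof
      fix z assume "z \<in> \<iota> ` I"
      then obtain x where x: "x \<in> I" "z = \<iota> x" by blast
      \<comment> \<open>\<open>y\<close> provides a nonzero generator in case \<open>x = 0\<close>\<close>
      let ?S = "{x, y}"
      have S': "?S \<subseteq> I" "finite ?S" "?S \<subseteq> carrier R" using x y I by auto
      have SF: "\<iota> ` ?S \<subseteq> carrier F" using S'(3) by auto
      let ?J = "span (\<iota> ` ?S)"
      have J: "?J \<subseteq> \<iota> ` I" using S'(1) by (intro span_least[OF sub]) auto
      have "\<iota> y \<in> ?J" by (rule subsetD[OF span_superset]) simp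
      then have "?J \<noteq> {\<zero>\<^bsub>F\<^esub>}" using y I by (auto simp: embed_zero_iff)
      then have "nonzero_fractional_ideal F B ?J"
        using integral_fractional_ideal_iff[of ?J] J IB span_submodule[OF SF] by auto
      moreover have "finitely_generated_in F B ?J"
        unfolding finitely_generated_in_def span_def using S'(2) SF by blast
      moreover have "z \<in> v_closure F B ?J"
        unfolding v_closure_span[OF S'(3) insertI2[OF singletonI] y(2)] using x R.v_hull_self[OF S'(3), of x] by blast
      ultimately show "z \<in> t_closure F B (\<iota> ` I)"
        unfolding t_closure_def using J by blast
    qed
  qed
  then show "t_ideal F B (\<iota> ` I)" using frac by (simp add: t_ideal_def)
qed

lemma t_maximal_iff:
  "t_maximal F B N \<longleftrightarrow> (\<exists>N0. max_t_closed R N0 \<and> N = \<iota> ` N0)"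
proof
  assume N: "t_maximal F B N"
  then have tN: "t_ideal F B N" and sN: "N \<subset> B" by (auto simp: t_maximal_def)
  then obtain N0 where N0: "N0 \<subseteq> carrier R" "N = \<iota> ` N0" by (metis psubset_imp_subset subset_image_iff)
  have t: "t_closed R N0" "N0 \<noteq> {\<zero>\<^bsub>R\<^esub>}" using t_ideal_image_iff[OF N0(1)] tN N0(2) by auto
  have "max_t_closed R N0"
    unfolding max_t_closed_def
  proof (intro conjI allI impI)
    show "\<one>\<^bsub>R\<^esub> \<notin> N0"
      using ideal.one_imp_carrier[OF R.t_closed_ideal[OF t(1)]] sN N0(2) by blast
    fix I assume I: "t_closed R I \<and> \<one>\<^bsub>R\<^esub> \<notin> I \<and> N0 \<subseteq> I"
    have Ic: "I \<subseteq> carrier R" using I by (simp add: t_closed_def)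
    have "\<zero>\<^bsub>R\<^esub> \<in> N0" using R.t_closed_ideal[OF t(1)]
      by (simp add: additive_subgroup.zero_closed ideal.axioms(1))
    then have "I \<noteq> {\<zero>\<^bsub>R\<^esub>}" using I t(2) by blast
    then have "t_ideal F B (\<iota> ` I)" using t_ideal_image_iff[OF Ic] I by blast
    moreover have "\<iota> \<one>\<^bsub>R\<^esub> \<notin> \<iota> ` I" using I Ic embed_in_image_iff by blast
    then have "\<iota> ` I \<subset> B" using Ic R.one_closed by blast
    ultimately have "\<iota> ` I = \<iota> ` N0" using N I N0(2) unfolding t_maximal_def by (meson image_mono)
    then show "I = N0" using inj_on_image_eq_iff[OF inj Ic N0(1)] by blast
  qed (use t in auto)
  then show "\<exists>N0. max_t_closed R N0 \<and> N = \<iota> ` N0" using N0 by blast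
next
  assume "\<exists>N0. max_t_closed R N0 \<and> N = \<iota> ` N0"
  then obtain N0 where N0: "max_t_closed R N0" and N: "N = \<iota> ` N0" by blast
  note m = max_t_closedD[OF N0]
  have c: "N0 \<subseteq> carrier R" by (rule t_closed_subset[OF m(1)])
  show "t_maximal F B N"
    unfolding t_maximal_def
  proof (intro conjI allI impI)
    show "t_ideal F B N" using t_ideal_image_iff[OF c] m N by blast
    show "N \<subset> B" using N c m(3) embed_in_image_iff[OF R.one_closed c] R.one_closed by blast
    fix I assume I: "t_ideal F B I \<and> I \<subset> B \<and> N \<subseteq> I"
    then obtain I0 where I0: "I0 \<subseteq> carrier R" "I = \<iota> ` I0" by (metis psubset_imp_subset subset_image_iff)
    have t: "t_closed R I0" using t_ideal_image_iff[OF I0(1)] I I0(2) by blast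
    moreover have "\<one>\<^bsub>R\<^esub> \<notin> I0"
      using ideal.one_imp_carrier[OF R.t_closed_ideal[OF t]] I I0(2) by blast
    moreover have "N0 \<subseteq> I0" using I N I0 embed_subset_iff[OF c I0(1)] by blast
    ultimately show "I = N" using m(4) N I0(2) by blast
  qed
qed

text \<open>Divisibility in the localization between \<open>a / s\<close> and \<open>b / t\<close> depends on the numerators
only, and the image of \<open>b\<close> divides that of \<open>a\<close> there exactly when \<open>b\<close> divides some multiple of
\<open>a\<close> by an element outside \<open>P\<close>.\<close>

lemma valuation_localization_iff:
  assumes "primeideal P R"
  shows "valuation_domain (localization_in F B (\<iota> ` P)) \<longleftrightarrow> essential R P"
proof -
  interpret P: primeideal P R by fact
  define V where "V = {a \<otimes>\<^bsub>F\<^esub> inv\<^bsub>F\<^esub> s |a s. a \<in> B \<and> s \<in> B - \<iota> ` P}"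
  have L: "localization_in F B (\<iota> ` P) = F\<lparr>carrier := V\<rparr>"
    by (simp add: localization_in_def V_def)
  have Pc: "P \<subseteq> carrier R" using P.Icarr by blast
  have one: "\<one>\<^bsub>R\<^esub> \<notin> P" using P.I_notcarr P.one_imp_carrier by blast
  have nz: "s \<noteq> \<zero>\<^bsub>R\<^esub>" if "s \<notin> P" for s using that P.zero_closed by blast
  have V_iff: "x \<in> V \<longleftrightarrow> (\<exists>a\<in>carrier R. \<exists>s\<in>carrier R - P. x \<in> carrier F \<and> x \<otimes>\<^bsub>F\<^esub> \<iota> s = \<iota> a)" for x
  proof
    assume "x \<in> V"
    then obtain a s where as: "a \<in> carrier R" "s \<in> carrier R" "s \<notin> P" "x = \<iota> a \<otimes>\<^bsub>F\<^esub> inv\<^bsub>F\<^esub> \<iota> s"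
      by (auto simp: V_def)
    have u: "\<iota> s \<in> Units F" using as nz by (simp add: F.field_Units embed_zero_iff)
    have "x \<otimes>\<^bsub>F\<^esub> \<iota> s = \<iota> a" using as(1,2) u unfolding as(4) by (simp add: F.m_assoc)
    then show "\<exists>a\<in>carrier R. \<exists>s\<in>carrier R - P. x \<in> carrier F \<and> x \<otimes>\<^bsub>F\<^esub> \<iota> s = \<iota> a"
      using as u by auto
  next
    assume "\<exists>a\<in>carrier R. \<exists>s\<in>carrier R - P. x \<in> carrier F \<and> x \<otimes>\<^bsub>F\<^esub> \<iota> s = \<iota> a"
    then obtain a s where as: "a \<in> carrier R" "s \<in> carrier R" "s \<notin> P" "x \<in> carrier F" "x \<otimes>\<^bsub>F\<^esub> \<iota> s = \<iota> a"
      by blast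
    have u: "\<iota> s \<in> Units F" using as nz by (simp add: F.field_Units embed_zero_iff)
    have "x = \<iota> a \<otimes>\<^bsub>F\<^esub> inv\<^bsub>F\<^esub> \<iota> s" unfolding as(5)[symmetric] using as(2,4) u by (simp add: F.m_assoc)
    moreover have "\<iota> s \<in> B - \<iota> ` P" using as embed_in_image_iff[OF _ Pc] by blast
    ultimately show "x \<in> V" unfolding V_def using as(1) by blast
  qed
  have BV: "\<iota> a \<in> V" if "a \<in> carrier R" for a
    unfolding V_iff using that one by (intro bexI[of _ a] bexI[of _ "\<one>\<^bsub>R\<^esub>"]) auto
  have "subring V F"
  proof (rule F.subringI)
    show "V \<subseteq> carrier F" by (auto simp: V_iff)
    show "\<one>\<^bsub>F\<^esub> \<in> V" using BV[of "\<one>\<^bsub>R\<^esub>"] by simp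
    fix x y assume "x \<in> V"
    then obtain a s where as: "a \<in> carrier R" "s \<in> carrier R - P" "x \<in> carrier F" "x \<otimes>\<^bsub>F\<^esub> \<iota> s = \<iota> a"
      by (auto simp: V_iff)
    have "(\<ominus>\<^bsub>F\<^esub> x) \<otimes>\<^bsub>F\<^esub> \<iota> s = \<iota> (\<ominus>\<^bsub>R\<^esub> a)" using as by (simp add: F.l_minus)
    then show "\<ominus>\<^bsub>F\<^esub> x \<in> V" unfolding V_iff using as by (intro bexI[of _ "\<ominus>\<^bsub>R\<^esub> a"] bexI[of _ s]) auto
    assume "y \<in> V"
    then obtain b t where bt: "b \<in> carrier R" "t \<in> carrier R - P" "y \<in> carrier F" "y \<otimes>\<^bsub>F\<^esub> \<iota> t = \<iota> b"
      by (auto simp: V_iff)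
    have st: "s \<otimes>\<^bsub>R\<^esub> t \<in> carrier R - P" using as bt P.I_prime by auto
    have "(x \<otimes>\<^bsub>F\<^esub> y) \<otimes>\<^bsub>F\<^esub> \<iota> (s \<otimes>\<^bsub>R\<^esub> t) = (x \<otimes>\<^bsub>F\<^esub> \<iota> s) \<otimes>\<^bsub>F\<^esub> (y \<otimes>\<^bsub>F\<^esub> \<iota> t)"
      using as(1-3) bt(1-3) by (simp add: F.m_ac)
    also have "\<dots> = \<iota> (a \<otimes>\<^bsub>R\<^esub> b)" using as bt by simp
    finally show "x \<otimes>\<^bsub>F\<^esub> y \<in> V" unfolding V_iff using as bt st
      by (intro bexI[of _ "a \<otimes>\<^bsub>R\<^esub> b"] bexI[of _ "s \<otimes>\<^bsub>R\<^esub> t"]) auto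
    have "(x \<oplus>\<^bsub>F\<^esub> y) \<otimes>\<^bsub>F\<^esub> \<iota> (s \<otimes>\<^bsub>R\<^esub> t) = (x \<otimes>\<^bsub>F\<^esub> \<iota> s) \<otimes>\<^bsub>F\<^esub> \<iota> t \<oplus>\<^bsub>F\<^esub> (y \<otimes>\<^bsub>F\<^esub> \<iota> t) \<otimes>\<^bsub>F\<^esub> \<iota> s"
      using as(1-3) bt(1-3) by (simp add: F.m_ac F.l_distr F.r_distr)
    also have "\<dots> = \<iota> (a \<otimes>\<^bsub>R\<^esub> t \<oplus>\<^bsub>R\<^esub> b \<otimes>\<^bsub>R\<^esub> s)" using as bt by simp
    finally show "x \<oplus>\<^bsub>F\<^esub> y \<in> V" unfolding V_iff using as bt st
      by (intro bexI[of _ "a \<otimes>\<^bsub>R\<^esub> t \<oplus>\<^bsub>R\<^esub> b \<otimes>\<^bsub>R\<^esub> s"] bexI[of _ "s \<otimes>\<^bsub>R\<^esub> t"]) auto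
  qed
  then have dom: "domain (F\<lparr>carrier := V\<rparr>)" by (rule F.subring_is_domain)
  have div_iff: "(\<exists>v\<in>V. \<iota> a = \<iota> b \<otimes>\<^bsub>F\<^esub> v) \<longleftrightarrow> (\<exists>s\<in>carrier R - P. b divides\<^bsub>R\<^esub> (s \<otimes>\<^bsub>R\<^esub> a))"
    if ab: "a \<in> carrier R" "b \<in> carrier R" for a b
  proof
    assume "\<exists>v\<in>V. \<iota> a = \<iota> b \<otimes>\<^bsub>F\<^esub> v"
    then obtain v c s where v: "\<iota> a = \<iota> b \<otimes>\<^bsub>F\<^esub> v" "v \<in> carrier F" "c \<in> carrier R" "s \<in> carrier R - P" "v \<otimes>\<^bsub>F\<^esub> \<iota> s = \<iota> c"
      by (auto simp: V_iff)
    have "\<iota> (s \<otimes>\<^bsub>R\<^esub> a) = \<iota> b \<otimes>\<^bsub>F\<^esub> (v \<otimes>\<^bsub>F\<^esub> \<iota> s)" using v(1-4) ab by (simp add: F.m_ac)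
    also have "\<dots> = \<iota> (b \<otimes>\<^bsub>R\<^esub> c)" using v ab by simp
    finally have "s \<otimes>\<^bsub>R\<^esub> a = b \<otimes>\<^bsub>R\<^esub> c" using embed_eq_iff[of "s \<otimes>\<^bsub>R\<^esub> a" "b \<otimes>\<^bsub>R\<^esub> c"] v ab by simp
    then show "\<exists>s\<in>carrier R - P. b divides\<^bsub>R\<^esub> (s \<otimes>\<^bsub>R\<^esub> a)" using v by (auto simp: factor_def)
  next
    assume "\<exists>s\<in>carrier R - P. b divides\<^bsub>R\<^esub> (s \<otimes>\<^bsub>R\<^esub> a)"
    then obtain s c where sc: "s \<in> carrier R" "s \<notin> P" "c \<in> carrier R" "s \<otimes>\<^bsub>R\<^esub> a = b \<otimes>\<^bsub>R\<^esub> c"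
      by (auto simp: factor_def)
    have u: "\<iota> s \<in> Units F" using sc nz by (simp add: F.field_Units embed_zero_iff)
    have "\<iota> s \<otimes>\<^bsub>F\<^esub> \<iota> a = \<iota> b \<otimes>\<^bsub>F\<^esub> \<iota> c" using sc ab by (metis h.hom_mult)
    then have "inv\<^bsub>F\<^esub> \<iota> s \<otimes>\<^bsub>F\<^esub> (\<iota> s \<otimes>\<^bsub>F\<^esub> \<iota> a) = inv\<^bsub>F\<^esub> \<iota> s \<otimes>\<^bsub>F\<^esub> (\<iota> b \<otimes>\<^bsub>F\<^esub> \<iota> c)" by simp
    moreover have "inv\<^bsub>F\<^esub> \<iota> s \<otimes>\<^bsub>F\<^esub> (\<iota> s \<otimes>\<^bsub>F\<^esub> \<iota> a) = \<iota> a"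
      using ab sc u by (simp add: F.m_assoc[symmetric])
    moreover have "inv\<^bsub>F\<^esub> \<iota> s \<otimes>\<^bsub>F\<^esub> (\<iota> b \<otimes>\<^bsub>F\<^esub> \<iota> c) = \<iota> b \<otimes>\<^bsub>F\<^esub> (\<iota> c \<otimes>\<^bsub>F\<^esub> inv\<^bsub>F\<^esub> \<iota> s)"
      using ab sc u by (simp add: F.m_ac)
    moreover have "\<iota> c \<otimes>\<^bsub>F\<^esub> inv\<^bsub>F\<^esub> \<iota> s \<in> V"
      unfolding V_def using sc embed_in_image_iff[OF sc(1) Pc] by blast
    ultimately show "\<exists>v\<in>V. \<iota> a = \<iota> b \<otimes>\<^bsub>F\<^esub> v" by metis
  qed
  have "(\<forall>x\<in>V. \<forall>y\<in>V. (\<exists>v\<in>V. y = x \<otimes>\<^bsub>F\<^esub> v) \<or> (\<exists>v\<in>V. x = y \<otimes>\<^bsub>F\<^esub> v)) \<longleftrightarrow> essential R P"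
  proof
    assume val: "\<forall>x\<in>V. \<forall>y\<in>V. (\<exists>v\<in>V. y = x \<otimes>\<^bsub>F\<^esub> v) \<or> (\<exists>v\<in>V. x = y \<otimes>\<^bsub>F\<^esub> v)"
    show "essential R P"
      unfolding essential_def using val BV div_iff by blast
  next
    assume ess: "essential R P"
    \<comment> \<open>clear denominators: \<open>x = a / s\<close> divides \<open>y = b / t\<close> as soon as \<open>a\<close> divides \<open>b\<close>\<close>
    have clear: "\<exists>v\<in>V. y = x \<otimes>\<^bsub>F\<^esub> v"
      if x: "x \<in> carrier F" "a \<in> carrier R" "s \<in> carrier R - P" "x \<otimes>\<^bsub>F\<^esub> \<iota> s = \<iota> a"
        and y: "y \<in> V" "b \<in> carrier R" "t \<in> carrier R - P" "y \<otimes>\<^bsub>F\<^esub> \<iota> t = \<iota> b"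
        and v: "v \<in> V" "\<iota> b = \<iota> a \<otimes>\<^bsub>F\<^esub> v" for x y a b s t v
    proof -
      have yF: "y \<in> carrier F" and vF: "v \<in> carrier F" using y v by (auto simp: V_iff)
      have u: "\<iota> t \<in> Units F" using y nz by (simp add: F.field_Units embed_zero_iff)
      let ?w = "\<iota> s \<otimes>\<^bsub>F\<^esub> v \<otimes>\<^bsub>F\<^esub> inv\<^bsub>F\<^esub> \<iota> t"
      have "x \<otimes>\<^bsub>F\<^esub> ?w = (x \<otimes>\<^bsub>F\<^esub> \<iota> s) \<otimes>\<^bsub>F\<^esub> v \<otimes>\<^bsub>F\<^esub> inv\<^bsub>F\<^esub> \<iota> t"
        using x(1,3) vF u by (simp add: F.m_assoc)
      also have "\<dots> = y \<otimes>\<^bsub>F\<^esub> \<iota> t \<otimes>\<^bsub>F\<^esub> inv\<^bsub>F\<^esub> \<iota> t" using x(4) y(4) v(2) by simp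
      also have "\<dots> = y" using yF u y(3) by (simp add: F.m_assoc)
      finally have "y = x \<otimes>\<^bsub>F\<^esub> ?w" ..
      moreover have "inv\<^bsub>F\<^esub> \<iota> t \<in> V"
        unfolding V_iff using y(3) u by (intro bexI[of _ "\<one>\<^bsub>R\<^esub>"] bexI[of _ t]) auto
      then have "?w \<in> V" using subringE(6)[OF \<open>subring V F\<close>] v(1) BV x(3) by blast
      ultimately show ?thesis by blast
    qed
    show "\<forall>x\<in>V. \<forall>y\<in>V. (\<exists>v\<in>V. y = x \<otimes>\<^bsub>F\<^esub> v) \<or> (\<exists>v\<in>V. x = y \<otimes>\<^bsub>F\<^esub> v)"
    proof (intro ballI)
      fix x y assume xy: "x \<in> V" "y \<in> V"
      obtain a s where as: "a \<in> carrier R" "s \<in> carrier R - P" "x \<in> carrier F" "x \<otimes>\<^bsub>F\<^esub> \<iota> s = \<iota> a"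
        using xy by (auto simp: V_iff)
      obtain b t where bt: "b \<in> carrier R" "t \<in> carrier R - P" "y \<in> carrier F" "y \<otimes>\<^bsub>F\<^esub> \<iota> t = \<iota> b"
        using xy by (auto simp: V_iff)
      have "(\<exists>v\<in>V. \<iota> a = \<iota> b \<otimes>\<^bsub>F\<^esub> v) \<or> (\<exists>v\<in>V. \<iota> b = \<iota> a \<otimes>\<^bsub>F\<^esub> v)"
        using ess as(1) bt(1) div_iff unfolding essential_def by blast
      then show "(\<exists>v\<in>V. y = x \<otimes>\<^bsub>F\<^esub> v) \<or> (\<exists>v\<in>V. x = y \<otimes>\<^bsub>F\<^esub> v)"
        using clear[of x a s y b t] clear[of y b t x a s] as bt xy by blast
    qed
  qed
  then show ?thesis
    unfolding valuation_domain_def L using dom by (simp add: factor_def)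
qed

end

text \<open>Units lie in no proper ideal, so finite \<open>t\<close>-character may be tested on all nonzero elements.\<close>

theorem (in domain) Krull_type_domain_iff:
  "Krull_type_domain R \<longleftrightarrow> (\<forall>N. max_t_closed R N \<longrightarrow> essential R N) \<and>
     (\<forall>x\<in>carrier R - {\<zero>}. finite {N. max_t_closed R N \<and> x \<in> N})"
proof -
  interpret Q: field_of_fractions R "frac_field R" "frac_embed R"
    by (rule frac_field_of_fractions)
  let ?\<iota> = "frac_embed R"
  have "PVMD R \<longleftrightarrow> (\<forall>N. max_t_closed R N \<longrightarrow> essential R N)"
    unfolding PVMD_def using Q.t_maximal_iff Q.valuation_localization_iff max_t_closed_prime domain_axioms
    by metis
  moreover have "finite {N. t_maximal (frac_field R) (?\<iota> ` carrier R) N \<and> ?\<iota> x \<in> N} \<longleftrightarrow>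
      finite {N. max_t_closed R N \<and> x \<in> N}" if x: "x \<in> carrier R" for x
  proof -
    have sub: "N \<subseteq> carrier R" if "max_t_closed R N" for N
      using max_t_closedD(1)[OF that] by (rule t_closed_subset)
    have "{N. t_maximal (frac_field R) (?\<iota> ` carrier R) N \<and> ?\<iota> x \<in> N} =
        (`) ?\<iota> ` {N. max_t_closed R N \<and> x \<in> N}"
      using Q.embed_in_image_iff[OF x sub] by (auto simp: Q.t_maximal_iff)
    moreover have "inj_on ((`) ?\<iota>) {N. max_t_closed R N \<and> x \<in> N}"
      using inj_on_image_eq_iff[OF Q.inj] sub by (intro inj_onI) blast
    ultimately show ?thesis by (simp add: finite_image_iff)
  qed
  moreover have "{N. max_t_closed R N \<and> x \<in> N} = {}" if x: "x \<in> Units R" for x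
  proof -
    have False if N: "max_t_closed R N" "x \<in> N" for N
    proof -
      interpret N: primeideal N R by (rule max_t_closed_prime[OF N(1)])
      have "inv x \<otimes> x \<in> N" using x by (intro N.I_l_closed[OF N(2)] Units_inv_closed)
      then show False using max_t_closedD(3)[OF N(1)] x by simp
    qed
    then show ?thesis by blast
  qed
  ultimately show ?thesis
    unfolding Krull_type_domain_def finite_t_character_def
    by (metis (no_types, lifting) Diff_iff finite.emptyI)
qed

lemma (in domain) valuation_domain_localization_iff:
  assumes "primeideal P R"
  shows "valuation_domain (localization R P) \<longleftrightarrow> essential R P"
  unfolding localization_def
  by (rule field_of_fractions.valuation_localization_iff[OF frac_field_of_fractions assms])

section \<open>Semilocal Bezout domains\<close>

context cring
begin

text \<open>Otherwise a product of elements, one from each ideal and none in \<open>Q\<close>, would lie in the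
intersection but not in the prime \<open>Q\<close>. The factor \<open>carrier R\<close> gives the empty intersection
its intended meaning.\<close>

lemma finite_Inter_subset_prime:
  assumes "finite \<F>" "\<And>I. I \<in> \<F> \<Longrightarrow> ideal I R" "primeideal Q R" "carrier R \<inter> \<Inter>\<F> \<subseteq> Q"
  obtains I where "I \<in> \<F>" "I \<subseteq> Q"
proof -
  interpret Q: primeideal Q R by fact
  have "\<exists>I\<in>\<F>. I \<subseteq> Q" using assms(1,2,4)
  proof (induction \<F> rule: finite_induct)
    case empty
    then show ?case using Q.I_notcarr Q.a_subset by auto
  next
    case (insert I \<F>)
    show ?case
    proof (rule ccontr)
      assume no: "\<not> ?case"
      then have "\<not> carrier R \<inter> \<Inter>\<F> \<subseteq> Q" using insert.IH insert.prems(1) by blast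
      then obtain x where x: "x \<in> carrier R" "x \<in> \<Inter>\<F>" "x \<notin> Q" by blast
      obtain y where y: "y \<in> I" "y \<notin> Q" using no by blast
      interpret I: ideal I R using insert.prems(1) by blast
      have yc: "y \<in> carrier R" using y(1) by (rule I.Icarr)
      have "x \<otimes> y \<in> J" if J: "J \<in> \<F>" for J
        using ideal.I_r_closed[of J R x y] insert.prems(1) J x(2) yc by blast
      moreover have "x \<otimes> y \<in> I" by (rule I.I_l_closed[OF y(1) x(1)])
      ultimately have "x \<otimes> y \<in> Q" using insert.prems(2) x(1) yc by blast
      then show False using Q.I_prime[OF x(1) yc] x(3) y(2) by blast
    qed
  qed
  then show ?thesis using that by blast
qed

lemma prime_avoidance:
  assumes "finite \<F>" "\<And>Q. Q \<in> \<F> \<Longrightarrow> primeideal Q R" "ideal I R" "I \<subseteq> \<Union>\<F>"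
  obtains Q where "Q \<in> \<F>" "I \<subseteq> Q"
proof -
  interpret I: ideal I R by fact
  have "\<exists>Q\<in>\<F>. I \<subseteq> Q" using assms(1,2,4)
  proof (induction \<F> rule: finite_psubset_induct)
    case (psubset \<F>)
    show ?case
    proof (cases "\<exists>Q\<in>\<F>. I \<subseteq> \<Union>(\<F> - {Q})")
      case True
      then obtain Q where Q: "Q \<in> \<F>" "I \<subseteq> \<Union>(\<F> - {Q})" by blast
      then have "\<F> - {Q} \<subset> \<F>" by blast
      from psubset.IH[OF this] psubset.prems(1) Q(2) show ?thesis by blast
    next
      case False
      \<comment> \<open>the cover is irredundant, so each prime has an element of \<open>I\<close> lying in no other one\<close>
      have "\<exists>x. x \<in> I \<and> x \<in> Q \<and> x \<notin> \<Union>(\<F> - {Q})" if Q: "Q \<in> \<F>" for Q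
      proof -
        obtain x where "x \<in> I" "x \<notin> \<Union>(\<F> - {Q})" using False Q by blast
        moreover have "x \<in> Q" using calculation psubset.prems(2) by blast
        ultimately show ?thesis by blast
      qed
      then obtain x where x: "\<And>Q. Q \<in> \<F> \<Longrightarrow> x Q \<in> I \<and> x Q \<in> Q \<and> x Q \<notin> \<Union>(\<F> - {Q})" by metis
      have "\<F> \<noteq> {}" using psubset.prems(2) I.zero_closed by blast
      then obtain Q where Q: "Q \<in> \<F>" by blast
      interpret Q: primeideal Q R by (rule psubset.prems(1)[OF Q])
      show ?thesis
      proof (cases "\<F> = {Q}")
        case True
        then show ?thesis using psubset.prems(2) by blast
      next
        case other: False
        \<comment> \<open>some \<open>y\<close> in \<open>I\<close> lies in all primes but \<open>Q\<close>; then \<open>x Q \<oplus> y\<close> lies in none of them\<close>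
        have "\<not> carrier R \<inter> \<Inter>(insert I (\<F> - {Q})) \<subseteq> Q"
        proof
          assume sub: "carrier R \<inter> \<Inter>(insert I (\<F> - {Q})) \<subseteq> Q"
          have fin: "finite (insert I (\<F> - {Q}))" using psubset.hyps by simp
          have idl: "ideal J R" if "J \<in> insert I (\<F> - {Q})" for J
            using that I.is_ideal psubset.prems(1) by (auto simp: primeideal_def)
          obtain J where J: "J \<in> insert I (\<F> - {Q})" "J \<subseteq> Q"
            by (rule finite_Inter_subset_prime[OF fin idl Q.primeideal sub])
          then consider "I \<subseteq> Q" | "J \<in> \<F>" "J \<noteq> Q" "J \<subseteq> Q" by blast
          then show False
          proof cases
            case 1
            from other Q obtain Q' where Q': "Q' \<in> \<F>" "Q' \<noteq> Q" by blast
            have "x Q' \<in> Q" using x[OF Q'(1)] 1 by blast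
            then show False using x[OF Q'(1)] Q Q' by blast
          next
            case 2
            then show False using x[of J] Q by blast
          qed
        qed
        then obtain y where y: "y \<in> I" "y \<in> carrier R" "\<And>J. J \<in> \<F> \<Longrightarrow> J \<noteq> Q \<Longrightarrow> y \<in> J" "y \<notin> Q" by blast
        have xI: "x Q \<in> I" "x Q \<in> Q" using x[OF Q] by auto
        have xc: "x Q \<in> carrier R" using xI(1) by (rule I.Icarr)
        have "x Q \<oplus> y \<in> I" using xI(1) y(1) by (rule I.a_closed)
        then obtain J where J: "J \<in> \<F>" "x Q \<oplus> y \<in> J" using psubset.prems(2) by blast
        interpret J: primeideal J R by (rule psubset.prems(1)[OF J(1)])
        have False
        proof (cases "J = Q")
          case True
          have "y = (\<ominus> x Q) \<oplus> (x Q \<oplus> y)" using xc y(2) by (simp add: r_neg1)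
          also have "\<dots> \<in> Q" using J(2) True xI(2) by simp
          finally show False using y(4) by blast
        next
          case False
          have yJ: "y \<in> J" using y(3)[OF J(1) False] .
          have "x Q = (x Q \<oplus> y) \<oplus> (\<ominus> y)" using xc y(2) by (simp add: a_assoc r_neg)
          also have "\<dots> \<in> J" using J(2) yJ by simp
          finally show False using x[OF Q] J(1) False by blast
        qed
        then show ?thesis ..
      qed
    qed
  qed
  then show ?thesis using that by blast
qed

text \<open>The colon ideal of the multiples of \<open>a\<close> that \<open>c\<close> divides; it measures how far \<open>c\<close> is from dividing
\<open>a\<close>, which makes divisibility a local property.\<close>

lemma ideal_divisor_multiples:
  assumes "c \<in> carrier R" "a \<in> carrier R"
  shows "ideal {d \<in> carrier R. c divides (d \<otimes> a)} R"
proof (rule idealI)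
  show "ring R" by (rule ring_axioms)
  show "subgroup {d \<in> carrier R. c divides (d \<otimes> a)} (add_monoid R)"
  proof (rule add.subgroupI)
    have "\<zero> \<in> {d \<in> carrier R. c divides (d \<otimes> a)}" using assms by (simp add: divides_zero)
    then show "{d \<in> carrier R. c divides (d \<otimes> a)} \<noteq> {}" by blast
    fix x y assume "x \<in> {d \<in> carrier R. c divides (d \<otimes> a)}"
    then obtain e where x: "x \<in> carrier R" "e \<in> carrier R" "x \<otimes> a = c \<otimes> e" by (auto simp: factor_def)
    have "(\<ominus> x) \<otimes> a = c \<otimes> (\<ominus> e)" using x assms by (simp add: l_minus r_minus)
    then show "\<ominus> x \<in> {d \<in> carrier R. c divides (d \<otimes> a)}"
      using x(1,2) a_inv_closed unfolding factor_def by blast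
    assume "y \<in> {d \<in> carrier R. c divides (d \<otimes> a)}"
    then obtain f where y: "y \<in> carrier R" "f \<in> carrier R" "y \<otimes> a = c \<otimes> f" by (auto simp: factor_def)
    have "(x \<oplus> y) \<otimes> a = c \<otimes> (e \<oplus> f)" using x y assms by (simp add: l_distr r_distr)
    then show "x \<oplus> y \<in> {d \<in> carrier R. c divides (d \<otimes> a)}"
      using x(1,2) y(1,2) a_closed unfolding factor_def by blast
  qed auto
  fix x r assume "x \<in> {d \<in> carrier R. c divides (d \<otimes> a)}" and r: "r \<in> carrier R"
  then obtain e where x: "x \<in> carrier R" "e \<in> carrier R" "x \<otimes> a = c \<otimes> e" by (auto simp: factor_def)
  have "(r \<otimes> x) \<otimes> a = r \<otimes> (x \<otimes> a)" using r x(1) assms by (simp add: m_assoc)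
  also have "\<dots> = c \<otimes> (r \<otimes> e)" unfolding x(3) using r x(2) assms by (simp add: m_lcomm)
  finally show rx: "r \<otimes> x \<in> {d \<in> carrier R. c divides (d \<otimes> a)}"
    using r x(1,2) m_closed unfolding factor_def by blast
  show "x \<otimes> r \<in> {d \<in> carrier R. c divides (d \<otimes> a)}"
    unfolding m_comm[OF x(1) r] by (rule rx)
qed

lemma divides_local_global:
  assumes "c \<in> carrier R" "a \<in> carrier R"
    and "\<And>P. maximalideal P R \<Longrightarrow> \<exists>d\<in>carrier R - P. c divides (d \<otimes> a)"
  shows "c divides a"
proof -
  let ?I = "{d \<in> carrier R. c divides (d \<otimes> a)}"
  have "\<one> \<in> ?I"
  proof (rule ccontr)
    assume "\<one> \<notin> ?I"
    then obtain P where "maximalideal P R" "?I \<subseteq> P"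
      by (rule maximalideal_exists[OF ideal_divisor_multiples[OF assms(1,2)]])
    then show False using assms(3) by blast
  qed
  then show ?thesis using assms(2) by simp
qed

lemma in_PIdl_iff:
  assumes "c \<in> carrier R" shows "a \<in> PIdl c \<longleftrightarrow> c divides a"
  using assms m_comm by (auto simp: cgenideal_def factor_def)

text \<open>The generator is \<open>c = a + y b\<close>. The maximal ideals are split into the set \<open>G\<close> of those where \<open>a\<close>
divides \<open>b\<close> locally and the set \<open>H\<close> of the others, where \<open>b\<close> strictly divides \<open>a\<close>. With \<open>y\<close> in all
ideals of \<open>G\<close> and in none of \<open>H\<close>, which exists by prime avoidance, \<open>c\<close> is locally associated to \<open>a\<close>
on \<open>G\<close> and to \<open>b\<close> on \<open>H\<close>.\<close>

lemma two_generators_principal: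
  assumes fin: "finite {P. maximalideal P R}"
    and ess: "\<And>P. maximalideal P R \<Longrightarrow> essential R P"
    and ab: "a \<in> carrier R" "b \<in> carrier R"
  obtains c where "c \<in> carrier R" "c divides a" "c divides b" "\<forall>I. ideal I R \<longrightarrow> a \<in> I \<longrightarrow> b \<in> I \<longrightarrow> c \<in> I"
proof -
  define G where "G = {P. maximalideal P R \<and> (\<exists>s\<in>carrier R - P. a divides (s \<otimes> b))}"
  define H where "H = {P. maximalideal P R} - G"
  have finGH: "finite G" "finite H" using fin by (auto simp: G_def H_def)
  have prime: "primeideal P R" if "maximalideal P R" for P using maximalideal_prime[OF that] .
  have "\<not> carrier R \<inter> \<Inter>G \<subseteq> \<Union>H"
  proof
    assume sub: "carrier R \<inter> \<Inter>G \<subseteq> \<Union>H"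
    have idG: "ideal P R" if "P \<in> G" for P
      using that by (auto simp: G_def maximalideal_def)
    have eq: "carrier R \<inter> \<Inter>G = \<Inter>(insert (carrier R) G)" by auto
    have "ideal (\<Inter>(insert (carrier R) G)) R"
      by (rule i_Intersect) (use idG oneideal in auto)
    then have idl: "ideal (carrier R \<inter> \<Inter>G) R" unfolding eq .
    obtain Q where Q: "Q \<in> H" "carrier R \<inter> \<Inter>G \<subseteq> Q"
      by (rule prime_avoidance[OF finGH(2) _ idl sub]) (auto simp: H_def intro: prime)
    have mQ: "maximalideal Q R" using Q(1) by (simp add: H_def)
    obtain P where P: "P \<in> G" "P \<subseteq> Q"
      by (rule finite_Inter_subset_prime[OF finGH(1) idG prime[OF mQ] Q(2)])
    have mP: "maximalideal P R" using P(1) by (simp add: G_def)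
    have "Q = P \<or> Q = carrier R"
      using mQ P(2) by (intro maximalideal.I_maximal[OF mP])
        (auto simp: maximalideal_def ideal_def additive_subgroup.a_subset)
    moreover have "Q \<noteq> P" using P(1) Q(1) by (auto simp: H_def)
    ultimately show False using maximalideal.I_notcarr[OF mQ] by simp
  qed
  then obtain y where y: "y \<in> carrier R" "\<And>P. P \<in> G \<Longrightarrow> y \<in> P" "\<And>P. P \<in> H \<Longrightarrow> y \<notin> P" by blast
  define c where "c = a \<oplus> y \<otimes> b"
  have c: "c \<in> carrier R" using ab y(1) by (simp add: c_def)
  have both: "\<exists>d\<in>carrier R - P. c divides (d \<otimes> a) \<and> c divides (d \<otimes> b)" if mP: "maximalideal P R" for P
  proof -
    interpret P: primeideal P R by (rule prime[OF mP])
    have one: "\<one> \<notin> P" using P.I_notcarr P.one_imp_carrier by blast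
    show ?thesis
    proof (cases "P \<in> G")
      case True
      then obtain s e where s: "s \<in> carrier R" "s \<notin> P" "e \<in> carrier R" "s \<otimes> b = a \<otimes> e"
        by (auto simp: G_def factor_def)
      \<comment> \<open>locally at \<open>P\<close> the element \<open>c\<close> is \<open>a\<close> times the unit \<open>1 + y (b / a)\<close>\<close>
      define w where "w = s \<oplus> y \<otimes> e"
      have wc: "w \<in> carrier R" using s y(1) by (simp add: w_def)
      have ye: "y \<otimes> e \<in> P" using y(2)[OF True] s(3) by (rule P.I_r_closed)
      have wP: "w \<notin> P"
      proof
        assume "w \<in> P"
        then have "w \<oplus> (\<ominus> (y \<otimes> e)) \<in> P" using ye by simp
        moreover have "w \<oplus> (\<ominus> (y \<otimes> e)) = s" using s y(1) by (simp add: w_def a_assoc r_neg)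
        ultimately show False using s(2) by simp
      qed
      have sc: "s \<otimes> c = a \<otimes> w"
      proof -
        have "s \<otimes> c = s \<otimes> a \<oplus> y \<otimes> (s \<otimes> b)" unfolding c_def using s(1) ab y(1) by (simp add: r_distr m_lcomm)
        also have "\<dots> = a \<otimes> w" unfolding s(4) w_def using s(1,3) ab y(1) by (simp add: r_distr m_lcomm m_comm)
        finally show ?thesis .
      qed
      have "w \<otimes> a = c \<otimes> s" using sc c wc s(1) ab by (simp add: m_comm)
      then have "s \<otimes> (w \<otimes> a) = c \<otimes> (s \<otimes> s)" using c s(1) by (simp add: m_lcomm)
      then have 1: "(s \<otimes> w) \<otimes> a = c \<otimes> (s \<otimes> s)" using ab wc s(1) by (simp add: m_assoc)
      have "(s \<otimes> w) \<otimes> b = w \<otimes> (s \<otimes> b)" using ab wc s(1) by (simp add: m_ac)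
      also have "\<dots> = (w \<otimes> a) \<otimes> e" unfolding s(4) using ab wc s(3) by (simp add: m_assoc)
      also have "\<dots> = c \<otimes> (s \<otimes> e)" unfolding \<open>w \<otimes> a = c \<otimes> s\<close> using c s(1,3) by (simp add: m_assoc)
      finally have 2: "(s \<otimes> w) \<otimes> b = c \<otimes> (s \<otimes> e)" .
      have "s \<otimes> w \<in> carrier R - P" using s(1,2) wc wP P.I_prime by auto
      then show ?thesis using 1 2 s(1,3) unfolding factor_def by (metis m_closed)
    next
      case False
      then have yP: "y \<notin> P" using y(3) mP by (simp add: H_def)
      obtain s e where s: "s \<in> carrier R" "s \<notin> P" "e \<in> carrier R" "s \<otimes> a = b \<otimes> e"
        using ess[OF mP] ab False mP unfolding G_def essential_def factor_def by blast
      have eP: "e \<in> P"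
      proof (rule ccontr)
        assume "e \<notin> P"
        moreover have "e \<otimes> b = a \<otimes> s" using s ab by (simp add: m_comm)
        ultimately show False using False mP s(1,3) unfolding G_def factor_def by blast
      qed
      \<comment> \<open>locally at \<open>P\<close> the element \<open>c\<close> is \<open>b\<close> times the unit \<open>a / b + y\<close>\<close>
      define w where "w = e \<oplus> y \<otimes> s"
      have wc: "w \<in> carrier R" using s y(1) by (simp add: w_def)
      have wP: "w \<notin> P"
      proof
        assume "w \<in> P"
        then have "(\<ominus> e) \<oplus> w \<in> P" using eP by simp
        moreover have "(\<ominus> e) \<oplus> w = y \<otimes> s" using s y(1) by (simp add: w_def r_neg1)
        ultimately show False using P.I_prime[OF y(1) s(1)] s(2) yP by simp
      qed
      have sc: "s \<otimes> c = b \<otimes> w"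
      proof -
        have "s \<otimes> c = s \<otimes> a \<oplus> s \<otimes> (y \<otimes> b)" unfolding c_def using s(1) ab y(1) by (simp add: r_distr)
        also have "\<dots> = b \<otimes> w" unfolding s(4) w_def using s(1,3) ab y(1) by (simp add: r_distr m_ac)
        finally show ?thesis .
      qed
      have wb: "w \<otimes> b = c \<otimes> s" using sc c wc s(1) ab by (simp add: m_comm)
      have 1: "(s \<otimes> w) \<otimes> b = c \<otimes> (s \<otimes> s)"
      proof -
        have "(s \<otimes> w) \<otimes> b = s \<otimes> (w \<otimes> b)" using ab wc s(1) by (simp add: m_assoc)
        also have "\<dots> = c \<otimes> (s \<otimes> s)" unfolding wb using c s(1) by (simp add: m_lcomm)
        finally show ?thesis .
      qed
      have "(s \<otimes> w) \<otimes> a = w \<otimes> (s \<otimes> a)" using ab wc s(1) by (simp add: m_ac)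
      also have "\<dots> = (w \<otimes> b) \<otimes> e" unfolding s(4) using ab wc s(3) by (simp add: m_assoc)
      also have "\<dots> = c \<otimes> (s \<otimes> e)" unfolding wb using c s(1,3) by (simp add: m_assoc)
      finally have 2: "(s \<otimes> w) \<otimes> a = c \<otimes> (s \<otimes> e)" .
      have "s \<otimes> w \<in> carrier R - P" using s(1,2) wc wP P.I_prime by auto
      then show ?thesis using 1 2 s(1,3) unfolding factor_def by (metis m_closed)
    qed
  qed
  show ?thesis
  proof (rule that[OF c])
    show "c divides a" by (rule divides_local_global[OF c ab(1)]) (use both in blast)
    show "c divides b" by (rule divides_local_global[OF c ab(2)]) (use both in blast)
    show "\<forall>I. ideal I R \<longrightarrow> a \<in> I \<longrightarrow> b \<in> I \<longrightarrow> c \<in> I"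
      unfolding c_def
      by (intro allI impI additive_subgroup.a_closed ideal.axioms(1) ideal.I_l_closed y(1))
  qed
qed

theorem semilocal_finitely_generated_principal:
  assumes fin: "finite {P. maximalideal P R}"
    and ess: "\<And>P. maximalideal P R \<Longrightarrow> essential R P"
    and S: "finite S" "S \<subseteq> carrier R"
  shows "principalideal (Idl S) R"
proof -
  have "\<exists>c\<in>carrier R. Idl S = PIdl c" using S
  proof (induction S rule: finite_induct)
    case empty
    have "Idl {} \<subseteq> {\<zero>}" by (rule genideal_minimal[OF zeroideal]) simp
    moreover have "\<zero> \<in> Idl {}"
      using genideal_ideal[of "{}"] by (simp add: additive_subgroup.zero_closed ideal.axioms(1))
    moreover have "PIdl \<zero> = {\<zero>}" by (auto simp: cgenideal_def intro: exI[of _ \<zero>])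
    ultimately have "Idl {} = PIdl \<zero>" by (metis empty_subsetI insert_subset subset_antisym)
    then show ?case using zero_closed by metis
  next
    case (insert a S)
    then obtain b where b: "b \<in> carrier R" "Idl S = PIdl b" by auto
    have a: "a \<in> carrier R" using insert.prems by simp
    have Sc: "S \<subseteq> carrier R" using insert.prems by simp
    obtain c where c: "c \<in> carrier R" "c divides a" "c divides b"
      "\<forall>I. ideal I R \<longrightarrow> a \<in> I \<longrightarrow> b \<in> I \<longrightarrow> c \<in> I"
      by (rule two_generators_principal[OF fin ess a b(1)])
    have idl: "ideal (Idl (insert a S)) R" by (rule genideal_ideal[OF insert.prems])
    have self: "insert a S \<subseteq> Idl (insert a S)" by (rule genideal_self[OF insert.prems])
    have "Idl S \<subseteq> Idl (insert a S)" using self by (intro genideal_minimal[OF idl]) simp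
    moreover have "b \<in> Idl S" unfolding b(2) by (rule cgenideal_self[OF b(1)])
    ultimately have "c \<in> Idl (insert a S)" using c(4) idl self by blast
    then have "PIdl c \<subseteq> Idl (insert a S)" by (rule cgenideal_minimal[OF idl])
    moreover have "Idl (insert a S) \<subseteq> PIdl c"
    proof (rule genideal_minimal[OF cgenideal_ideal[OF c(1)]])
      have "S \<subseteq> PIdl b" using genideal_self[OF Sc] b(2) by simp
      moreover have "PIdl b \<subseteq> PIdl c"
        using c(1,3) b(1) by (intro cgenideal_minimal[OF cgenideal_ideal[OF c(1)]]) (simp add: in_PIdl_iff)
      moreover have "a \<in> PIdl c" using c(1,2) by (simp add: in_PIdl_iff)
      ultimately show "insert a S \<subseteq> PIdl c" by blast
    qed
    ultimately show ?case using c(1) by blast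
  qed
  then show ?thesis using cgenideal_is_principalideal by auto
qed

end

text \<open>If \<open>d\<close> generates the ideal of \<open>a = d e\<close> and \<open>b = d f\<close>, then \<open>1\<close> is a combination of \<open>e\<close> and
\<open>f\<close>, so one of them lies outside \<open>P\<close> and serves as the multiplier in \<open>f a = e b\<close>.\<close>

lemma (in domain) Bezout_maximal_essential:
  assumes bez: "\<And>S. finite S \<Longrightarrow> S \<subseteq> carrier R \<Longrightarrow> principalideal (Idl S) R"
    and P: "maximalideal P R"
  shows "essential R P"
proof (rule essentialI)
  interpret P: primeideal P R by (rule maximalideal_prime[OF P])
  have one: "\<one> \<notin> P" using P.I_notcarr P.one_imp_carrier by blast
  fix a b assume ab: "a \<in> carrier R" "b \<in> carrier R"
  let ?S = "{a, b}"
  have "principalideal (Idl ?S) R" using bez[of ?S] ab by simp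
  then obtain d where d: "d \<in> carrier R" "Idl ?S = PIdl d"
    using principalideal.generate[of "Idl ?S" R] cgenideal_eq_genideal by metis
  have self: "?S \<subseteq> PIdl d" using genideal_self[of ?S] ab d by simp
  then obtain e f where ef: "e \<in> carrier R" "f \<in> carrier R" "a = d \<otimes> e" "b = d \<otimes> f"
    using in_PIdl_iff[OF d(1)] by (auto simp: factor_def)
  let ?J = "PIdl a <+>\<^bsub>R\<^esub> PIdl b"
  have Jid: "ideal ?J R" by (intro add_ideals cgenideal_ideal ab)
  have aJ: "a \<in> ?J"
    using cgenideal_self[OF ab(1)] additive_subgroup.zero_closed[OF ideal.axioms(1)[OF cgenideal_ideal[OF ab(2)]]] ab(1)
    unfolding set_add_def' by force
  have bJ: "b \<in> ?J"
    using cgenideal_self[OF ab(2)] additive_subgroup.zero_closed[OF ideal.axioms(1)[OF cgenideal_ideal[OF ab(1)]]] ab(2)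
    unfolding set_add_def' by force
  have "d \<in> ?J" using genideal_minimal[OF Jid, of ?S] aJ bJ d cgenideal_self[OF d(1)] by auto
  then obtain x y where xy: "x \<in> carrier R" "y \<in> carrier R" "d = x \<otimes> a \<oplus> y \<otimes> b"
    unfolding set_add_def' cgenideal_def by auto
  show "\<exists>s\<in>carrier R - P. \<exists>c\<in>carrier R. s \<otimes> a = b \<otimes> c \<or> s \<otimes> b = a \<otimes> c"
  proof (cases "d = \<zero>")
    case True
    then show ?thesis using ef one by (intro bexI[of _ \<one>] bexI[of _ \<zero>]) auto
  next
    case False
    let ?u = "x \<otimes> e \<oplus> y \<otimes> f"
    have uc: "?u \<in> carrier R" using xy ef by simp
    have "d \<otimes> ?u = d \<otimes> \<one>"
      using xy(3) unfolding ef(3,4) using xy(1,2) ef(1,2) d(1) by (simp add: r_distr m_lcomm)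
    then have u1: "?u = \<one>" using m_lcancel[OF False d(1) uc one_closed] by simp
    have "e \<notin> P \<or> f \<notin> P"
    proof (rule ccontr)
      assume "\<not> ?thesis"
      then have "?u \<in> P" using xy(1,2) P.I_l_closed by (auto intro!: P.a_closed)
      then show False using u1 one by simp
    qed
    moreover have "f \<otimes> a = b \<otimes> e" "e \<otimes> b = a \<otimes> f" unfolding ef(3,4) using d(1) ef(1,2) by (simp_all add: m_ac)
    ultimately show ?thesis using ef(1,2) by blast
  qed
qed

lemma (in domain) semilocal_Bezout_iff:
  assumes "finite {P. maximalideal P R}"
  shows "Bezout_domain R \<longleftrightarrow> (\<forall>P. maximalideal P R \<longrightarrow> essential R P)"
proof
  assume "Bezout_domain R"
  then show "\<forall>P. maximalideal P R \<longrightarrow> essential R P"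
    by (intro allI impI Bezout_maximal_essential) (simp_all add: Bezout_domain_def)
next
  assume ess: "\<forall>P. maximalideal P R \<longrightarrow> essential R P"
  have "principalideal (Idl S) R" if "finite S" "S \<subseteq> carrier R" for S
    by (rule semilocal_finitely_generated_principal[OF assms _ that]) (simp add: ess)
  then show "Bezout_domain R" by (simp add: Bezout_domain_def domain_axioms)
qed


section \<open>Residue rings\<close>

context cring
begin

lemma carrier_quotient: "carrier (R Quot I) = (+>) I ` carrier R"
  by (auto simp: FactRing_def A_RCOSETS_def')

lemma coset_in_image_iff:
  assumes I: "ideal I R" and P: "ideal P R" "I \<subseteq> P" and s: "s \<in> carrier R"
  shows "I +> s \<in> (+>) I ` P \<longleftrightarrow> s \<in> P"
proof
  interpret I: ideal I R by fact
  assume "I +> s \<in> (+>) I ` P"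
  then have "s \<in> (\<Union>j\<in>P. I +> j)" using I.a_rcos_self[OF s] by blast
  then show "s \<in> P" using ideal_incl_iff[OF I P(1)] P(2) by blast
qed blast

lemma essential_quotient_iff:
  assumes I: "ideal I R" and P: "ideal P R" "I \<subseteq> P"
  shows "essential (R Quot I) ((+>) I ` P) \<longleftrightarrow>
    (\<forall>a\<in>carrier R. \<forall>b\<in>carrier R. \<exists>s\<in>carrier R - P. \<exists>c\<in>carrier R.
       I +> (s \<otimes> a) = I +> (b \<otimes> c) \<or> I +> (s \<otimes> b) = I +> (a \<otimes> c))"
proof -
  interpret I: ideal I R by fact
  have mult: "(I +> x) \<otimes>\<^bsub>R Quot I\<^esub> (I +> y) = I +> (x \<otimes> y)" if "x \<in> carrier R" "y \<in> carrier R" for x y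
    using I.rcoset_mult_add[OF that] by (simp add: FactRing_def)
  have outside: "carrier (R Quot I) - (+>) I ` P = (+>) I ` (carrier R - P)"
    using coset_in_image_iff[OF I P] by (auto simp: carrier_quotient)
  have "essential (R Quot I) ((+>) I ` P) \<longleftrightarrow>
    (\<forall>a\<in>carrier R. \<forall>b\<in>carrier R. \<exists>s\<in>carrier R - P.
       (\<exists>c\<in>carrier R. (I +> s) \<otimes>\<^bsub>R Quot I\<^esub> (I +> a) = (I +> b) \<otimes>\<^bsub>R Quot I\<^esub> (I +> c)) \<or>
       (\<exists>c\<in>carrier R. (I +> s) \<otimes>\<^bsub>R Quot I\<^esub> (I +> b) = (I +> a) \<otimes>\<^bsub>R Quot I\<^esub> (I +> c)))"
    unfolding essential_def factor_def outside unfolding carrier_quotient by simp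
  also have "\<dots> \<longleftrightarrow> (\<forall>a\<in>carrier R. \<forall>b\<in>carrier R. \<exists>s\<in>carrier R - P. \<exists>c\<in>carrier R.
       I +> (s \<otimes> a) = I +> (b \<otimes> c) \<or> I +> (s \<otimes> b) = I +> (a \<otimes> c))"
    by (intro ball_cong refl) (auto simp: mult)
  finally show ?thesis .
qed

lemma maximalideals_quotient:
  assumes I: "ideal I R"
  shows "{P'. maximalideal P' (R Quot I)} = (`) ((+>) I) ` {P. maximalideal P R \<and> I \<subseteq> P}"
proof -
  note bij = quot_ideal_correspondence[OF I]
  let ?f = "\<lambda>J. (+>) I ` J"
  have inj: "J = J'" if eq: "?f J = ?f J'" and J: "ideal J R" "I \<subseteq> J" "ideal J' R" "I \<subseteq> J'" for J J'
  proof -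
    have "J = \<Union>((+>) I ` J)" by (rule iffD1[OF ideal_incl_iff[OF I J(1)] J(2)])
    also have "\<dots> = \<Union>((+>) I ` J')" by (rule arg_cong[OF eq])
    also have "\<dots> = J'" by (rule iffD1[OF ideal_incl_iff[OF I J(3)] J(4), symmetric])
    finally show ?thesis .
  qed
  have surj: "\<exists>J. ideal J R \<and> I \<subseteq> J \<and> J' = ?f J" if "ideal J' (R Quot I)" for J'
  proof -
    have "J' \<in> ?f ` {J. ideal J R \<and> I \<subseteq> J}"
      unfolding bij_betw_imp_surj_on[OF bij] using that by simp
    then show ?thesis by (elim imageE) blast
  qed
  have car: "ideal (carrier R) R" "I \<subseteq> carrier R"
    using oneideal additive_subgroup.a_subset[OF ideal.axioms(1)[OF I]] by blast+
  have sub: "J \<subseteq> J'" if "?f J \<subseteq> ?f J'" "ideal J R" "ideal J' R" "I \<subseteq> J'" for J J'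
  proof
    fix x assume x: "x \<in> J"
    then have "x \<in> carrier R" using that(2) by (rule ideal.Icarr[rotated])
    then show "x \<in> J'" using coset_in_image_iff[OF I that(3,4)] that(1) x by blast
  qed
  show ?thesis
  proof (intro equalityI subsetI)
    fix P' assume "P' \<in> {P'. maximalideal P' (R Quot I)}"
    then interpret P': maximalideal P' "R Quot I" by simp
    obtain P where P: "ideal P R" "I \<subseteq> P" "P' = ?f P" using surj[OF P'.is_ideal] by blast
    have "maximalideal P R"
    proof (rule maximalidealI[OF P(1)])
      show "carrier R \<noteq> P" using P'.I_notcarr P(3) carrier_quotient by metis
      fix J assume J: "ideal J R" "P \<subseteq> J" "J \<subseteq> carrier R"
      have IJ: "I \<subseteq> J" using P(2) J(2) by blast
      have "?f J = P' \<or> ?f J = carrier (R Quot I)"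
        by (rule P'.I_maximal[OF ring_ideal_imp_quot_ideal[OF I J(1)]])
          (use P(3) J in \<open>auto simp: carrier_quotient\<close>)
      then show "J = P \<or> J = carrier R"
        unfolding P(3) carrier_quotient using inj[OF _ J(1) IJ P(1,2)] inj[OF _ J(1) IJ car] by blast
    qed
    then show "P' \<in> (`) ((+>) I) ` {P. maximalideal P R \<and> I \<subseteq> P}" using P by blast
  next
    fix P' assume "P' \<in> (`) ((+>) I) ` {P. maximalideal P R \<and> I \<subseteq> P}"
    then obtain P where P: "maximalideal P R" "I \<subseteq> P" "P' = ?f P" by blast
    interpret P: maximalideal P R by fact
    have "maximalideal P' (R Quot I)"
    proof (rule maximalidealI)
      show "ideal P' (R Quot I)" unfolding P(3) by (rule ring_ideal_imp_quot_ideal[OF I P.is_ideal])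
      show "carrier (R Quot I) \<noteq> P'"
        unfolding carrier_quotient P(3) using inj[OF _ car P.is_ideal P(2)] P.I_notcarr by blast
      fix J' assume J': "ideal J' (R Quot I)" "P' \<subseteq> J'" "J' \<subseteq> carrier (R Quot I)"
      obtain J where J: "ideal J R" "I \<subseteq> J" "J' = ?f J" using surj[OF J'(1)] by blast
      have "P \<subseteq> J" by (rule sub[OF _ P.is_ideal J(1,2)]) (use J'(2) P(3) J(3) in simp)
      moreover have "J \<subseteq> carrier R" using J(1) by (simp add: ideal_def additive_subgroup.a_subset)
      ultimately have "J = P \<or> J = carrier R" by (intro P.I_maximal J(1))
      then show "J' = P' \<or> J' = carrier (R Quot I)" unfolding J(3) P(3) carrier_quotient by blast
    qed
    then show "P' \<in> {P'. maximalideal P' (R Quot I)}" by simp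
  qed
qed

lemma maximalideal_quotient_iff:
  assumes I: "ideal I R"
  shows "maximalideal P' (R Quot I) \<longleftrightarrow> (\<exists>P. maximalideal P R \<and> I \<subseteq> P \<and> P' = (+>) I ` P)"
proof -
  have "maximalideal P' (R Quot I) \<longleftrightarrow> P' \<in> (`) ((+>) I) ` {P. maximalideal P R \<and> I \<subseteq> P}"
    unfolding maximalideals_quotient[OF I, symmetric] by simp
  also have "\<dots> \<longleftrightarrow> (\<exists>P. maximalideal P R \<and> I \<subseteq> P \<and> P' = (+>) I ` P)"
    unfolding image_iff[of P'] by simp
  finally show ?thesis .
qed

lemma finite_maximalideals_quotient_iff:
  assumes I: "ideal I R"
  shows "finite {P'. maximalideal P' (R Quot I)} \<longleftrightarrow> finite {P. maximalideal P R \<and> I \<subseteq> P}"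
proof -
  have "inj_on ((`) ((+>) I)) {P. maximalideal P R \<and> I \<subseteq> P}"
    using bij_betw_imp_inj_on[OF quot_ideal_correspondence[OF I]]
    by (rule inj_on_subset) (auto simp: maximalideal_def)
  then show ?thesis unfolding maximalideals_quotient[OF I] by (rule finite_image_iff)
qed

end

section \<open>Ideals of the pullback ring\<close>

text \<open>The ring \<open>R\<close> with carrier \<open>B\<close> shares the operations of \<open>T\<close>, so both rings can be treated with the
arithmetic of \<open>T\<close> alone. That \<open>B\<close> is a full preimage under \<open>T \<rightarrow> T / M\<close> is expressed by \<open>M \<subseteq> B\<close>.\<close>

locale pullback_square = domain T + M: maximalideal M T for T (structure) and M +
  fixes B
  assumes subring: "subring B T" and M_subset: "M \<subseteq> B" and M_nonzero: "M \<noteq> {\<zero>}"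
    and B_proper: "B \<noteq> carrier T"
begin

abbreviation R where "R \<equiv> T\<lparr>carrier := B\<rparr>"

lemma B_carrier: "x \<in> B \<Longrightarrow> x \<in> carrier T"
  using subringE(1)[OF subring] by blast

lemmas B_zero = subringE(2)[OF subring]
  and B_one = subringE(3)[OF subring]
  and B_uminus = subringE(5)[OF subring]
  and B_mult = subringE(6)[OF subring]
  and B_add = subringE(7)[OF subring]

lemmas B_closed = B_zero B_one B_uminus B_mult B_add

lemma M_B: "m \<in> M \<Longrightarrow> m \<in> B"
  using M_subset by blast

lemma R_domain: "domain R"
  by (rule subring_is_domain[OF subring])

lemma M_prime: "primeideal M T"
  by (rule maximalideal_prime[OF M.is_maximalideal])

lemma one_notin_M: "\<one> \<notin> M"
  using M.I_notcarr M.one_imp_carrier by blast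

lemma M_cancel: "s \<in> carrier T \<Longrightarrow> x \<in> carrier T \<Longrightarrow> s \<otimes> x \<in> M \<Longrightarrow> s \<notin> M \<Longrightarrow> x \<in> M"
  using primeideal.I_prime[OF M_prime] by blast

lemma nonzero_in_M: obtains m where "m \<in> M" "m \<noteq> \<zero>"
  using M_nonzero M.zero_closed by blast

lemma divides_R: "b divides\<^bsub>R\<^esub> a \<longleftrightarrow> (\<exists>c\<in>B. a = b \<otimes> c)"
  by (simp add: factor_def)

lemma t_closed_RI:
  assumes "I \<subseteq> B"
    and "\<And>S x. \<lbrakk> finite S; S \<subseteq> I; x \<in> B;
       \<And>a b. \<lbrakk> a \<in> B; b \<in> B; \<And>s. s \<in> S \<Longrightarrow> \<exists>c\<in>B. a \<otimes> s = b \<otimes> c \<rbrakk> \<Longrightarrow> \<exists>c\<in>B. a \<otimes> x = b \<otimes> c \<rbrakk>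
      \<Longrightarrow> x \<in> I"
  shows "t_closed R I"
  unfolding t_closed_def
proof (intro conjI allI impI subsetI)
  show "x \<in> carrier R" if "x \<in> I" for x using that assms(1) by auto
  fix S x assume S: "finite S" "S \<subseteq> I" and x: "x \<in> v_hull R S"
  show "x \<in> I"
  proof (rule assms(2)[OF S])
    show "x \<in> B" using v_hull_carrier[OF x] by simp
    fix a b assume "a \<in> B" "b \<in> B" "\<And>s. s \<in> S \<Longrightarrow> \<exists>c\<in>B. a \<otimes> s = b \<otimes> c"
    then show "\<exists>c\<in>B. a \<otimes> x = b \<otimes> c" using v_hullD[OF x, of a b] by (simp add: divides_R)
  qed
qed

lemma v_hull_RI:
  assumes "x \<in> B"
    and "\<And>a b. \<lbrakk> a \<in> B; b \<in> B; \<And>s. s \<in> S \<Longrightarrow> \<exists>c\<in>B. a \<otimes> s = b \<otimes> c \<rbrakk> \<Longrightarrow> \<exists>c\<in>B. a \<otimes> x = b \<otimes> c"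
  shows "x \<in> v_hull R S"
  by (rule v_hullI) (use assms in \<open>simp_all add: divides_R\<close>)

lemma essential_RI:
  assumes "\<And>a b. \<lbrakk> a \<in> B; b \<in> B \<rbrakk> \<Longrightarrow> \<exists>s\<in>B - P. \<exists>c\<in>B. s \<otimes> a = b \<otimes> c \<or> s \<otimes> b = a \<otimes> c"
  shows "essential R P"
  by (rule essentialI) (use assms in simp)

lemma essential_RE:
  assumes "essential R P" "a \<in> B" "b \<in> B"
  obtains s c where "s \<in> B" "s \<notin> P" "c \<in> B" "s \<otimes> a = b \<otimes> c"
  | s c where "s \<in> B" "s \<notin> P" "c \<in> B" "s \<otimes> b = a \<otimes> c"
  using essentialE[OF assms(1), of a b] assms(2,3) by simp metis

lemma ideal_R:
  assumes "ideal I R"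
  shows "I \<subseteq> B" "\<zero> \<in> I" "\<And>x y. x \<in> I \<Longrightarrow> y \<in> I \<Longrightarrow> x \<oplus> y \<in> I"
    "\<And>x r. x \<in> I \<Longrightarrow> r \<in> B \<Longrightarrow> r \<otimes> x \<in> I" "\<And>x r. x \<in> I \<Longrightarrow> r \<in> B \<Longrightarrow> x \<otimes> r \<in> I"
    "\<And>x. x \<in> I \<Longrightarrow> \<ominus> x \<in> I"
proof -
  interpret I: ideal I R by fact
  show sub: "I \<subseteq> B" using I.a_subset by simp
  show "\<zero> \<in> I" using additive_subgroup.zero_closed[OF I.is_additive_subgroup] by simp
  show "\<And>x y. x \<in> I \<Longrightarrow> y \<in> I \<Longrightarrow> x \<oplus> y \<in> I"
    using additive_subgroup.a_closed[OF I.is_additive_subgroup] by simp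
  show l: "\<And>x r. x \<in> I \<Longrightarrow> r \<in> B \<Longrightarrow> r \<otimes> x \<in> I" using I.I_l_closed by simp
  show "\<And>x r. x \<in> I \<Longrightarrow> r \<in> B \<Longrightarrow> x \<otimes> r \<in> I" using I.I_r_closed by simp
  show "\<ominus> x \<in> I" if x: "x \<in> I" for x
  proof -
    have "(\<ominus> \<one>) \<otimes> x \<in> I" by (rule l[OF x B_uminus[OF B_one]])
    moreover have "x \<in> carrier T" using x sub B_carrier by blast
    ultimately show ?thesis by (simp add: l_minus)
  qed
qed

lemma prime_R:
  assumes "primeideal P R"
  shows "ideal P R" "\<one> \<notin> P" "\<And>x y. x \<in> B \<Longrightarrow> y \<in> B \<Longrightarrow> x \<otimes> y \<in> P \<Longrightarrow> x \<in> P \<or> y \<in> P"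
proof -
  interpret P: primeideal P R by fact
  show "ideal P R" by (rule P.is_ideal)
  show "\<one> \<notin> P" using P.I_notcarr P.one_imp_carrier by auto
  show "\<And>x y. x \<in> B \<Longrightarrow> y \<in> B \<Longrightarrow> x \<otimes> y \<in> P \<Longrightarrow> x \<in> P \<or> y \<in> P" using P.I_prime by simp
qed

lemma ideal_contraction:
  assumes "ideal I T" shows "ideal (I \<inter> B) R"
proof -
  interpret I: ideal I T by fact
  show ?thesis
  proof (rule idealI)
    show "ring R" using R_domain by (simp add: domain_def cring_def)
    have "subgroup (I \<inter> B) (add_monoid T)"
    proof (rule add.subgroupI)
      show "I \<inter> B \<noteq> {}" using additive_subgroup.zero_closed[OF I.is_additive_subgroup] B_zero by blast
      show "I \<inter> B \<subseteq> carrier T" using B_carrier by blast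
      show "\<ominus> x \<in> I \<inter> B" if "x \<in> I \<inter> B" for x
        using that additive_subgroup.a_inv_closed[OF I.is_additive_subgroup] B_uminus by blast
      show "x \<oplus> y \<in> I \<inter> B" if "x \<in> I \<inter> B" "y \<in> I \<inter> B" for x y
        using that additive_subgroup.a_closed[OF I.is_additive_subgroup] B_add by blast
    qed
    then show "subgroup (I \<inter> B) (add_monoid R)"
      using add.subgroup_incl[of "I \<inter> B" B] subring by (simp add: subring_def)
    fix a x assume "a \<in> I \<inter> B" "x \<in> carrier R"
    then show "x \<otimes>\<^bsub>R\<^esub> a \<in> I \<inter> B" "a \<otimes>\<^bsub>R\<^esub> x \<in> I \<inter> B"
      using I.I_l_closed I.I_r_closed B_mult B_carrier by auto
  qed
qed

lemma prime_contraction: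
  assumes "primeideal P T" shows "primeideal (P \<inter> B) R"
proof -
  interpret P: primeideal P T by fact
  have "\<one> \<notin> P" using P.I_notcarr P.one_imp_carrier by blast
  then show ?thesis
    by (intro primeidealI ideal_contraction P.is_ideal)
      (use R_domain B_one B_carrier P.I_prime in \<open>auto simp: domain_def\<close>)
qed

lemma M_ideal_R: "ideal M R" and M_prime_R: "primeideal M R"
  using ideal_contraction[OF M.is_ideal] prime_contraction[OF M_prime] M_subset
  by (simp_all add: Int_absorb2)

text \<open>The residue ring of \<open>T\<close> modulo \<open>M\<close> is a field.\<close>

lemma inverse_modulo_M:
  assumes t: "t \<in> carrier T" "t \<notin> M"
  obtains u n where "u \<in> carrier T" "n \<in> M" "u \<otimes> t = \<one> \<oplus> n"
proof -
  let ?J = "M <+>\<^bsub>T\<^esub> PIdl t"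
  have J: "ideal ?J T" by (intro add_ideals M.is_ideal cgenideal_ideal t)
  have "M \<subseteq> ?J"
  proof
    fix m assume m: "m \<in> M"
    then have "m \<oplus> \<zero> \<in> ?J" using additive_subgroup.zero_closed[OF ideal.axioms(1)[OF cgenideal_ideal[OF t(1)]]]
      unfolding set_add_def' by blast
    then show "m \<in> ?J" using m M.Icarr by simp
  qed
  moreover have "t \<in> ?J"
  proof -
    have "\<zero> \<oplus> t \<in> ?J" using M.zero_closed cgenideal_self[OF t(1)] unfolding set_add_def' by blast
    then show ?thesis using t by simp
  qed
  moreover have "?J \<subseteq> carrier T" using J by (simp add: ideal_def additive_subgroup.a_subset)
  ultimately have "?J = carrier T" using M.I_maximal[OF J] t by blast
  then have "\<one> \<in> ?J" by simp
  then obtain m u where mu: "m \<in> M" "u \<in> carrier T" "\<one> = m \<oplus> u \<otimes> t"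
    unfolding set_add_def' cgenideal_def by blast
  have "u \<otimes> t = \<one> \<oplus> (\<ominus> m)" using mu t M.Icarr by (simp add: a_ac r_neg1 r_neg2)
  then show ?thesis using that mu by blast
qed

lemma B_subtract_M:
  assumes "x \<in> carrier T" "n \<in> M" "x \<oplus> n \<in> B" shows "x \<in> B"
proof -
  have "x = (x \<oplus> n) \<oplus> (\<ominus> n)" using assms M.Icarr by (simp add: a_assoc r_neg)
  then show ?thesis using assms M_B B_closed by metis
qed

lemma one_plus_M:
  assumes "n \<in> M" shows "\<one> \<oplus> n \<in> B"
  by (rule B_add[OF B_one M_B[OF assms]])

lemma one_plus_M_notin:
  assumes "ideal P R" "M \<subseteq> P" "\<one> \<notin> P" "n \<in> M" shows "\<one> \<oplus> n \<notin> P"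
proof
  assume "\<one> \<oplus> n \<in> P"
  moreover have "\<ominus> n \<in> P" using ideal_R(6)[OF assms(1)] assms(2,4) by blast
  ultimately have "(\<one> \<oplus> n) \<oplus> (\<ominus> n) \<in> P" by (rule ideal_R(3)[OF assms(1)])
  then show False using assms M.Icarr by (simp add: a_assoc r_neg)
qed

text \<open>The ideal \<open>M\<close> is the conductor of \<open>T\<close> in \<open>R\<close>, hence divisorial. With a nonzero \<open>m \<in> M\<close> each \<open>t \<in> T\<close> is the
fraction \<open>m t / m\<close> of elements of \<open>R\<close>, so an \<open>x\<close> in the hull of a finite subset of \<open>M\<close> satisfies
\<open>t x \<in> R\<close> for all \<open>t\<close>. If \<open>x\<close> were outside \<open>M\<close>, it would be invertible modulo \<open>M\<close> and \<open>R\<close> would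
be all of \<open>T\<close>.\<close>

lemma M_t_closed: "t_closed R M"
proof (rule t_closed_RI[OF M_subset])
  fix S x assume S: "finite S" "S \<subseteq> M" and xB: "x \<in> B"
    and hull: "\<And>a b. \<lbrakk> a \<in> B; b \<in> B; \<And>s. s \<in> S \<Longrightarrow> \<exists>c\<in>B. a \<otimes> s = b \<otimes> c \<rbrakk> \<Longrightarrow> \<exists>c\<in>B. a \<otimes> x = b \<otimes> c"
  have xc: "x \<in> carrier T" using xB by (rule B_carrier)
  obtain m where m: "m \<in> M" "m \<noteq> \<zero>" by (rule nonzero_in_M)
  have mc: "m \<in> carrier T" using m(1) by (rule M.Icarr)
  have conductor: "t \<otimes> x \<in> B" if t: "t \<in> carrier T" for t
  proof -
    have "\<exists>c\<in>B. (m \<otimes> t) \<otimes> x = m \<otimes> c"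
    proof (rule hull)
      show "m \<otimes> t \<in> B" "m \<in> B" using m t M.I_r_closed M_B by blast+
      fix s assume "s \<in> S"
      then have s: "s \<in> M" using S by blast
      have "(m \<otimes> t) \<otimes> s = m \<otimes> (t \<otimes> s)" using mc t M.Icarr[OF s] by (simp add: m_assoc)
      moreover have "t \<otimes> s \<in> B" using M.I_l_closed[OF s t] M_B by blast
      ultimately show "\<exists>c\<in>B. (m \<otimes> t) \<otimes> s = m \<otimes> c" by blast
    qed
    then obtain c where c: "c \<in> B" "(m \<otimes> t) \<otimes> x = m \<otimes> c" by blast
    then have "m \<otimes> (t \<otimes> x) = m \<otimes> c" using mc t xc by (simp add: m_assoc)
    then have "t \<otimes> x = c" using m_lcancel[OF m(2) mc] t xc B_carrier[OF c(1)] by simp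
    then show ?thesis using c(1) by simp
  qed
  show "x \<in> M"
  proof (rule ccontr)
    assume "x \<notin> M"
    then obtain u n where u: "u \<in> carrier T" "n \<in> M" "u \<otimes> x = \<one> \<oplus> n"
      by (rule inverse_modulo_M[OF xc])
    obtain t where t: "t \<in> carrier T" "t \<notin> B" using B_proper B_carrier by blast
    have "(t \<otimes> u) \<otimes> x = t \<otimes> (\<one> \<oplus> n)" using t u(1) xc u(3) by (simp add: m_assoc)
    also have "\<dots> = t \<oplus> t \<otimes> n" using t u(2) M.Icarr by (simp add: r_distr)
    finally have "t \<oplus> t \<otimes> n \<in> B" using conductor[of "t \<otimes> u"] t u(1) by simp
    then have "t \<in> B" by (rule B_subtract_M[OF t(1) M.I_l_closed[OF u(2) t(1)]])
    then show False using t(2) by simp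
  qed
qed

lemma M_t_closed_in_T: "essential T M \<Longrightarrow> t_closed T M"
  by (rule essential_prime_t_closed[OF M_prime])

text \<open>Multiply both elements by a nonzero element of \<open>M\<close> to get into \<open>R\<close>, and cancel it afterwards.\<close>

lemma essential_lift:
  assumes "essential R Q" "P \<inter> B \<subseteq> Q" shows "essential T P"
proof (rule essentialI)
  obtain m where m: "m \<in> M" "m \<noteq> \<zero>" by (rule nonzero_in_M)
  have mc: "m \<in> carrier T" using m(1) by (rule M.Icarr)
  have cancel: "s \<otimes> a = b \<otimes> c" if "s \<in> B" "c \<in> B" "a \<in> carrier T" "b \<in> carrier T"
    "s \<otimes> (m \<otimes> a) = (m \<otimes> b) \<otimes> c" for s c a b
  proof -
    have "m \<otimes> (s \<otimes> a) = m \<otimes> (b \<otimes> c)" using that mc B_carrier by (simp add: m_ac)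
    then show ?thesis using m_lcancel[OF m(2) mc] that B_carrier by simp
  qed
  fix a b assume ab: "a \<in> carrier T" "b \<in> carrier T"
  have B: "m \<otimes> a \<in> B" "m \<otimes> b \<in> B" using M.I_r_closed[OF m(1)] ab M_B by auto
  from assms(1) B show "\<exists>s\<in>carrier T - P. \<exists>c\<in>carrier T. s \<otimes> a = b \<otimes> c \<or> s \<otimes> b = a \<otimes> c"
  proof (cases rule: essential_RE)
    case (1 s c)
    then have "s \<otimes> a = b \<otimes> c" using cancel ab by blast
    then show ?thesis using 1 assms(2) B_carrier by blast
  next
    case (2 s c)
    then have "s \<otimes> b = a \<otimes> c" using cancel ab by blast
    then show ?thesis using 2 assms(2) B_carrier by blast
  qed
qed

text \<open>Multiplying the data of a local divisibility in \<open>T\<close> by some \<open>m \<in> M\<close> outside \<open>P\<close> moves it into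
\<open>R\<close>: localizing at a prime not containing \<open>M\<close> does not distinguish \<open>R\<close> from \<open>T\<close>.\<close>

lemma essential_contraction:
  assumes P: "primeideal P T" "\<not> M \<subseteq> P" and ess: "essential T P"
  shows "essential R (P \<inter> B)"
proof (rule essential_RI)
  interpret P: primeideal P T by fact
  obtain m where m: "m \<in> M" "m \<notin> P" using P(2) by blast
  have mc: "m \<in> carrier T" using m(1) by (rule M.Icarr)
  have scale: "m \<otimes> s \<in> B - P \<inter> B \<and> m \<otimes> c \<in> B \<and> (m \<otimes> s) \<otimes> a = b \<otimes> (m \<otimes> c)"
    if "s \<in> carrier T" "s \<notin> P" "c \<in> carrier T" "a \<in> carrier T" "b \<in> carrier T" "s \<otimes> a = b \<otimes> c" for s c a b
  proof -
    have "(m \<otimes> s) \<otimes> a = m \<otimes> (b \<otimes> c)" using that(1-5) mc unfolding that(6)[symmetric] by (simp add: m_assoc)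
    also have "\<dots> = b \<otimes> (m \<otimes> c)" using that(1-5) mc by (simp add: m_lcomm)
    finally show ?thesis
      using that(1-5) mc m P.I_prime[OF mc that(1)] M.I_r_closed[OF m(1)] M_B by blast
  qed
  fix a b assume "a \<in> B" "b \<in> B"
  then have ab: "a \<in> carrier T" "b \<in> carrier T" by (simp_all add: B_carrier)
  from ess ab show "\<exists>s\<in>B - P \<inter> B. \<exists>c\<in>B. s \<otimes> a = b \<otimes> c \<or> s \<otimes> b = a \<otimes> c"
  proof (cases rule: essentialE)
    case (1 s c) then show ?thesis using scale[of s c a b] ab by blast
  next
    case (2 s c) then show ?thesis using scale[of s c b a] ab by blast
  qed
qed

text \<open>If \<open>x\<close> is in the hull of \<open>S\<close> over \<open>R\<close>, then \<open>m x\<close> is in the hull over \<open>T\<close> for each \<open>m \<in> M\<close>.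
The pair \<open>(a, b)\<close> over \<open>T\<close> is tested by the pair \<open>(m m a, m b)\<close> over \<open>R\<close>; the additional \<open>m\<close>
moves the quotients from \<open>T\<close> to \<open>R\<close>.\<close>

lemma t_closed_contraction:
  assumes P: "primeideal P T" "\<not> M \<subseteq> P" and t: "t_closed T P"
  shows "t_closed R (P \<inter> B)"
proof (rule t_closed_RI)
  interpret P: primeideal P T by fact
  obtain m where m: "m \<in> M" "m \<notin> P" using P(2) by blast
  have mc: "m \<in> carrier T" using m(1) by (rule M.Icarr)
  have m0: "m \<noteq> \<zero>" using m(2) P.zero_closed by blast
  fix S x assume S: "finite S" "S \<subseteq> P \<inter> B" and xB: "x \<in> B"
    and hull: "\<And>a b. \<lbrakk> a \<in> B; b \<in> B; \<And>s. s \<in> S \<Longrightarrow> \<exists>c\<in>B. a \<otimes> s = b \<otimes> c \<rbrakk> \<Longrightarrow> \<exists>c\<in>B. a \<otimes> x = b \<otimes> c"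
  have xc: "x \<in> carrier T" using xB by (rule B_carrier)
  have "m \<otimes> x \<in> v_hull T S"
  proof (rule v_hullI)
    show "m \<otimes> x \<in> carrier T" using mc xc by simp
    fix a b assume ab: "a \<in> carrier T" "b \<in> carrier T" and d: "\<And>s. s \<in> S \<Longrightarrow> b divides (a \<otimes> s)"
    have "\<exists>c\<in>B. (m \<otimes> (m \<otimes> a)) \<otimes> x = (m \<otimes> b) \<otimes> c"
    proof (rule hull)
      show "m \<otimes> (m \<otimes> a) \<in> B" "m \<otimes> b \<in> B" using M.I_r_closed[OF m(1)] ab mc M_B by auto
      fix s assume s: "s \<in> S"
      then have sc: "s \<in> carrier T" using S(2) B_carrier by blast
      obtain e where e: "e \<in> carrier T" "a \<otimes> s = b \<otimes> e" using d[OF s] by (auto simp: factor_def)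
      have "(m \<otimes> (m \<otimes> a)) \<otimes> s = m \<otimes> (m \<otimes> (a \<otimes> s))" using ab mc sc by (simp add: m_assoc)
      also have "\<dots> = (m \<otimes> b) \<otimes> (m \<otimes> e)" unfolding e(2) using ab mc e(1) by (simp add: m_ac)
      finally show "\<exists>c\<in>B. (m \<otimes> (m \<otimes> a)) \<otimes> s = (m \<otimes> b) \<otimes> c"
        using M.I_r_closed[OF m(1) e(1)] M_B by blast
    qed
    then obtain c where c: "c \<in> B" "(m \<otimes> (m \<otimes> a)) \<otimes> x = (m \<otimes> b) \<otimes> c" by blast
    have cc: "c \<in> carrier T" using c(1) by (rule B_carrier)
    have "m \<otimes> (a \<otimes> (m \<otimes> x)) = (m \<otimes> (m \<otimes> a)) \<otimes> x" using ab mc xc by (simp add: m_ac)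
    also have "\<dots> = m \<otimes> (b \<otimes> c)" unfolding c(2) using ab mc cc by (simp add: m_assoc)
    finally have "a \<otimes> (m \<otimes> x) = b \<otimes> c" using m_lcancel[OF m0 mc] ab mc xc cc by simp
    then show "b divides (a \<otimes> (m \<otimes> x))" using cc by (auto simp: factor_def)
  qed
  then have "m \<otimes> x \<in> P" using t_closedD[OF t S(1)] S(2) by blast
  then have "x \<in> P" using P.I_prime[OF mc xc] m(2) by blast
  then show "x \<in> P \<inter> B" using xB by blast
qed blast

text \<open>The set \<open>E\<close> is the prime of \<open>T\<close> lying over \<open>N\<close>. Hulls over \<open>T\<close> are transported to \<open>R\<close> by multiplication
with an element \<open>m\<close> of \<open>M\<close>, and \<open>m\<close> is removed again because the prime \<open>N\<close> does not contain it.\<close>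

lemma t_closed_extension:
  assumes N: "primeideal N R" "\<not> M \<subseteq> N" and t: "t_closed R N"
  defines "E \<equiv> {x \<in> carrier T. \<forall>m\<in>M. x \<otimes> m \<in> N}"
  shows "t_closed T E" "N \<subseteq> E" "\<one> \<notin> E"
proof -
  note p = prime_R[OF N(1)]
  note i = ideal_R[OF p(1)]
  obtain m where m: "m \<in> M" "m \<notin> N" using N(2) by blast
  have mc: "m \<in> carrier T" using m(1) by (rule M.Icarr)
  have mB: "m \<in> B" using m(1) by (rule M_B)
  show "N \<subseteq> E" using i(1,5) B_carrier M_B by (auto simp: E_def)
  show "\<one> \<notin> E" using m mc by (auto simp: E_def)
  show "t_closed T E"
    unfolding t_closed_def
  proof (intro conjI allI impI subsetI)
    show "x \<in> carrier T" if "x \<in> E" for x using that by (simp add: E_def)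
    fix S x assume S: "finite S" "S \<subseteq> E" and x: "x \<in> v_hull T S"
    have xc: "x \<in> carrier T" using x by (rule v_hull_carrier)
    have mx: "m \<otimes> x \<in> M" by (rule M.I_r_closed[OF m(1) xc])
    have "m \<otimes> (m \<otimes> x) \<in> v_hull R ((\<lambda>s. s \<otimes> m) ` S)"
    proof (rule v_hull_RI)
      show "m \<otimes> (m \<otimes> x) \<in> B" using mB M_B[OF mx] by (rule B_mult)
      fix a b assume ab: "a \<in> B" "b \<in> B"
        and d: "\<And>s. s \<in> (\<lambda>s. s \<otimes> m) ` S \<Longrightarrow> \<exists>c\<in>B. a \<otimes> s = b \<otimes> c"
      have abc: "a \<in> carrier T" "b \<in> carrier T" using ab by (simp_all add: B_carrier)
      have "b divides ((a \<otimes> m) \<otimes> x)"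
      proof (rule v_hullD[OF x])
        show "a \<otimes> m \<in> carrier T" "b \<in> carrier T" using abc mc by auto
        fix s assume s: "s \<in> S"
        then have sc: "s \<in> carrier T" using S(2) by (auto simp: E_def)
        obtain c where c: "c \<in> B" "a \<otimes> (s \<otimes> m) = b \<otimes> c" using d s by blast
        have "(a \<otimes> m) \<otimes> s = a \<otimes> (s \<otimes> m)" using abc mc sc by (simp add: m_ac)
        then show "b divides ((a \<otimes> m) \<otimes> s)" using c B_carrier by (auto simp: factor_def)
      qed
      then obtain e where e: "e \<in> carrier T" "(a \<otimes> m) \<otimes> x = b \<otimes> e" by (auto simp: factor_def)
      have "a \<otimes> (m \<otimes> (m \<otimes> x)) = ((a \<otimes> m) \<otimes> x) \<otimes> m" using abc mc xc by (simp add: m_ac)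
      also have "\<dots> = b \<otimes> (e \<otimes> m)" unfolding e(2) using abc mc e(1) by (simp add: m_assoc)
      finally show "\<exists>c\<in>B. a \<otimes> (m \<otimes> (m \<otimes> x)) = b \<otimes> c"
        using M_B[OF M.I_l_closed[OF m(1) e(1)]] by blast
    qed
    moreover have "(\<lambda>s. s \<otimes> m) ` S \<subseteq> N" using S(2) m(1) by (auto simp: E_def)
    ultimately have "m \<otimes> (m \<otimes> x) \<in> N" by (intro t_closedD[OF t finite_imageI[OF S(1)]])
    then have mxN: "m \<otimes> x \<in> N" using p(3)[OF mB M_B[OF mx]] m(2) by blast
    have "x \<otimes> k \<in> N" if k: "k \<in> M" for k
    proof -
      have xk: "x \<otimes> k \<in> B" using M_B[OF M.I_l_closed[OF k xc]] .
      have "m \<otimes> (x \<otimes> k) = (m \<otimes> x) \<otimes> k" using mc xc M.Icarr[OF k] by (simp add: m_assoc)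
      also have "\<dots> \<in> N" using mxN M_B[OF k] by (rule i(5))
      finally show ?thesis using p(3)[OF mB xk] m(2) by blast
    qed
    then show "x \<in> E" using xc by (simp add: E_def)
  qed
qed

text \<open>Enlarge the extension of \<open>N\<close> to a \<open>t\<close>-maximal ideal \<open>P\<close> of \<open>T\<close>. It does not contain \<open>M\<close>: otherwise it
would equal \<open>M\<close>, so that \<open>N\<close> would be properly contained in the \<open>t\<close>-closed ideal \<open>M\<close> of \<open>R\<close>. Hence its
contraction is \<open>t\<close>-closed and equals \<open>N\<close>.\<close>

lemma max_t_closed_R_is_contraction:
  assumes N: "max_t_closed R N" "\<not> M \<subseteq> N"
  obtains P where "max_t_closed T P" "\<not> M \<subseteq> P" "N = P \<inter> B"
proof -
  interpret R: domain R by (rule R_domain)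
  note mN = max_t_closedD[OF N(1), simplified]
  have pN: "primeideal N R" by (rule R.max_t_closed_prime[OF N(1)])
  have NB: "N \<subseteq> B" using t_closed_subset[OF mN(1)] by simp
  let ?E = "{x \<in> carrier T. \<forall>m\<in>M. x \<otimes> m \<in> N}"
  note E = t_closed_extension[OF pN N(2) mN(1)]
  have "\<zero> \<in> N" by (rule ideal_R(2)[OF prime_R(1)[OF pN]])
  then have "?E \<noteq> {\<zero>}" using E(2) mN(2) by blast
  then obtain P where P: "max_t_closed T P" "?E \<subseteq> P"
    by (rule t_closed_in_max_t_closed[OF E(1) _ E(3)])
  note mP = max_t_closedD[OF P(1)]
  have pP: "primeideal P T" by (rule max_t_closed_prime[OF P(1)])
  have NP: "N \<subseteq> P \<inter> B" using E(2) P(2) NB by blast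
  have MP: "\<not> M \<subseteq> P"
  proof
    assume "M \<subseteq> P"
    then have "P = M \<or> P = carrier T"
      using M.I_maximal[of P] pP by (auto simp: primeideal_def ideal_def additive_subgroup.a_subset)
    then have "P = M" using mP(3) by blast
    then have "N \<subseteq> M" using NP by blast
    then have "M = N" using mN(4)[OF M_t_closed] one_notin_M by simp
    then show False using N(2) by blast
  qed
  have "P \<inter> B = N"
    using mN(4)[OF t_closed_contraction[OF pP MP mP(1)]] mP(3) NP by blast
  then show ?thesis using that P(1) MP by blast
qed

lemma contraction_subset_imp_subset:
  assumes P: "primeideal P T" and Q: "primeideal Q T" "\<not> M \<subseteq> Q" and sub: "P \<inter> B \<subseteq> Q"
  shows "P \<subseteq> Q"
proof
  interpret P: primeideal P T by fact
  interpret Q: primeideal Q T by fact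
  obtain m where m: "m \<in> M" "m \<notin> Q" using Q(2) by blast
  fix x assume x: "x \<in> P"
  have mc: "m \<in> carrier T" using m(1) by (rule M.Icarr)
  have xc: "x \<in> carrier T" using x by (rule P.Icarr)
  have "m \<otimes> x \<in> P" using P.I_l_closed[OF x mc] .
  moreover have "m \<otimes> x \<in> B" using M_B[OF M.I_r_closed[OF m(1) xc]] .
  ultimately have "m \<otimes> x \<in> Q" using sub by blast
  then show "x \<in> Q" using Q.I_prime[OF mc xc] m(2) by blast
qed

lemma max_t_closed_T_incomparable_M:
  assumes t: "t_closed T M" and P: "max_t_closed T P" "P \<noteq> M"
  shows "\<not> M \<subseteq> P" "\<not> P \<inter> B \<subseteq> M"
proof -
  note mP = max_t_closedD[OF P(1)]
  have pP: "primeideal P T" by (rule max_t_closed_prime[OF P(1)])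
  then interpret P: primeideal P T .
  show "\<not> M \<subseteq> P"
  proof
    assume "M \<subseteq> P"
    then have "P = M \<or> P = carrier T"
      using M.I_maximal[OF P.is_ideal] P.a_subset by blast
    then show False using mP(3) P(2) by blast
  qed
  show "\<not> P \<inter> B \<subseteq> M"
  proof
    assume sub: "P \<inter> B \<subseteq> M"
    have "P \<subseteq> M"
    proof (rule ccontr)
      assume "\<not> P \<subseteq> M"
      then obtain x where x: "x \<in> P" "x \<notin> M" by blast
      obtain u n where u: "u \<in> carrier T" "n \<in> M" "u \<otimes> x = \<one> \<oplus> n"
        by (rule inverse_modulo_M[OF P.Icarr[OF x(1)] x(2)])
      have "\<one> \<oplus> n \<in> P \<inter> B" using P.I_l_closed[OF x(1) u(1)] u(3) one_plus_M[OF u(2)] by simp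
      then show False using one_plus_M_notin[OF M_ideal_R _ one_notin_M u(2)] sub by blast
    qed
    then show False using mP(4)[OF t one_notin_M] P(2) by blast
  qed
qed

text \<open>Let \<open>N\<close> be a \<open>t\<close>-maximal ideal of \<open>R\<close> containing the contraction of \<open>P\<close>. If it contained \<open>M\<close>,
then \<open>M\<close> and the contraction of \<open>P\<close> would be comparable as primes inside an essential prime. So \<open>N\<close>
is the contraction of a \<open>t\<close>-maximal ideal of \<open>T\<close>, which contains \<open>P\<close> and therefore equals it.\<close>

lemma max_t_closed_T_contracts:
  assumes t: "t_closed T M" and ess: "\<And>N. max_t_closed R N \<Longrightarrow> essential R N"
    and P: "max_t_closed T P" "P \<noteq> M"
  shows "max_t_closed R (P \<inter> B)"
proof -
  interpret R: domain R by (rule R_domain)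
  note mP = max_t_closedD[OF P(1)]
  have pP: "primeideal P T" by (rule max_t_closed_prime[OF P(1)])
  then interpret P: primeideal P T .
  note notM = max_t_closed_T_incomparable_M[OF t P]
  have tc: "t_closed R (P \<inter> B)" by (rule t_closed_contraction[OF pP notM(1) mP(1)])
  have "P \<inter> B \<noteq> {\<zero>}"
  proof
    assume "P \<inter> B = {\<zero>}"
    then show False using notM(2) M.zero_closed by simp
  qed
  then obtain N where N: "max_t_closed R N" "P \<inter> B \<subseteq> N"
    using R.t_closed_in_max_t_closed[OF tc] mP(3) by auto
  have "\<not> M \<subseteq> N"
    using R.primes_in_essential_comparable[OF M_prime_R prime_contraction[OF pP] ess[OF N(1)] _ N(2)] notM
    by blast
  then obtain P' where P': "max_t_closed T P'" "\<not> M \<subseteq> P'" "N = P' \<inter> B"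
    by (rule max_t_closed_R_is_contraction[OF N(1)])
  have "P \<subseteq> P'"
    by (rule contraction_subset_imp_subset[OF pP max_t_closed_prime[OF P'(1)] P'(2)]) (use N(2) P'(3) in blast)
  then have "P' = P" using mP(4) max_t_closedD[OF P'(1)] by blast
  then show ?thesis using N(1) P'(3) by simp
qed

lemma coset_eq_iff:
  assumes "x \<in> carrier T" "y \<in> carrier T"
  shows "M +> x = M +> y \<longleftrightarrow> (\<exists>m\<in>M. x = m \<oplus> y)"
proof
  assume "M +> x = M +> y"
  then have "x \<in> M +> y" using M.a_rcos_self[OF assms(1)] by simp
  then show "\<exists>m\<in>M. x = m \<oplus> y" by (auto simp: a_r_coset_def')
next
  assume "\<exists>m\<in>M. x = m \<oplus> y"
  then have "x \<in> M +> y" by (auto simp: a_r_coset_def')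
  then show "M +> x = M +> y" using M.a_repr_independence' assms by blast
qed

text \<open>Comparing \<open>m t\<close> and \<open>m\<close> locally at \<open>M\<close> exhibits the residue of \<open>t\<close> as a fraction of residues of
elements of \<open>R\<close>.\<close>

lemma residue_field_fractions:
  assumes "essential R M" "t \<in> carrier T"
  shows "\<exists>s\<in>B - M. s \<otimes> t \<in> B"
proof -
  obtain m where m: "m \<in> M" "m \<noteq> \<zero>" by (rule nonzero_in_M)
  have mc: "m \<in> carrier T" using m(1) by (rule M.Icarr)
  have tm: "m \<otimes> t \<in> B" "m \<in> B" using m assms(2) M.I_r_closed M_B by blast+
  from assms(1) tm show ?thesis
  proof (cases rule: essential_RE)
    case (1 s c)
    have sc: "s \<in> carrier T" "c \<in> carrier T" using 1 by (simp_all add: B_carrier)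
    have "m \<otimes> (s \<otimes> t) = m \<otimes> c" using 1(4) mc sc assms(2) by (simp add: m_ac)
    then have "s \<otimes> t = c" using m_lcancel[OF m(2) mc] sc assms(2) by simp
    then show ?thesis using 1 by blast
  next
    case (2 s c)
    have sc: "s \<in> carrier T" "c \<in> carrier T" using 2 by (simp_all add: B_carrier)
    have "m \<otimes> s = m \<otimes> (c \<otimes> t)" using 2(4) mc sc assms(2) by (simp add: m_ac)
    then have eq: "s = c \<otimes> t" using m_lcancel[OF m(2) mc] sc assms(2) by simp
    then have "c \<notin> M" using 2(2) M.I_r_closed assms(2) by blast
    then show ?thesis using 2 eq by blast
  qed
qed

text \<open>The composite of two valuations is a valuation. If \<open>s a = b t\<close> with \<open>s \<notin> M\<close>, one may pass to \<open>v a = b w\<close>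
with \<open>v\<close> congruent to \<open>1\<close> modulo \<open>M\<close>. The residue of \<open>w\<close> is a fraction \<open>(f w) / f\<close> over \<open>D\<close>, and comparing
numerator and denominator locally over \<open>D\<close> shows that \<open>w\<close> or its inverse is locally in \<open>R\<close>, up to
elements of \<open>M\<close>, which lie in \<open>R\<close> anyway.\<close>

lemma essential_over_M:
  assumes fr: "\<And>t. t \<in> carrier T \<Longrightarrow> \<exists>s\<in>B - M. s \<otimes> t \<in> B"
    and essM: "essential T M"
    and P: "primeideal P R" "M \<subseteq> P"
    and res: "\<And>a b. \<lbrakk> a \<in> B; b \<in> B \<rbrakk> \<Longrightarrow> \<exists>s\<in>B - P. \<exists>c\<in>B. M +> (s \<otimes> a) = M +> (b \<otimes> c) \<or> M +> (s \<otimes> b) = M +> (a \<otimes> c)"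
  shows "essential R P"
proof (rule essential_RI)
  note p = prime_R[OF P(1)]
  note i = ideal_R[OF p(1)]
  have half: "\<exists>s\<in>B - P. \<exists>c\<in>B. s \<otimes> a = b \<otimes> c \<or> s \<otimes> b = a \<otimes> c"
    if ab: "a \<in> B" "b \<in> B" and st: "s \<in> carrier T" "s \<notin> M" "t \<in> carrier T" "s \<otimes> a = b \<otimes> t" for a b s t
  proof -
    have abc: "a \<in> carrier T" "b \<in> carrier T" using ab by (simp_all add: B_carrier)
    obtain u n where u: "u \<in> carrier T" "n \<in> M" "u \<otimes> s = \<one> \<oplus> n"
      by (rule inverse_modulo_M[OF st(1,2)])
    define v where "v = u \<otimes> s"
    define w where "w = u \<otimes> t"
    have v: "v \<in> B" "v \<notin> P"
      using one_plus_M[OF u(2)] one_plus_M_notin[OF p(1) P(2) p(2) u(2)] u(3) by (simp_all add: v_def)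
    have vc: "v \<in> carrier T" using v(1) by (rule B_carrier)
    have wc: "w \<in> carrier T" using u(1) st(3) by (simp add: w_def)
    have va: "v \<otimes> a = b \<otimes> w"
    proof -
      have "v \<otimes> a = u \<otimes> (s \<otimes> a)" using u(1) st(1) abc by (simp add: v_def m_assoc)
      also have "\<dots> = b \<otimes> w" unfolding st(4) w_def using u(1) st(3) abc by (simp add: m_lcomm)
      finally show ?thesis .
    qed
    obtain f where f: "f \<in> B" "f \<notin> M" "f \<otimes> w \<in> B" using fr[OF wc] by blast
    have fc: "f \<in> carrier T" using f(1) by (rule B_carrier)
    obtain e c where ec: "e \<in> B" "e \<notin> P" "c \<in> B"
      and cong: "M +> (e \<otimes> (f \<otimes> w)) = M +> (f \<otimes> c) \<or> M +> (e \<otimes> f) = M +> ((f \<otimes> w) \<otimes> c)"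
      using res[OF f(3,1)] by blast
    have ecc: "e \<in> carrier T" "c \<in> carrier T" using ec by (simp_all add: B_carrier)
    have cancel: "\<exists>n\<in>M. x = y \<oplus> n"
      if xy: "x \<in> carrier T" "y \<in> carrier T" and eq: "M +> (f \<otimes> x) = M +> (f \<otimes> y)" for x y
    proof -
      obtain k where k: "k \<in> M" "f \<otimes> x = k \<oplus> f \<otimes> y"
        using coset_eq_iff[of "f \<otimes> x" "f \<otimes> y"] fc xy eq by auto
      have kc: "k \<in> carrier T" using k(1) by (rule M.Icarr)
      have "f \<otimes> ((\<ominus> y) \<oplus> x) = (\<ominus> (f \<otimes> y)) \<oplus> f \<otimes> x" using fc xy by (simp add: r_distr r_minus)
      also have "\<dots> = k" unfolding k(2) using fc xy kc by (simp add: a_lcomm l_neg)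
      finally have "(\<ominus> y) \<oplus> x \<in> M" using M_cancel[OF fc, of "(\<ominus> y) \<oplus> x"] f(2) k(1) xy by simp
      moreover have "x = y \<oplus> ((\<ominus> y) \<oplus> x)" using xy by (simp add: r_neg2)
      ultimately show ?thesis by blast
    qed
    from cong show ?thesis
    proof
      assume "M +> (e \<otimes> (f \<otimes> w)) = M +> (f \<otimes> c)"
      then have "M +> (f \<otimes> (e \<otimes> w)) = M +> (f \<otimes> c)" using ecc fc wc by (simp add: m_lcomm)
      then obtain n where n: "n \<in> M" "e \<otimes> w = c \<oplus> n" using cancel[of "e \<otimes> w" c] ecc wc by auto
      then have ew: "e \<otimes> w \<in> B" using ec(3) M_B B_add by metis
      have "(e \<otimes> v) \<otimes> a = e \<otimes> (b \<otimes> w)" unfolding va[symmetric] using ecc vc abc by (simp add: m_assoc)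
      also have "\<dots> = b \<otimes> (e \<otimes> w)" using ecc wc abc by (simp add: m_lcomm)
      finally have "(e \<otimes> v) \<otimes> a = b \<otimes> (e \<otimes> w)" .
      moreover have "e \<otimes> v \<in> B - P" using B_mult[OF ec(1) v(1)] p(3)[OF ec(1) v(1)] ec(2) v(2) by blast
      ultimately show ?thesis using ew by blast
    next
      assume "M +> (e \<otimes> f) = M +> ((f \<otimes> w) \<otimes> c)"
      then have "M +> (f \<otimes> e) = M +> (f \<otimes> (w \<otimes> c))"
        unfolding m_comm[OF ecc(1) fc] m_assoc[OF fc wc ecc(2)] .
      then obtain n where n: "n \<in> M" "e = w \<otimes> c \<oplus> n" using cancel[of e "w \<otimes> c"] ecc wc by auto
      have wcB: "w \<otimes> c \<in> B" by (rule B_subtract_M[OF _ n(1)]) (use n(2) ec(1) wc ecc in auto)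
      moreover have "w \<otimes> c \<notin> P"
      proof
        assume "w \<otimes> c \<in> P"
        then have "e \<in> P" using n P(2) i(3)[of "w \<otimes> c" n] by auto
        then show False using ec(2) by simp
      qed
      moreover have "(w \<otimes> c) \<otimes> b = a \<otimes> (c \<otimes> v)"
      proof -
        have "(w \<otimes> c) \<otimes> b = c \<otimes> (b \<otimes> w)" using ecc wc abc by (simp add: m_ac)
        also have "\<dots> = a \<otimes> (c \<otimes> v)" unfolding va[symmetric] using ecc vc abc by (simp add: m_ac)
        finally show ?thesis .
      qed
      ultimately show ?thesis using B_mult[OF ec(3) v(1)] by blast
    qed
  qed
  fix a b assume ab: "a \<in> B" "b \<in> B"
  from essM B_carrier[OF ab(1)] B_carrier[OF ab(2)]
  show "\<exists>s\<in>B - P. \<exists>c\<in>B. s \<otimes> a = b \<otimes> c \<or> s \<otimes> b = a \<otimes> c"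
  proof (cases rule: essentialE)
    case (1 s c) then show ?thesis using half[OF ab] by blast
  next
    case (2 s c) then show ?thesis using half[OF ab(2,1)] by blast
  qed
qed

text \<open>Let \<open>t\<close> be an inverse of \<open>a\<close> modulo \<open>M\<close> in \<open>T\<close>. The ideal \<open>W\<close> of all \<open>x \<in> R\<close> with \<open>t x \<in> R\<close> is divisorial
and contains \<open>M\<close> and \<open>a\<close>. As no \<open>t\<close>-maximal ideal contains both, \<open>W\<close> is all of \<open>R\<close>, that is,
\<open>t \<in> R\<close>.\<close>

lemma unit_modulo_M:
  assumes a: "a \<in> B" "\<And>N. max_t_closed R N \<Longrightarrow> M \<subseteq> N \<Longrightarrow> a \<notin> N"
  obtains t n where "t \<in> B" "n \<in> M" "t \<otimes> a = \<one> \<oplus> n"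
proof -
  interpret R: domain R by (rule R_domain)
  have ac: "a \<in> carrier T" using a(1) by (rule B_carrier)
  have "a \<notin> M"
  proof -
    obtain N where "max_t_closed R N" "M \<subseteq> N"
      using R.t_closed_in_max_t_closed[OF M_t_closed] M_nonzero one_notin_M by auto
    then show ?thesis using a(2) by blast
  qed
  then obtain t n where t: "t \<in> carrier T" "n \<in> M" "t \<otimes> a = \<one> \<oplus> n"
    by (rule inverse_modulo_M[OF ac])
  obtain m where m: "m \<in> M" "m \<noteq> \<zero>" by (rule nonzero_in_M)
  have mc: "m \<in> carrier T" using m(1) by (rule M.Icarr)
  define W where "W = {x \<in> B. t \<otimes> x \<in> B}"
  have MW: "M \<subseteq> W" using M_B M.I_l_closed t(1) by (auto simp: W_def)
  have aW: "a \<in> W" using a(1) t(3) one_plus_M[OF t(2)] by (simp add: W_def)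
  have "t_closed R W"
  proof (rule t_closed_RI)
    fix S x assume S: "finite S" "S \<subseteq> W" and xB: "x \<in> B"
      and hull: "\<And>a b. \<lbrakk> a \<in> B; b \<in> B; \<And>s. s \<in> S \<Longrightarrow> \<exists>c\<in>B. a \<otimes> s = b \<otimes> c \<rbrakk> \<Longrightarrow> \<exists>c\<in>B. a \<otimes> x = b \<otimes> c"
    have xc: "x \<in> carrier T" using xB by (rule B_carrier)
    have "\<exists>c\<in>B. (m \<otimes> t) \<otimes> x = m \<otimes> c"
    proof (rule hull)
      show "m \<otimes> t \<in> B" "m \<in> B" using m t M.I_r_closed M_B by blast+
      fix s assume "s \<in> S"
      then have s: "s \<in> B" "t \<otimes> s \<in> B" using S by (auto simp: W_def)
      have "(m \<otimes> t) \<otimes> s = m \<otimes> (t \<otimes> s)" using mc t B_carrier[OF s(1)] by (simp add: m_assoc)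
      then show "\<exists>c\<in>B. (m \<otimes> t) \<otimes> s = m \<otimes> c" using s(2) by blast
    qed
    then obtain c where c: "c \<in> B" "(m \<otimes> t) \<otimes> x = m \<otimes> c" by blast
    then have "m \<otimes> (t \<otimes> x) = m \<otimes> c" using mc t xc by (simp add: m_assoc)
    then have "t \<otimes> x = c" using m_lcancel[OF m(2) mc] t xc B_carrier[OF c(1)] by simp
    then show "x \<in> W" using c(1) xB by (simp add: W_def)
  qed (auto simp: W_def)
  moreover have "W \<noteq> {\<zero>}" using m MW by blast
  ultimately have "\<one> \<in> W"
    using R.t_closed_in_max_t_closed[of W] a(2) MW aW by (simp, metis order_trans subsetD)
  then have "t \<in> B" using t(1) by (simp add: W_def)
  then show ?thesis using that t by blast
qed

text \<open>An element of a proper ideal above \<open>M\<close> is no unit modulo \<open>M\<close>, so the \<open>t\<close>-maximal ideals above \<open>M\<close>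
cover \<open>P\<close>, and prime avoidance applies.\<close>

lemma maximal_over_M_is_max_t_closed:
  assumes fin: "finite {N. max_t_closed R N \<and> M \<subseteq> N}" and P: "maximalideal P R" "M \<subseteq> P"
  shows "max_t_closed R P"
proof -
  interpret R: domain R by (rule R_domain)
  interpret P: maximalideal P R by fact
  have one: "\<one> \<notin> P" using P.I_notcarr P.one_imp_carrier by auto
  have sub: "P \<subseteq> \<Union>{N. max_t_closed R N \<and> M \<subseteq> N}"
  proof
    fix a assume a: "a \<in> P"
    have aB: "a \<in> B" using P.Icarr[OF a] by simp
    show "a \<in> \<Union>{N. max_t_closed R N \<and> M \<subseteq> N}"
    proof (rule ccontr)
      assume "\<not> ?thesis"
      then obtain t n where t: "t \<in> B" "n \<in> M" "t \<otimes> a = \<one> \<oplus> n"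
        by (blast intro: unit_modulo_M[OF aB])
      have "t \<otimes> a \<in> P" by (rule ideal_R(4)[OF P.is_ideal a t(1)])
      then show False using one_plus_M_notin[OF P.is_ideal P(2) one t(2)] t(3) by simp
    qed
  qed
  obtain N where N: "N \<in> {N. max_t_closed R N \<and> M \<subseteq> N}" "P \<subseteq> N"
    by (rule R.prime_avoidance[OF fin _ P.is_ideal sub]) (auto intro: R.max_t_closed_prime)
  then have mN: "max_t_closed R N" by simp
  interpret N: primeideal N R by (rule R.max_t_closed_prime[OF mN])
  have "N = P" using P.I_maximal[OF N.is_ideal N(2) N.a_subset] N.I_notcarr by simp
  then show ?thesis using mN by simp
qed

text \<open>The pullback theorem with the conditions on \<open>D = R / M\<close> expressed through the maximal ideals of
\<open>R\<close> above \<open>M\<close>, where the third condition says that \<open>T / M\<close> is the quotient field of \<open>D\<close>.\<close>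

theorem Krull_type_pullback_iff:
  "Krull_type_domain R \<longleftrightarrow>
     finite {P. maximalideal P R \<and> M \<subseteq> P} \<and>
     (\<forall>P. maximalideal P R \<and> M \<subseteq> P \<longrightarrow> essential (R Quot M) ((+>\<^bsub>R\<^esub>) M ` P)) \<and>
     (\<forall>t\<in>carrier T. \<exists>s\<in>B - M. s \<otimes> t \<in> B) \<and>
     Krull_type_domain T \<and> essential T M"
    (is "_ \<longleftrightarrow> ?fin \<and> ?res \<and> ?frac \<and> _ \<and> _")
proof -
  interpret R: domain R by (rule R_domain)
  have res_iff: "essential (R Quot M) ((+>\<^bsub>R\<^esub>) M ` P) \<longleftrightarrow>
    (\<forall>a\<in>B. \<forall>b\<in>B. \<exists>s\<in>B - P. \<exists>c\<in>B. M +> (s \<otimes> a) = M +> (b \<otimes> c) \<or> M +> (s \<otimes> b) = M +> (a \<otimes> c))"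
    if "ideal P R" "M \<subseteq> P" for P
    using R.essential_quotient_iff[OF M_ideal_R that] by (simp add: a_r_coset_def')
  have maxR: "ideal P R" "primeideal P R" if "maximalideal P R" for P
    using that R.maximalideal_prime by (auto simp: maximalideal_def)
  show ?thesis
  proof
    assume KR: "Krull_type_domain R"
    then have essR: "\<And>N. max_t_closed R N \<Longrightarrow> essential R N"
      and finR: "\<And>x. x \<in> B \<Longrightarrow> x \<noteq> \<zero> \<Longrightarrow> finite {N. max_t_closed R N \<and> x \<in> N}"
      by (auto simp: R.Krull_type_domain_iff)
    obtain m where m: "m \<in> M" "m \<noteq> \<zero>" by (rule nonzero_in_M)
    have mB: "m \<in> B" using m(1) by (rule M_B)
    have mc: "m \<in> carrier T" using mB by (rule B_carrier)
    have finM: "finite {N. max_t_closed R N \<and> M \<subseteq> N}"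
      by (rule finite_subset[OF _ finR[OF mB m(2)]]) (use m(1) in auto)
    have maxt: "max_t_closed R P" if "maximalideal P R" "M \<subseteq> P" for P
      using maximal_over_M_is_max_t_closed[OF finM that] .
    obtain N0 where N0: "max_t_closed R N0" "M \<subseteq> N0"
      using R.t_closed_in_max_t_closed[OF M_t_closed] M_nonzero one_notin_M by auto
    have essM: "essential R M" by (rule essential_subset[OF essR[OF N0(1)] N0(2)])
    have essTM: "essential T M" by (rule essential_lift[OF essM]) blast
    have tM: "t_closed T M" by (rule M_t_closed_in_T[OF essTM])
    have ?fin by (rule finite_subset[OF _ finM]) (use maxt in blast)
    moreover have ?res
    proof (intro allI impI)
      fix P assume P: "maximalideal P R \<and> M \<subseteq> P"
      have "essential R P" using essR maxt P by blast
      then show "essential (R Quot M) ((+>\<^bsub>R\<^esub>) M ` P)"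
        unfolding res_iff[OF maxR(1)[OF conjunct1[OF P]] conjunct2[OF P]]
        by (metis DiffI essential_RE)
    qed
    moreover have ?frac using residue_field_fractions[OF essM] by blast
    moreover have "Krull_type_domain T"
      unfolding Krull_type_domain_iff
    proof (intro conjI allI impI ballI)
      fix P assume P: "max_t_closed T P"
      show "essential T P"
      proof (cases "P = M")
        case False
        show ?thesis
          by (rule essential_lift[OF essR[OF max_t_closed_T_contracts[OF tM essR P False]]]) simp_all
      qed (simp add: essTM)
    next
      fix x assume x: "x \<in> carrier T - {\<zero>}"
      \<comment> \<open>contraction maps these ideals injectively to \<open>t\<close>-maximal ideals of \<open>R\<close> containing \<open>m x\<close>\<close>
    let ?A = "{P. max_t_closed T P \<and> x \<in> P} - {M}"
      have mx: "m \<otimes> x \<in> B" "m \<otimes> x \<noteq> \<zero>"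
        using M_B[OF M.I_r_closed[OF m(1)]] x mc m(2) by (auto simp: integral_iff)
      have "(\<lambda>P. P \<inter> B) ` ?A \<subseteq> {N. max_t_closed R N \<and> m \<otimes> x \<in> N}"
      proof
        fix N assume "N \<in> (\<lambda>P. P \<inter> B) ` ?A"
        then obtain P where P: "max_t_closed T P" "x \<in> P" "P \<noteq> M" "N = P \<inter> B" by blast
        interpret P: primeideal P T by (rule max_t_closed_prime[OF P(1)])
        have "m \<otimes> x \<in> P" by (rule P.I_l_closed[OF P(2) mc])
        then show "N \<in> {N. max_t_closed R N \<and> m \<otimes> x \<in> N}"
          using max_t_closed_T_contracts[OF tM essR P(1,3)] mx(1) P(4) by blast
      qed
      then have "finite ((\<lambda>P. P \<inter> B) ` ?A)" using finR[OF mx] by (rule finite_subset)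
      moreover have "inj_on (\<lambda>P. P \<inter> B) ?A"
      proof (rule inj_onI)
        fix P Q assume PQ: "P \<in> ?A" "Q \<in> ?A" "P \<inter> B = Q \<inter> B"
        have "P \<subseteq> Q" using PQ max_t_closed_T_incomparable_M(1)[OF tM]
          by (intro contraction_subset_imp_subset[of P Q]) (auto intro: max_t_closed_prime)
        moreover have "Q \<subseteq> P" using PQ max_t_closed_T_incomparable_M(1)[OF tM]
          by (intro contraction_subset_imp_subset[of Q P]) (auto intro: max_t_closed_prime)
        ultimately show "P = Q" by blast
      qed
      ultimately have "finite ?A" by (rule finite_imageD)
      then show "finite {P. max_t_closed T P \<and> x \<in> P}" by simp
    qed
    ultimately show "?fin \<and> ?res \<and> ?frac \<and> Krull_type_domain T \<and> essential T M" using essTM by blast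
  next
    assume "?fin \<and> ?res \<and> ?frac \<and> Krull_type_domain T \<and> essential T M"
    then have fin: ?fin and res: ?res and frac: ?frac and KT: "Krull_type_domain T"
      and essTM: "essential T M" by blast+
    have essT: "\<And>P. max_t_closed T P \<Longrightarrow> essential T P"
      and finT: "\<And>x. x \<in> carrier T \<Longrightarrow> x \<noteq> \<zero> \<Longrightarrow> finite {P. max_t_closed T P \<and> x \<in> P}"
      using KT by (auto simp: Krull_type_domain_iff)
    have essP: "essential R P" if P: "maximalideal P R" "M \<subseteq> P" for P
    proof (rule essential_over_M[OF _ essTM maxR(2)[OF P(1)] P(2)])
      show "\<exists>s\<in>B - M. s \<otimes> t \<in> B" if "t \<in> carrier T" for t using frac that by blast
      have "essential (R Quot M) ((+>\<^bsub>R\<^esub>) M ` P)" using res P by blast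
      then show "\<exists>s\<in>B - P. \<exists>c\<in>B. M +> (s \<otimes> a) = M +> (b \<otimes> c) \<or> M +> (s \<otimes> b) = M +> (a \<otimes> c)"
        if "a \<in> B" "b \<in> B" for a b
        using that unfolding res_iff[OF maxR(1)[OF P(1)] P(2)] by blast
    qed
    have over: "maximalideal N R" if N: "max_t_closed R N" "M \<subseteq> N" for N
    proof -
      note mN = max_t_closedD[OF N(1)]
      interpret N: primeideal N R by (rule R.max_t_closed_prime[OF N(1)])
      obtain P where P: "maximalideal P R" "N \<subseteq> P"
        by (rule R.maximalideal_exists[OF N.is_ideal mN(3)])
      have MP: "M \<subseteq> P" using N(2) P(2) by blast
      have "t_closed R P" by (rule R.essential_prime_t_closed[OF maxR(2)[OF P(1)] essP[OF P(1) MP]])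
      moreover have "\<one>\<^bsub>R\<^esub> \<notin> P" using prime_R(2)[OF maxR(2)[OF P(1)]] by simp
      ultimately have "P = N" using mN(4) P(2) by blast
      then show ?thesis using P(1) by simp
    qed
    show "Krull_type_domain R"
      unfolding R.Krull_type_domain_iff
    proof (intro conjI allI impI ballI)
      fix N assume N: "max_t_closed R N"
      show "essential R N"
      proof (cases "M \<subseteq> N")
        case True
        then show ?thesis using essP over N by blast
      next
        case False
        then obtain P where P: "max_t_closed T P" "\<not> M \<subseteq> P" "N = P \<inter> B"
          by (rule max_t_closed_R_is_contraction[OF N])
        show ?thesis unfolding P(3)
          by (rule essential_contraction[OF max_t_closed_prime[OF P(1)] P(2) essT[OF P(1)]])
      qed
    next
      fix x assume "x \<in> carrier R - {\<zero>\<^bsub>R\<^esub>}"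
      then have x: "x \<in> carrier T" "x \<noteq> \<zero>" using B_carrier by auto
      have "{N. max_t_closed R N \<and> x \<in> N} \<subseteq>
          {P. maximalideal P R \<and> M \<subseteq> P} \<union> (\<lambda>P. P \<inter> B) ` {P. max_t_closed T P \<and> x \<in> P}"
      proof
        fix N assume N: "N \<in> {N. max_t_closed R N \<and> x \<in> N}"
        show "N \<in> {P. maximalideal P R \<and> M \<subseteq> P} \<union> (\<lambda>P. P \<inter> B) ` {P. max_t_closed T P \<and> x \<in> P}"
        proof (cases "M \<subseteq> N")
          case True
          then show ?thesis using over N by blast
        next
          case False
          obtain P where P: "max_t_closed T P" "N = P \<inter> B"
            using max_t_closed_R_is_contraction[OF _ False] N by blast
          then show ?thesis using N by blast
        qed
      qed
      then show "finite {N. max_t_closed R N \<and> x \<in> N}"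
        using fin finT[OF x] by (auto intro: finite_subset)
    qed
  qed
qed

end

section \<open>The pullback theorem\<close>

lemma zero_FactRing: "\<zero>\<^bsub>R Quot I\<^esub> = I"
  by (simp add: FactRing_def)

text \<open>Cosets and their operations do not involve the carrier of the ambient ring, so \<open>R / M\<close> is literally
the given subring of \<open>T / M\<close>.\<close>

lemma (in ring) pullback_quotient_eq:
  assumes M: "ideal M R" and D: "D \<subseteq> carrier (R Quot M)"
  shows "(pullback_ring R M D) Quot M = (R Quot M)\<lparr>carrier := D\<rparr>"
proof -
  have "(\<Union>x\<in>{x \<in> carrier R. M +> x \<in> D}. {M +> x}) = D"
  proof (intro equalityI subsetI)
    fix Y assume Y: "Y \<in> D"
    then obtain x where "x \<in> carrier R" "Y = M +> x"
      using D unfolding FactRing_def A_RCOSETS_def' by auto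
    then show "Y \<in> (\<Union>x\<in>{x \<in> carrier R. M +> x \<in> D}. {M +> x})" using Y by blast
  qed blast
  then have "a_rcosets\<^bsub>pullback_ring R M D\<^esub> M = D"
    unfolding A_RCOSETS_def' pullback_ring_def by (simp add: a_r_coset_def')
  then show ?thesis
    by (simp add: FactRing_def pullback_ring_def a_r_coset_def' rcoset_mult_def set_add_def' fun_eq_iff)
qed

theorem proposition4p1:
  fixes T :: "('a, 'm) ring_scheme" and M :: "'a set" and D :: "'a set set"
  assumes "domain T"
    and "maximalideal M T"
    and "M \<noteq> {\<zero>\<^bsub>T\<^esub>}"
    and "subring D (T Quot M)"
    and "D \<noteq> carrier (T Quot M)"
  shows "Krull_type_domain (pullback_ring T M D) \<longleftrightarrow>
      semilocal ((T Quot M)\<lparr>carrier := D\<rparr>) \<and>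
      Bezout_domain ((T Quot M)\<lparr>carrier := D\<rparr>) \<and>
      is_quotient_field (T Quot M) D \<and>
      Krull_type_domain T \<and>
      valuation_domain (localization T M)"
proof -
  interpret T: domain T by fact
  interpret M: maximalideal M T by fact
  let ?K = "T Quot M" and ?\<phi> = "\<lambda>x. M +>\<^bsub>T\<^esub> x"
  interpret K: field ?K by (rule M.quotient_is_field[OF T.is_cring])
  interpret \<phi>: ring_hom_ring T ?K ?\<phi> by (rule M.rcos_ring_hom_ring)
  note D = subringE[OF assms(4)]
  define B where "B = {x \<in> carrier T. ?\<phi> x \<in> D}"
  have R_eq: "pullback_ring T M D = T\<lparr>carrier := B\<rparr>" by (simp add: pullback_ring_def B_def)
  have \<phi>_zero_iff: "?\<phi> x = \<zero>\<^bsub>?K\<^esub> \<longleftrightarrow> x \<in> M" if "x \<in> carrier T" for x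
  proof -
    show ?thesis
      unfolding zero_FactRing using T.a_rcos_zero[OF M.is_ideal, of x] M.rcos_const_imp_mem[OF that] by metis
  qed
  have K_carrier: "carrier ?K = ?\<phi> ` carrier T" by (rule T.carrier_quotient)
  interpret pullback_square T M B
  proof (intro pullback_square.intro pullback_square_axioms.intro)
    show "domain T" "maximalideal M T" "M \<noteq> {\<zero>\<^bsub>T\<^esub>}" by fact+
    show "subring B T"
      by (rule T.subringI) (use D in \<open>auto simp: B_def\<close>)
    show "M \<subseteq> B"
    proof
      fix x assume x: "x \<in> M"
      have xc: "x \<in> carrier T" using x by (rule M.Icarr)
      have "?\<phi> x = \<zero>\<^bsub>?K\<^esub>" using \<phi>_zero_iff[OF xc] x by blast
      then show "x \<in> B" using xc D(2) by (simp add: B_def)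
    qed
    show "B \<noteq> carrier T"
    proof
      assume "B = carrier T"
      then have "carrier ?K \<subseteq> D" unfolding K_carrier by (auto simp: B_def)
      then show False using D(1) assms(5) by blast
    qed
  qed
  interpret R: domain R by (rule R_domain)
  have quot: "R Quot M = ?K\<lparr>carrier := D\<rparr>"
    using T.pullback_quotient_eq[OF M.is_ideal D(1)] by (simp add: R_eq)
  have domD: "domain (?K\<lparr>carrier := D\<rparr>)" by (rule K.subring_is_domain[OF assms(4)])
  interpret D: domain "R Quot M" unfolding quot by (rule domD)
  have semi: "semilocal (?K\<lparr>carrier := D\<rparr>) \<longleftrightarrow> finite {P. maximalideal P R \<and> M \<subseteq> P}"
    unfolding semilocal_def quot[symmetric] by (rule R.finite_maximalideals_quotient_iff[OF M_ideal_R])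
  have maxD: "maximalideal P' (R Quot M) \<longleftrightarrow> (\<exists>P. maximalideal P R \<and> M \<subseteq> P \<and> P' = (+>\<^bsub>R\<^esub>) M ` P)" for P'
    by (rule R.maximalideal_quotient_iff[OF M_ideal_R])
  have Bez: "Bezout_domain (?K\<lparr>carrier := D\<rparr>) \<longleftrightarrow>
      (\<forall>P. maximalideal P R \<and> M \<subseteq> P \<longrightarrow> essential (R Quot M) ((+>\<^bsub>R\<^esub>) M ` P))"
    if "semilocal (?K\<lparr>carrier := D\<rparr>)"
  proof -
    have "finite {P'. maximalideal P' (R Quot M)}" using that by (simp add: semilocal_def quot)
    from D.semilocal_Bezout_iff[OF this] show ?thesis unfolding quot[symmetric] maxD by blast
  qed
  have qf: "is_quotient_field ?K D \<longleftrightarrow> (\<forall>t\<in>carrier T. \<exists>s\<in>B - M. s \<otimes>\<^bsub>T\<^esub> t \<in> B)"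
  proof
    assume q: "is_quotient_field ?K D"
    show "\<forall>t\<in>carrier T. \<exists>s\<in>B - M. s \<otimes>\<^bsub>T\<^esub> t \<in> B"
    proof
      fix t assume t: "t \<in> carrier T"
      then have "?\<phi> t \<in> {a \<otimes>\<^bsub>?K\<^esub> inv\<^bsub>?K\<^esub> b |a b. a \<in> D \<and> b \<in> D - {\<zero>\<^bsub>?K\<^esub>}}"
        using q unfolding is_quotient_field_def K_carrier by blast
      then obtain a b where ab: "a \<in> D" "b \<in> D" "b \<noteq> \<zero>\<^bsub>?K\<^esub>" "?\<phi> t = a \<otimes>\<^bsub>?K\<^esub> inv\<^bsub>?K\<^esub> b" by blast
      obtain s where s: "s \<in> carrier T" "b = ?\<phi> s" using D(1) ab(2) unfolding K_carrier by blast
      have bu: "b \<in> Units ?K" "a \<in> carrier ?K" using ab D(1) by (auto simp: K.field_Units)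
      have "?\<phi> (s \<otimes>\<^bsub>T\<^esub> t) = b \<otimes>\<^bsub>?K\<^esub> (a \<otimes>\<^bsub>?K\<^esub> inv\<^bsub>?K\<^esub> b)" using s t ab(4) \<phi>.hom_mult by simp
      also have "\<dots> = a" using bu K.Units_closed[OF bu(1)] K.m_lcomm[of b a "inv\<^bsub>?K\<^esub> b"] by simp
      finally have "s \<otimes>\<^bsub>T\<^esub> t \<in> B" using ab(1) s(1) t by (simp add: B_def)
      moreover have "s \<in> B - M" using s ab(2,3) \<phi>_zero_iff by (auto simp: B_def)
      ultimately show "\<exists>s\<in>B - M. s \<otimes>\<^bsub>T\<^esub> t \<in> B" by blast
    qed
  next
    assume fr: "\<forall>t\<in>carrier T. \<exists>s\<in>B - M. s \<otimes>\<^bsub>T\<^esub> t \<in> B"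
    have "carrier ?K = {a \<otimes>\<^bsub>?K\<^esub> inv\<^bsub>?K\<^esub> b |a b. a \<in> D \<and> b \<in> D - {\<zero>\<^bsub>?K\<^esub>}}"
    proof (intro equalityI subsetI)
      fix x assume "x \<in> carrier ?K"
      then obtain t where t: "t \<in> carrier T" "x = ?\<phi> t" unfolding K_carrier by blast
      obtain s where s: "s \<in> B" "s \<notin> M" "s \<otimes>\<^bsub>T\<^esub> t \<in> B" using fr t(1) by blast
      have sc: "s \<in> carrier T" "?\<phi> s \<in> D" "?\<phi> (s \<otimes>\<^bsub>T\<^esub> t) \<in> D" using s by (auto simp: B_def)
      have s0: "?\<phi> s \<noteq> \<zero>\<^bsub>?K\<^esub>" using \<phi>_zero_iff[OF sc(1)] s(2) by simp
      have su: "?\<phi> s \<in> Units ?K" using s0 sc(2) D(1) by (auto simp: K.field_Units)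
      have xK: "x \<in> carrier ?K" by fact
      have "?\<phi> (s \<otimes>\<^bsub>T\<^esub> t) \<otimes>\<^bsub>?K\<^esub> inv\<^bsub>?K\<^esub> (?\<phi> s) = (x \<otimes>\<^bsub>?K\<^esub> ?\<phi> s) \<otimes>\<^bsub>?K\<^esub> inv\<^bsub>?K\<^esub> (?\<phi> s)"
        using \<phi>.hom_mult[OF sc(1) t(1)] t(2) K.m_comm[of x "?\<phi> s"] xK K.Units_closed[OF su] by simp
      also have "\<dots> = x"
        using K.m_assoc[OF xK K.Units_closed[OF su] K.Units_inv_closed[OF su]] K.Units_r_inv[OF su] xK by simp
      finally have "x = ?\<phi> (s \<otimes>\<^bsub>T\<^esub> t) \<otimes>\<^bsub>?K\<^esub> inv\<^bsub>?K\<^esub> (?\<phi> s)" ..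
      moreover have "?\<phi> s \<in> D - {\<zero>\<^bsub>?K\<^esub>}" using sc(2) s0 by simp
      ultimately show "x \<in> {a \<otimes>\<^bsub>?K\<^esub> inv\<^bsub>?K\<^esub> b |a b. a \<in> D \<and> b \<in> D - {\<zero>\<^bsub>?K\<^esub>}}"
        using sc(3) by blast
    next
      fix x assume "x \<in> {a \<otimes>\<^bsub>?K\<^esub> inv\<^bsub>?K\<^esub> b |a b. a \<in> D \<and> b \<in> D - {\<zero>\<^bsub>?K\<^esub>}}"
      then obtain a b where ab: "a \<in> D" "b \<in> D" "b \<noteq> \<zero>\<^bsub>?K\<^esub>" "x = a \<otimes>\<^bsub>?K\<^esub> inv\<^bsub>?K\<^esub> b" by blast
      have "b \<in> Units ?K" "a \<in> carrier ?K" using ab D(1) by (auto simp: K.field_Units)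
      then show "x \<in> carrier ?K" unfolding ab(4) by simp
    qed
    then show "is_quotient_field ?K D"
      unfolding is_quotient_field_def using K.field_axioms assms(4) by blast
  qed
  show ?thesis
    unfolding R_eq Krull_type_pullback_iff qf T.valuation_domain_localization_iff[OF M_prime]
    using semi Bez by blast
qed

end
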